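(* Let $\Bbbk=\mathbb{C}(q)$, $z=q-q^{-1}$, $U_q=U_q(\mathfrak{q}_n)$ with center $Z_q$. For $m>0$, the image of the bubble $$\zeta_m:=\mathrm{cap}_L\circ\bigl(1_\downarrow\otimes(c\circ o)^{m}\bigr)\circ\mathrm{cup}_R\in\mathrm{End}_{\mathcal{AQ}(z)}(\mathbb{1})$$ under the composite superalgebra homomorphism $\mathrm{End}_{\mathcal{AQ}(z)}(\mathbb{1})\xrightarrow{\widehat{\mathbf{F}}_n}\mathrm{End}(\mathrm{id}_{U_q\text{-smod}})\xrightarrow{\cong}Z_q$ (the second map being evaluation on the identity element of the regular representation) is $$\sum_{i\in\mathtt{I}}(-1)^{p(i)}q^{2|i|-2n-1}\,y_{ii}^{(m)}.$$
   Context: Everything is $\Bbbk$-linear. A supercategory is a category enriched in vector superspaces with parity-preserving maps; $\bar f$ is the parity of a homogeneous $f$. A supernatural transformation $\alpha\colon F\Rightarrow G$ of parity $r$ consists of morphisms $\alpha_X$ of parity $r$ with $Gf\circ\alpha_X=(-1)^{r\bar f}\alpha_Y\circ Ff$. $\mathcal{SE}nd(\mathcal{C})$ is the strict monoidal supercategory of endosuperfunctors of $\mathcal{C}$ and supernatural transformations; $\mathrm{End}(\mathrm{id}_{\mathcal{C}})$ is the superalgebra of supernatural endotransformations of the identity superfunctor. In a strict monoidal supercategory (unit $\mathbb{1}$, identities $1_X$) one has $(f'\otimes g)\circ(f\otimes g')=(-1)^{\bar f\bar g}(f'\circ f)\otimes(g\circ g')$. **The supercategory $\mathcal{AQ}(z)$.**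 $\mathcal{Q}(z)$ is the strict monoidal supercategory generated by objects $\uparrow,\downarrow$; even morphisms $u^+,u^-\colon\uparrow\otimes\uparrow\to\uparrow\otimes\uparrow$, $r^-\colon\uparrow\otimes\downarrow\to\downarrow\otimes\uparrow$, $\mathrm{cap}_L\colon\downarrow\otimes\uparrow\to\mathbb{1}$, $\mathrm{cup}_L\colon\mathbb{1}\to\uparrow\otimes\downarrow$; and an odd morphism $c\colon\uparrow\to\uparrow$; subject to: $u^-u^+=1=u^+u^-$; $l^+r^-=1_{\uparrow\otimes\downarrow}$; $r^-l^+=1_{\downarrow\otimes\uparrow}$; $(u^+\otimes1_\uparrow)(1_\uparrow\otimes u^+)(u^+\otimes1_\uparrow)=(1_\uparrow\otimes u^+)(u^+\otimes1_\uparrow)(1_\uparrow\otimes u^+)$; $u^+-u^-=z\,1_{\uparrow\otimes\uparrow}$; $c^2=-1_\uparrow$; $u^+(c\otimes1_\uparrow)=(1_\uparrow\otimes c)u^+$; $\mathrm{cap}_R(c\otimes1_\downarrow)\mathrm{cup}_L=0=\mathrm{cap}_R\,\mathrm{cup}_L$; $(1_\uparrow\otimes\mathrm{cap}_L)(\mathrm{cup}_L\otimes1_\uparrow)=1_\uparrow$; $(\mathrm{cap}_L\otimes1_\downarrow)(1_\downarrow\otimes\mathrm{cup}_L)=1_\downarrow$, where $l^+:=(\mathrm{cap}_L\otimes1_\uparrow\otimes1_\downarrow)(1_\downarrow\otimes u^+\otimes1_\downarrow)(1_\downarrow\otimes1_\uparrow\otimes\mathrm{cup}_L)$, $\mathrm{cap}_R:=\mathrm{cap}_L\circ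 r^-$; also $\mathrm{cup}_R:=r^-\circ\mathrm{cup}_L\colon\mathbb{1}\to\downarrow\otimes\uparrow$. $\mathcal{AQ}(z)$ is obtained from $\mathcal{Q}(z)$ by adjoining an odd morphism $o\colon\uparrow\to\uparrow$ subject to $o^2=-1_\uparrow$, $u^+(1_\uparrow\otimes o)=(o\otimes1_\uparrow)u^+$, $\mathrm{cap}_R(o\otimes1_\downarrow)\mathrm{cup}_L=0$. **The superalgebra $U_q$.** $\mathtt{I}=\{1,\dots,n,-1,\dots,-n\}$, ordered as integers. For $i,j\in\mathtt{I}$: $p(i)=0$ if $i>0$ and $p(i)=1$ if $i<0$; $p(i,j)=p(i)+p(j)$; $\mathrm{sgn}(i)=(-1)^{p(i)}$; $\varphi(i,j)=\delta_{|i|,|j|}\,\mathrm{sgn}(j)$. $V$ has $\Bbbk$-basis $v_i$ ($i\in\mathtt{I}$) with $v_i$ of parity $p(i)$; $E_{ij}\in\mathrm{End}_\Bbbk(V)$ are the matrix units, of parity $p(i,j)$. Tensor products of superalgebras are multiplied by $(a'\otimes b)(a\otimes b')=(-1)^{\bar a\bar b}a'a\otimes bb'$, and $(A\otimes B)(v\otimes w)=(-1)^{\bar B\bar v}Av\otimes Bw$. Set $$\Theta=\sum_{i,j}q^{\varphi(i,j)}E_{ii}\otimes E_{jj}+z\sum_{i<j}(-1)^{p(i)}(E_{ji}+E_{-j,-i})\otimes E_{ij}=\sum_{i,j}\Theta_{ij}\otimes E_{ij}.$$ $U_q=U_q(\mathfrak{q}_n)$ is the unital associative $\Bbbk$-superalgebra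 generated by $u_{ij}$, $i\le j$, of parity $p(i,j)$, subject to $u_{ii}u_{-i,-i}=1=u_{-i,-i}u_{ii}$ and $L^{12}L^{13}\Theta^{23}=\Theta^{23}L^{13}L^{12}$ in $U_q\otimes\mathrm{End}_\Bbbk(V)^{\otimes2}$, where $L=\sum_{i\le j}u_{ij}\otimes E_{ij}$, $L^{12}=L\otimes 1$, $L^{13}=\sum u_{ij}\otimes1\otimes E_{ij}$, $\Theta^{23}=1\otimes\Theta$. It is a Hopf superalgebra with $\Delta(u_{ij})=\sum_{i\le k\le j}u_{ik}\otimes u_{kj}$, $\varepsilon(u_{ij})=\delta_{ij}$, and antipode $S$ determined by $\sum_{i\le j}S(u_{ij})\otimes E_{ij}=L^{-1}$. Its center is $Z_q=\{x\in U_q: xy=(-1)^{\bar x\bar y}yx\ \forall y\in U_q\}$. Morphisms of $U_q$-supermodules are all (even and odd) linear maps $f$ with $f(xm)=(-1)^{\bar f\bar x}xf(m)$. $V$ is a $U_q$-supermodule via $u_{ij}\mapsto\Theta_{ij}$; $V^*$ has action $(xf)(v)=(-1)^{\bar x\bar f}f(S(x)v)$, with dual basis $v_i^*$. **The superfunctor $\widehat{\mathbf{F}}_n$.** Let $\mathrm{flip}(a\otimes b)=(-1)^{\bar a\bar b}b\otimes a$; $T=\mathrm{flip}\circ\Theta$; $\mathrm{ev}(f\otimes v)=f(v)$; $\mathrm{coev}(1)=\sum_iv_i\otimes v_i^*$; $J=\sum_i(-1)^{p(i)}E_{-i,i}$. $\mathbf{F}_n$ is the unique monoidal superfunctor from $\mathcal{Q}(z)$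 to finite-dimensional $U_q$-supermodules with $\uparrow\mapsto V$, $\downarrow\mapsto V^*$, $u^+\mapsto T$, $\mathrm{cap}_L\mapsto\mathrm{ev}$, $c\mapsto J$ (then $u^-\mapsto T^{-1}$, $\mathrm{cup}_L\mapsto\mathrm{coev}$, $r^-\mapsto\mathbf{F}_n(l^+)^{-1}$). For a $U_q$-supermodule $M$ with representation $\rho_M$, $L_M=\sum_{i\le j}\rho_M(u_{ij})\otimes E_{ij}$ and $T_{MV}=\mathrm{flip}\circ L_M\colon M\otimes V\to V\otimes M$ (invertible). $\widehat{\mathbf{F}}_n\colon\mathcal{AQ}(z)\to\mathcal{SE}nd(U_q\text{-smod})$ is the unique monoidal superfunctor sending objects $X$ and morphisms $f$ of $\mathcal{Q}(z)$ to $\mathbf{F}_n(X)\otimes-$ and $\mathbf{F}_n(f)\otimes-$, and $o$ to the supernatural transformation with $M$-component $T_{MV}\circ(1_M\otimes J)\circ T_{MV}^{-1}\colon V\otimes M\to V\otimes M$. These formulas make sense also for the regular representation $M=U_q$, so the image in the claim is the value at $1\in U_q$ of the $U_q$-component of $\widehat{\mathbf{F}}_n(\zeta_m)$. **The elements $y_{ij}^{(m)}$.** For $i,j\in\mathtt{I}$, $$y_{ij}:=-\sum_{k=\max(i,j)}^n(-1)^{p(i,k)p(j,k)}S(u_{ik})u_{-k,-j}\in U_q$$ (sum over $k\in\mathtt{I}$), and for $m>0$ $$y_{ij}^{(m)}:=(-1)^{p(i)p(j)}\sum(-1)^{\sum_{k=1}^{m-1}p(i_k)+\sum_{k=0}^{m-1}p(i_k)p(i_{k+1})}\,y_{i_0,i_1}\dotsm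 y_{i_{m-1},i_m},$$ the outer sum being over all $i_1,\dots,i_{m-1}\in\mathtt{I}$ with $i_0=i$, $i_m=j$. *)

theory Defs
  imports
    Complex_Main
    "HOL-Algebra.Algebraic_Closure_Type"
    "HOL-Algebra.QuotRing"
    "HOL-Library.Z2"
    "HOL-Library.Poly_Mapping"
begin

no_notation Polynomials.var (\<open>X\<index>\<close>)

section \<open>Ground field, parities, superspaces\<close>

type_synonym Cq = "complex poly fract"

abbreviation kring :: "Cq ring" where
  "kring \<equiv> ring_of_type_algebra"

definition qq :: Cq where
  "qq = Fraction_Field.Fract [:0, 1:] 1"

definition zz :: Cq where
  "zz = qq - inverse qq"

definition ksgn :: "bit \<Rightarrow> Cq" where
  "ksgn r = (if r = 0 then 1 else - 1)"

text \<open>Parities are elements of \<^typ>\<open>bit\<close>, so that \<open>ksgn\<close> of a sum of products of parities is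
  the corresponding power of \<open>-1\<close>.  The fields \<open>mult\<close> and \<open>one\<close> inherited from the library record
  of modules are meaningful only if the superspace is a superalgebra.\<close>

record 'a sspace = "(complex poly fract, 'a) module" +
  hpart :: "bit \<Rightarrow> 'a set"

definition is_superspace :: "('a, 'b) sspace_scheme \<Rightarrow> bool" where
  "is_superspace W \<longleftrightarrow>
     module kring W \<and>
     (\<forall>r. submodule (hpart W r) kring W) \<and>
     (\<forall>x\<in>carrier W. \<exists>!w. fst w \<in> hpart W 0 \<and> snd w \<in> hpart W 1 \<and> x = fst w \<oplus>\<^bsub>W\<^esub> snd w)"

definition parity_inv :: "('a, 'b) sspace_scheme \<Rightarrow> 'a \<Rightarrow> 'a" where
  "parity_inv W x =
     (THE y. \<exists>x0\<in>hpart W 0. \<exists>x1\<in>hpart W 1. x = x0 \<oplus>\<^bsub>W\<^esub> x1 \<and> y = x0 \<ominus>\<^bsub>W\<^esub> x1)"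

text \<open>On homogeneous \<open>x\<close> this is \<open>x\<close> multiplied by \<open>-1\<close> to the power \<open>r\<close> times the parity of \<open>x\<close>.\<close>

definition twist :: "('a, 'b) sspace_scheme \<Rightarrow> bit \<Rightarrow> 'a \<Rightarrow> 'a" where
  "twist W r x = (if r = 0 then x else parity_inv W x)"


section \<open>Supercategories and superfunctors\<close>

record ('o, 'a) supercat =
  obs :: "'o set"
  homs :: "'o \<Rightarrow> 'o \<Rightarrow> 'a sspace"
  ide :: "'o \<Rightarrow> 'a"
  cmp :: "'a \<Rightarrow> 'a \<Rightarrow> 'a"

record ('o, 'a) mon_supercat = "('o, 'a) supercat" +
  unit_ob :: 'o
  tens_ob :: "'o \<Rightarrow> 'o \<Rightarrow> 'o"
  tens_ar :: "'a \<Rightarrow> 'a \<Rightarrow> 'a"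

definition arrows :: "('o, 'a, 'e) supercat_scheme \<Rightarrow> 'a set" where
  "arrows C = (\<Union>X\<in>obs C. \<Union>Y\<in>obs C. carrier (homs C X Y))"

record ('o, 'a, 'p, 'b) sfunctor =
  omap :: "'o \<Rightarrow> 'p"
  amap :: "'a \<Rightarrow> 'b"

definition superfunctor ::
  "('o, 'a, 'e) supercat_scheme \<Rightarrow> ('p, 'b, 'f) supercat_scheme \<Rightarrow> ('o, 'a, 'p, 'b) sfunctor \<Rightarrow> bool"
where
  "superfunctor C D F \<longleftrightarrow>
     (\<forall>X\<in>obs C. omap F X \<in> obs D) \<and>
     (\<forall>X\<in>obs C. \<forall>Y\<in>obs C.
        (\<forall>f\<in>carrier (homs C X Y). amap F f \<in> carrier (homs D (omap F X) (omap F Y))) \<and>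
        (\<forall>r. \<forall>f\<in>hpart (homs C X Y) r. amap F f \<in> hpart (homs D (omap F X) (omap F Y)) r) \<and>
        (\<forall>f\<in>carrier (homs C X Y). \<forall>g\<in>carrier (homs C X Y).
           amap F (f \<oplus>\<^bsub>homs C X Y\<^esub> g) = amap F f \<oplus>\<^bsub>homs D (omap F X) (omap F Y)\<^esub> amap F g) \<and>
        (\<forall>a. \<forall>f\<in>carrier (homs C X Y).
           amap F (a \<odot>\<^bsub>homs C X Y\<^esub> f) = a \<odot>\<^bsub>homs D (omap F X) (omap F Y)\<^esub> amap F f)) \<and>
     (\<forall>X\<in>obs C. amap F (ide C X) = ide D (omap F X)) \<and>
     (\<forall>X\<in>obs C. \<forall>Y\<in>obs C. \<forall>Z\<in>obs C. \<forall>g\<in>carrier (homs C Y Z). \<forall>f\<in>carrier (homs C X Y).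
        amap F (cmp C g f) = cmp D (amap F g) (amap F f))"

definition strict_monoidal_superfunctor ::
  "('o, 'a, 'e) mon_supercat_scheme \<Rightarrow> ('p, 'b, 'f) mon_supercat_scheme
    \<Rightarrow> ('o, 'a, 'p, 'b) sfunctor \<Rightarrow> bool"
where
  "strict_monoidal_superfunctor C D F \<longleftrightarrow>
     superfunctor C D F \<and>
     omap F (unit_ob C) = unit_ob D \<and>
     (\<forall>X\<in>obs C. \<forall>Y\<in>obs C. omap F (tens_ob C X Y) = tens_ob D (omap F X) (omap F Y)) \<and>
     (\<forall>f\<in>arrows C. \<forall>g\<in>arrows C. amap F (tens_ar C f g) = tens_ar D (amap F f) (amap F g))"


subsection \<open>Endosuperfunctors and supernatural transformations\<close>

type_synonym ('o, 'a) endo = "('o, 'a, 'o, 'a) sfunctor"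
type_synonym ('o, 'a) nattrans = "('o, 'a) endo \<times> ('o \<Rightarrow> 'a) \<times> ('o, 'a) endo"

text \<open>Functions are required to be extensional, i.e. \<^term>\<open>undefined\<close> off their domain, so that
  equality in HOL is equality of functors and of transformations.\<close>

definition endofunctor :: "('o, 'a, 'e) supercat_scheme \<Rightarrow> ('o, 'a) endo \<Rightarrow> bool" where
  "endofunctor C G \<longleftrightarrow>
     superfunctor C C G \<and> omap G \<in> extensional (obs C) \<and> amap G \<in> extensional (arrows C)"

definition supernat ::
  "('o, 'a, 'e) supercat_scheme \<Rightarrow> bit \<Rightarrow> ('o, 'a) endo \<Rightarrow> ('o, 'a) endo \<Rightarrow> ('o \<Rightarrow> 'a) \<Rightarrow> bool"
where
  "supernat C r G H \<alpha> \<longleftrightarrow>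
     \<alpha> \<in> extensional (obs C) \<and>
     (\<forall>X\<in>obs C. \<alpha> X \<in> hpart (homs C (omap G X) (omap H X)) r) \<and>
     (\<forall>X\<in>obs C. \<forall>Y\<in>obs C. \<forall>s. \<forall>f\<in>hpart (homs C X Y) s.
        cmp C (amap H f) (\<alpha> X) =
          ksgn (r * s) \<odot>\<^bsub>homs C (omap G X) (omap H Y)\<^esub> cmp C (\<alpha> Y) (amap G f))"

definition nat_space ::
  "('o, 'a, 'e) supercat_scheme \<Rightarrow> ('o, 'a) endo \<Rightarrow> ('o, 'a) endo \<Rightarrow> ('o, 'a) nattrans sspace"
where
  "nat_space C G H =
    (let padd = (\<lambda>\<alpha> \<beta>. \<lambda>X\<in>obs C. \<alpha> X \<oplus>\<^bsub>homs C (omap G X) (omap H X)\<^esub> \<beta> X) in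
     \<lparr> carrier = {(G, padd \<alpha> \<beta>, H) | \<alpha> \<beta>. supernat C 0 G H \<alpha> \<and> supernat C 1 G H \<beta>},
       monoid.mult = undefined, one = undefined,
       ring.zero = (G, \<lambda>X\<in>obs C. \<zero>\<^bsub>homs C (omap G X) (omap H X)\<^esub>, H),
       add = (\<lambda>(_, \<alpha>, _) (_, \<beta>, _). (G, padd \<alpha> \<beta>, H)),
       module.smult = (\<lambda>a (_, \<alpha>, _). (G, \<lambda>X\<in>obs C. a \<odot>\<^bsub>homs C (omap G X) (omap H X)\<^esub> \<alpha> X, H)),
       hpart = (\<lambda>r. {(G, \<alpha>, H) | \<alpha>. supernat C r G H \<alpha>}) \<rparr>)"

definition fun_comp ::
  "('o, 'a, 'e) supercat_scheme \<Rightarrow> ('o, 'a) endo \<Rightarrow> ('o, 'a) endo \<Rightarrow> ('o, 'a) endo"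
where
  "fun_comp C G H = \<lparr> omap = compose (obs C) (omap G) (omap H),
                      amap = compose (arrows C) (amap G) (amap H) \<rparr>"

text \<open>The tensor product of transformations \<open>\<alpha> : G \<Rightarrow> G'\<close> and \<open>\<beta> : H \<Rightarrow> H'\<close> is
  \<open>(\<alpha> \<otimes> 1) \<circ> (1 \<otimes> \<beta>)\<close>, as forced by the super interchange law.\<close>

definition SEnd ::
  "('o, 'a, 'e) supercat_scheme \<Rightarrow> (('o, 'a) endo, ('o, 'a) nattrans) mon_supercat"
where
  "SEnd C =
     \<lparr> obs = {G. endofunctor C G},
       homs = nat_space C,
       ide = (\<lambda>G. (G, \<lambda>X\<in>obs C. ide C (omap G X), G)),
       cmp = (\<lambda>(_, \<beta>, K) (G, \<alpha>, _). (G, \<lambda>X\<in>obs C. cmp C (\<beta> X) (\<alpha> X), K)),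
       unit_ob = \<lparr> omap = (\<lambda>X\<in>obs C. X), amap = (\<lambda>f\<in>arrows C. f) \<rparr>,
       tens_ob = fun_comp C,
       tens_ar = (\<lambda>(G, \<alpha>, G') (H, \<beta>, H').
         (fun_comp C G H,
          \<lambda>X\<in>obs C. cmp C (\<alpha> (omap H' X)) (amap G (\<beta> X)),
          fun_comp C G' H')) \<rparr>"


section \<open>The monoidal supercategory \<open>AQ(z)\<close>\<close>

datatype dir = Up | Down

datatype gen = UPlus | UMinus | RMinus | CapL | CupL | CDot | ODot

datatype mor =
    Gen gen
  | Id "dir list"
  | Cmp mor mor  (infixr \<open>\<bullet>\<close> 65)
  | Tens mor mor  (infixr \<open>\<boxtimes>\<close> 70)
  | Zero "dir list" "dir list"
  | Add mor mor
  | Scale Cq mor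

fun gdom :: "gen \<Rightarrow> dir list" where
  "gdom UPlus = [Up, Up]"
| "gdom UMinus = [Up, Up]"
| "gdom RMinus = [Up, Down]"
| "gdom CapL = [Down, Up]"
| "gdom CupL = []"
| "gdom CDot = [Up]"
| "gdom ODot = [Up]"

fun gcod :: "gen \<Rightarrow> dir list" where
  "gcod UPlus = [Up, Up]"
| "gcod UMinus = [Up, Up]"
| "gcod RMinus = [Down, Up]"
| "gcod CapL = []"
| "gcod CupL = [Up, Down]"
| "gcod CDot = [Up]"
| "gcod ODot = [Up]"

definition gpar :: "gen \<Rightarrow> bit" where
  "gpar g = (if g = CDot \<or> g = ODot then 1 else 0)"

inductive typed :: "mor \<Rightarrow> dir list \<Rightarrow> dir list \<Rightarrow> bool" where
  "typed (Gen g) (gdom g) (gcod g)"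
| "typed (Id X) X X"
| "typed s Y Z \<Longrightarrow> typed t X Y \<Longrightarrow> typed (s \<bullet> t) X Z"
| "typed s X Y \<Longrightarrow> typed t X' Y' \<Longrightarrow> typed (s \<boxtimes> t) (X @ X') (Y @ Y')"
| "typed (Zero X Y) X Y"
| "typed s X Y \<Longrightarrow> typed t X Y \<Longrightarrow> typed (Add s t) X Y"
| "typed s X Y \<Longrightarrow> typed (Scale a s) X Y"

inductive homog :: "mor \<Rightarrow> dir list \<Rightarrow> dir list \<Rightarrow> bit \<Rightarrow> bool" where
  "homog (Gen g) (gdom g) (gcod g) (gpar g)"
| "homog (Id X) X X 0"
| "homog s Y Z r \<Longrightarrow> homog t X Y r' \<Longrightarrow> homog (s \<bullet> t) X Z (r + r')"
| "homog s X Y r \<Longrightarrow> homog t X' Y' r' \<Longrightarrow> homog (s \<boxtimes> t) (X @ X') (Y @ Y') (r + r')"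
| "homog (Zero X Y) X Y r"
| "homog s X Y r \<Longrightarrow> homog t X Y r \<Longrightarrow> homog (Add s t) X Y r"
| "homog s X Y r \<Longrightarrow> homog (Scale a s) X Y r"

definition lplus :: mor where
  "lplus = (Gen CapL \<boxtimes> Id [Up] \<boxtimes> Id [Down]) \<bullet> (Id [Down] \<boxtimes> Gen UPlus \<boxtimes> Id [Down])
             \<bullet> (Id [Down] \<boxtimes> Id [Up] \<boxtimes> Gen CupL)"

definition capR :: mor where
  "capR = Gen CapL \<bullet> Gen RMinus"

definition cupR :: mor where
  "cupR = Gen RMinus \<bullet> Gen CupL"

definition Q_rels :: "Cq \<Rightarrow> (mor \<times> mor) set" where
  "Q_rels z =
    { (Gen UMinus \<bullet> Gen UPlus, Id [Up, Up]),
      (Gen UPlus \<bullet> Gen UMinus, Id [Up, Up]),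
      (lplus \<bullet> Gen RMinus, Id [Up, Down]),
      (Gen RMinus \<bullet> lplus, Id [Down, Up]),
      ((Gen UPlus \<boxtimes> Id [Up]) \<bullet> (Id [Up] \<boxtimes> Gen UPlus) \<bullet> (Gen UPlus \<boxtimes> Id [Up]),
       (Id [Up] \<boxtimes> Gen UPlus) \<bullet> (Gen UPlus \<boxtimes> Id [Up]) \<bullet> (Id [Up] \<boxtimes> Gen UPlus)),
      (Add (Gen UPlus) (Scale (- 1) (Gen UMinus)), Scale z (Id [Up, Up])),
      (Gen CDot \<bullet> Gen CDot, Scale (- 1) (Id [Up])),
      (Gen UPlus \<bullet> (Gen CDot \<boxtimes> Id [Up]), (Id [Up] \<boxtimes> Gen CDot) \<bullet> Gen UPlus),
      (capR \<bullet> (Gen CDot \<boxtimes> Id [Down]) \<bullet> Gen CupL, Zero [] []),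
      (capR \<bullet> Gen CupL, Zero [] []),
      ((Id [Up] \<boxtimes> Gen CapL) \<bullet> (Gen CupL \<boxtimes> Id [Up]), Id [Up]),
      ((Gen CapL \<boxtimes> Id [Down]) \<bullet> (Id [Down] \<boxtimes> Gen CupL), Id [Down]) }"

definition AQ_rels :: "Cq \<Rightarrow> (mor \<times> mor) set" where
  "AQ_rels z = Q_rels z \<union>
    { (Gen ODot \<bullet> Gen ODot, Scale (- 1) (Id [Up])),
      (Gen UPlus \<bullet> (Id [Up] \<boxtimes> Gen ODot), (Gen ODot \<boxtimes> Id [Up]) \<bullet> Gen UPlus),
      (capR \<bullet> (Gen ODot \<boxtimes> Id [Down]) \<bullet> Gen CupL, Zero [] []) }"

text \<open>The congruence on morphism expressions generated by the axioms of a strict monoidal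
  supercategory and the defining relations.\<close>

inductive aqeq :: "Cq \<Rightarrow> mor \<Rightarrow> mor \<Rightarrow> bool" for z where
  rel: "(s, t) \<in> AQ_rels z \<Longrightarrow> aqeq z s t"
| refl: "typed s X Y \<Longrightarrow> aqeq z s s"
| sym: "aqeq z s t \<Longrightarrow> aqeq z t s"
| trans: "aqeq z s t \<Longrightarrow> aqeq z t u \<Longrightarrow> aqeq z s u"
| cmp_cong: "typed s Y Z \<Longrightarrow> typed t X Y \<Longrightarrow> aqeq z s s' \<Longrightarrow> aqeq z t t' \<Longrightarrow>
    aqeq z (s \<bullet> t) (s' \<bullet> t')"
| tens_cong: "aqeq z s s' \<Longrightarrow> aqeq z t t' \<Longrightarrow> aqeq z (s \<boxtimes> t) (s' \<boxtimes> t')"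
| add_cong: "typed s X Y \<Longrightarrow> typed t X Y \<Longrightarrow> aqeq z s s' \<Longrightarrow> aqeq z t t' \<Longrightarrow>
    aqeq z (Add s t) (Add s' t')"
| scale_cong: "aqeq z s s' \<Longrightarrow> aqeq z (Scale a s) (Scale a s')"
| add_assoc: "typed s X Y \<Longrightarrow> typed t X Y \<Longrightarrow> typed u X Y \<Longrightarrow>
    aqeq z (Add (Add s t) u) (Add s (Add t u))"
| add_comm: "typed s X Y \<Longrightarrow> typed t X Y \<Longrightarrow> aqeq z (Add s t) (Add t s)"
| add_zero: "typed s X Y \<Longrightarrow> aqeq z (Add (Zero X Y) s) s"
| add_neg: "typed s X Y \<Longrightarrow> aqeq z (Add s (Scale (- 1) s)) (Zero X Y)"
| scale_add: "typed s X Y \<Longrightarrow> typed t X Y \<Longrightarrow>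
    aqeq z (Scale a (Add s t)) (Add (Scale a s) (Scale a t))"
| add_scale: "typed s X Y \<Longrightarrow> aqeq z (Scale (a + b) s) (Add (Scale a s) (Scale b s))"
| scale_scale: "typed s X Y \<Longrightarrow> aqeq z (Scale (a * b) s) (Scale a (Scale b s))"
| scale_one: "typed s X Y \<Longrightarrow> aqeq z (Scale 1 s) s"
| cmp_add_left: "typed s Y Z \<Longrightarrow> typed s' Y Z \<Longrightarrow> typed t X Y \<Longrightarrow>
    aqeq z (Add s s' \<bullet> t) (Add (s \<bullet> t) (s' \<bullet> t))"
| cmp_add_right: "typed s Y Z \<Longrightarrow> typed t X Y \<Longrightarrow> typed t' X Y \<Longrightarrow>
    aqeq z (s \<bullet> Add t t') (Add (s \<bullet> t) (s \<bullet> t'))"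
| cmp_scale_left: "typed s Y Z \<Longrightarrow> typed t X Y \<Longrightarrow> aqeq z (Scale a s \<bullet> t) (Scale a (s \<bullet> t))"
| cmp_scale_right: "typed s Y Z \<Longrightarrow> typed t X Y \<Longrightarrow> aqeq z (s \<bullet> Scale a t) (Scale a (s \<bullet> t))"
| tens_add_left: "typed s X Y \<Longrightarrow> typed s' X Y \<Longrightarrow> typed t X' Y' \<Longrightarrow>
    aqeq z (Add s s' \<boxtimes> t) (Add (s \<boxtimes> t) (s' \<boxtimes> t))"
| tens_add_right: "typed s X Y \<Longrightarrow> typed t X' Y' \<Longrightarrow> typed t' X' Y' \<Longrightarrow>
    aqeq z (s \<boxtimes> Add t t') (Add (s \<boxtimes> t) (s \<boxtimes> t'))"
| tens_scale_left: "typed s X Y \<Longrightarrow> typed t X' Y' \<Longrightarrow>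
    aqeq z (Scale a s \<boxtimes> t) (Scale a (s \<boxtimes> t))"
| tens_scale_right: "typed s X Y \<Longrightarrow> typed t X' Y' \<Longrightarrow>
    aqeq z (s \<boxtimes> Scale a t) (Scale a (s \<boxtimes> t))"
| id_left: "typed s X Y \<Longrightarrow> aqeq z (Id Y \<bullet> s) s"
| id_right: "typed s X Y \<Longrightarrow> aqeq z (s \<bullet> Id X) s"
| cmp_assoc: "typed s Y Z \<Longrightarrow> typed t X Y \<Longrightarrow> typed u W X \<Longrightarrow>
    aqeq z ((s \<bullet> t) \<bullet> u) (s \<bullet> (t \<bullet> u))"
| tens_assoc: "typed s X Y \<Longrightarrow> typed t X' Y' \<Longrightarrow> typed u X'' Y'' \<Longrightarrow>
    aqeq z ((s \<boxtimes> t) \<boxtimes> u) (s \<boxtimes> (t \<boxtimes> u))"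
| unit_left: "typed s X Y \<Longrightarrow> aqeq z (Id [] \<boxtimes> s) s"
| unit_right: "typed s X Y \<Longrightarrow> aqeq z (s \<boxtimes> Id []) s"
| tens_id: "aqeq z (Id X \<boxtimes> Id Y) (Id (X @ Y))"
| interchange: "typed f' Y Z \<Longrightarrow> homog f X Y r \<Longrightarrow> homog g Y' Z' r' \<Longrightarrow> typed g' X' Y' \<Longrightarrow>
    aqeq z ((f' \<boxtimes> g) \<bullet> (f \<boxtimes> g')) (Scale (ksgn (r * r')) ((f' \<bullet> f) \<boxtimes> (g \<bullet> g')))"

definition cls :: "Cq \<Rightarrow> mor \<Rightarrow> mor set" where
  "cls z s = {t. aqeq z s t}"

definition AQ :: "Cq \<Rightarrow> (dir list, mor set) mon_supercat" where
  "AQ z =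
     \<lparr> obs = UNIV,
       homs = (\<lambda>X Y.
         \<lparr> carrier = {cls z s | s. typed s X Y},
           monoid.mult = undefined, one = undefined,
           ring.zero = cls z (Zero X Y),
           add = (\<lambda>A B. \<Union>s\<in>A. \<Union>t\<in>B. cls z (Add s t)),
           module.smult = (\<lambda>a A. \<Union>s\<in>A. cls z (Scale a s)),
           hpart = (\<lambda>r. {cls z s | s. homog s X Y r}) \<rparr>),
       ide = (\<lambda>X. cls z (Id X)),
       cmp = (\<lambda>A B. \<Union>s\<in>A. \<Union>t\<in>B. cls z (s \<bullet> t)),
       unit_ob = [],
       tens_ob = (@),
       tens_ar = (\<lambda>A B. \<Union>s\<in>A. \<Union>t\<in>B. cls z (s \<boxtimes> t)) \<rparr>"

primrec co_power :: "nat \<Rightarrow> mor" where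
  "co_power 0 = Id [Up]"
| "co_power (Suc m) = (Gen CDot \<bullet> Gen ODot) \<bullet> co_power m"

definition zeta :: "Cq \<Rightarrow> nat \<Rightarrow> mor set" where
  "zeta z m = cls z (Gen CapL \<bullet> (Id [Down] \<boxtimes> co_power m) \<bullet> cupR)"


section \<open>The superalgebra \<open>U\<^sub>q(\<qq>\<^sub>n)\<close>\<close>

definition Idx :: "nat \<Rightarrow> int set" where
  "Idx n = {- int n..int n} - {0}"

definition p :: "int \<Rightarrow> bit" where
  "p i = (if i > 0 then 0 else 1)"

definition pp :: "int \<Rightarrow> int \<Rightarrow> bit" where
  "pp i j = p i + p j"

definition phi :: "int \<Rightarrow> int \<Rightarrow> int" where
  "phi i j = (if \<bar>i\<bar> = \<bar>j\<bar> then sgn j else 0)"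

definition E :: "int \<Rightarrow> int \<Rightarrow> int \<Rightarrow> int \<Rightarrow> Cq" where
  "E i j a b = (if a = i \<and> b = j then 1 else 0)"

text \<open>\<open>Theta i j a b\<close> is the \<open>(a, b)\<close> matrix entry of \<open>\<Theta>\<^sub>i\<^sub>j\<close>, where \<open>\<Theta> = \<Sum> \<Theta>\<^sub>i\<^sub>j \<otimes> E\<^sub>i\<^sub>j\<close>.\<close>

definition Theta :: "int \<Rightarrow> int \<Rightarrow> int \<Rightarrow> int \<Rightarrow> Cq" where
  "Theta i j a b =
     (if i = j \<and> a = b then qq powi phi a j else 0)
     + (if i < j then zz * ksgn (p i) * (E j i a b + E (- j) (- i) a b) else 0)"


subsection \<open>The free superalgebra on the generators\<close>

datatype uword = UWord (letters: "(int \<times> int) list")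

instantiation uword :: monoid_add
begin

definition zero_uword :: uword where
  "0 = UWord []"

definition plus_uword :: "uword \<Rightarrow> uword \<Rightarrow> uword" where
  "v + w = UWord (letters v @ letters w)"

instance
  by standard (simp_all add: zero_uword_def plus_uword_def)

end

type_synonym free = "uword \<Rightarrow>\<^sub>0 complex poly fract"

definition gens :: "nat \<Rightarrow> (int \<times> int) set" where
  "gens n = {(i, j). i \<in> Idx n \<and> j \<in> Idx n \<and> i \<le> j}"

definition wpar :: "uword \<Rightarrow> bit" where
  "wpar w = sum_list (map (\<lambda>(i, j). pp i j) (letters w))"

definition FreeAlg :: "nat \<Rightarrow> free ring" where
  "FreeAlg n =
     \<lparr> carrier = {f. \<forall>w\<in>Poly_Mapping.keys f. set (letters w) \<subseteq> gens n},
       monoid.mult = (*), one = 1, ring.zero = 0, add = (+) \<rparr>"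

definition const :: "Cq \<Rightarrow> free" where
  "const a = Poly_Mapping.single 0 a"

definition ugen :: "int \<Rightarrow> int \<Rightarrow> free" where
  "ugen i j = Poly_Mapping.single (UWord [(i, j)]) 1"

text \<open>\<open>X a b c d\<close> is the coefficient in the free superalgebra of \<open>E\<^sub>a\<^sub>b \<otimes> E\<^sub>c\<^sub>d\<close> in an even element
  of the free superalgebra tensored with \<open>End(V)\<^sup>\<otimes>\<^sup>2\<close>; evenness means that this coefficient has parity
  \<open>pp a b + pp c d\<close>, whence the sign in the product.\<close>

type_synonym tens3 = "int \<Rightarrow> int \<Rightarrow> int \<Rightarrow> int \<Rightarrow> free"

definition mult3 :: "nat \<Rightarrow> tens3 \<Rightarrow> tens3 \<Rightarrow> tens3" where
  "mult3 n X Y a b c d =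
     (\<Sum>e\<in>Idx n. \<Sum>f\<in>Idx n.
        const (ksgn ((pp e b + pp f d) * (pp a e + pp c f) + pp e b * pp c f))
          * (X a e c f * Y e b f d))"

definition L12 :: tens3 where
  "L12 a b c d = (if a \<le> b \<and> c = d then ugen a b else 0)"

definition L13 :: tens3 where
  "L13 a b c d = (if a = b \<and> c \<le> d then ugen c d else 0)"

definition Theta23 :: tens3 where
  "Theta23 a b c d = const (Theta c d a b)"

definition U_rels :: "nat \<Rightarrow> free set" where
  "U_rels n =
     {ugen i i * ugen (- i) (- i) - 1 | i. i \<in> Idx n} \<union>
     {mult3 n L12 (mult3 n L13 Theta23) a b c d - mult3 n Theta23 (mult3 n L13 L12) a b c d
       | a b c d. a \<in> Idx n \<and> b \<in> Idx n \<and> c \<in> Idx n \<and> d \<in> Idx n}"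

definition U_ideal :: "nat \<Rightarrow> free set" where
  "U_ideal n = Idl\<^bsub>FreeAlg n\<^esub> (U_rels n)"

definition Uclass :: "nat \<Rightarrow> free \<Rightarrow> free set" where
  "Uclass n f = U_ideal n +>\<^bsub>FreeAlg n\<^esub> f"

definition Uq :: "nat \<Rightarrow> free set sspace" where
  "Uq n =
    (let R = FreeAlg n Quot U_ideal n in
     \<lparr> carrier = carrier R, monoid.mult = (\<otimes>\<^bsub>R\<^esub>), one = \<one>\<^bsub>R\<^esub>, ring.zero = \<zero>\<^bsub>R\<^esub>, add = (\<oplus>\<^bsub>R\<^esub>),
       module.smult = (\<lambda>a x. Uclass n (const a) \<otimes>\<^bsub>R\<^esub> x),
       hpart = (\<lambda>r. {Uclass n f | f. f \<in> carrier (FreeAlg n) \<and> (\<forall>w\<in>Poly_Mapping.keys f. wpar w = r)}) \<rparr>)"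

definition u :: "nat \<Rightarrow> int \<Rightarrow> int \<Rightarrow> free set" where
  "u n i j = Uclass n (ugen i j)"

definition Zq :: "nat \<Rightarrow> free set set" where
  "Zq n =
    (let central = (\<lambda>r x. x \<in> hpart (Uq n) r \<and>
           (\<forall>s. \<forall>y\<in>hpart (Uq n) s.
              x \<otimes>\<^bsub>Uq n\<^esub> y = ksgn (r * s) \<odot>\<^bsub>Uq n\<^esub> (y \<otimes>\<^bsub>Uq n\<^esub> x)))
     in {x0 \<oplus>\<^bsub>Uq n\<^esub> x1 | x0 x1. central 0 x0 \<and> central 1 x1})"

text \<open>The last two conditions say that \<open>\<Sum> S(u\<^sub>i\<^sub>j) \<otimes> E\<^sub>i\<^sub>j\<close> is a two-sided inverse of
  \<open>L = \<Sum> u\<^sub>i\<^sub>j \<otimes> E\<^sub>i\<^sub>j\<close> in the superalgebra \<open>U\<^sub>q \<otimes> End(V)\<close>.\<close>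

definition antipode :: "nat \<Rightarrow> (free set \<Rightarrow> free set) \<Rightarrow> bool" where
  "antipode n S \<longleftrightarrow>
     S \<in> carrier (Uq n) \<rightarrow> carrier (Uq n) \<and>
     (\<forall>x\<in>carrier (Uq n). \<forall>y\<in>carrier (Uq n). S (x \<oplus>\<^bsub>Uq n\<^esub> y) = S x \<oplus>\<^bsub>Uq n\<^esub> S y) \<and>
     (\<forall>a. \<forall>x\<in>carrier (Uq n). S (a \<odot>\<^bsub>Uq n\<^esub> x) = a \<odot>\<^bsub>Uq n\<^esub> S x) \<and>
     (\<forall>r. \<forall>x\<in>hpart (Uq n) r. S x \<in> hpart (Uq n) r) \<and>
     S \<one>\<^bsub>Uq n\<^esub> = \<one>\<^bsub>Uq n\<^esub> \<and>
     (\<forall>r s. \<forall>x\<in>hpart (Uq n) r. \<forall>y\<in>hpart (Uq n) s.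
        S (x \<otimes>\<^bsub>Uq n\<^esub> y) = ksgn (r * s) \<odot>\<^bsub>Uq n\<^esub> (S y \<otimes>\<^bsub>Uq n\<^esub> S x)) \<and>
     (\<forall>(i, j)\<in>gens n.
        (\<Oplus>\<^bsub>Uq n\<^esub>k\<in>Idx n \<inter> {i..j}.
           ksgn (pp i k * pp k j) \<odot>\<^bsub>Uq n\<^esub> (u n i k \<otimes>\<^bsub>Uq n\<^esub> S (u n k j)))
          = (if i = j then \<one>\<^bsub>Uq n\<^esub> else \<zero>\<^bsub>Uq n\<^esub>)) \<and>
     (\<forall>(i, j)\<in>gens n.
        (\<Oplus>\<^bsub>Uq n\<^esub>k\<in>Idx n \<inter> {i..j}.
           ksgn (pp i k * pp k j) \<odot>\<^bsub>Uq n\<^esub> (S (u n i k) \<otimes>\<^bsub>Uq n\<^esub> u n k j))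
          = (if i = j then \<one>\<^bsub>Uq n\<^esub> else \<zero>\<^bsub>Uq n\<^esub>))"


section \<open>Supermodules\<close>

record 'v supermod = "'v sspace" +
  act :: "free set \<Rightarrow> 'v \<Rightarrow> 'v"

definition is_supermodule :: "nat \<Rightarrow> 'v supermod \<Rightarrow> bool" where
  "is_supermodule n M \<longleftrightarrow>
     is_superspace M \<and>
     (\<forall>x\<in>carrier (Uq n). \<forall>m\<in>carrier M. act M x m \<in> carrier M) \<and>
     (\<forall>r s. \<forall>x\<in>hpart (Uq n) r. \<forall>m\<in>hpart M s. act M x m \<in> hpart M (r + s)) \<and>
     (\<forall>x\<in>carrier (Uq n). \<forall>y\<in>carrier (Uq n). \<forall>m\<in>carrier M.
        act M (x \<oplus>\<^bsub>Uq n\<^esub> y) m = act M x m \<oplus>\<^bsub>M\<^esub> act M y m \<and>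
        act M (x \<otimes>\<^bsub>Uq n\<^esub> y) m = act M x (act M y m)) \<and>
     (\<forall>x\<in>carrier (Uq n). \<forall>m\<in>carrier M. \<forall>m'\<in>carrier M.
        act M x (m \<oplus>\<^bsub>M\<^esub> m') = act M x m \<oplus>\<^bsub>M\<^esub> act M x m') \<and>
     (\<forall>a. \<forall>x\<in>carrier (Uq n). \<forall>m\<in>carrier M.
        act M (a \<odot>\<^bsub>Uq n\<^esub> x) m = a \<odot>\<^bsub>M\<^esub> act M x m \<and>
        act M x (a \<odot>\<^bsub>M\<^esub> m) = a \<odot>\<^bsub>M\<^esub> act M x m) \<and>
     (\<forall>m\<in>carrier M. act M \<one>\<^bsub>Uq n\<^esub> m = m)"

definition smod_hom ::
  "nat \<Rightarrow> bit \<Rightarrow> 'v supermod \<Rightarrow> 'v supermod \<Rightarrow> ('v \<Rightarrow> 'v) \<Rightarrow> bool"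
where
  "smod_hom n r M N f \<longleftrightarrow>
     f \<in> carrier M \<rightarrow>\<^sub>E carrier N \<and>
     (\<forall>m\<in>carrier M. \<forall>m'\<in>carrier M. f (m \<oplus>\<^bsub>M\<^esub> m') = f m \<oplus>\<^bsub>N\<^esub> f m') \<and>
     (\<forall>a. \<forall>m\<in>carrier M. f (a \<odot>\<^bsub>M\<^esub> m) = a \<odot>\<^bsub>N\<^esub> f m) \<and>
     (\<forall>s. \<forall>m\<in>hpart M s. f m \<in> hpart N (r + s)) \<and>
     (\<forall>s. \<forall>x\<in>hpart (Uq n) s. \<forall>m\<in>carrier M. f (act M x m) = ksgn (r * s) \<odot>\<^bsub>N\<^esub> act N x (f m))"

type_synonym 'v smod_arrow = "'v supermod \<times> ('v \<Rightarrow> 'v) \<times> 'v supermod"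

definition smod_homs :: "nat \<Rightarrow> 'v supermod \<Rightarrow> 'v supermod \<Rightarrow> 'v smod_arrow sspace" where
  "smod_homs n M N =
     \<lparr> carrier = {(M, \<lambda>m\<in>carrier M. f m \<oplus>\<^bsub>N\<^esub> g m, N) | f g. smod_hom n 0 M N f \<and> smod_hom n 1 M N g},
       monoid.mult = undefined, one = undefined,
       ring.zero = (M, \<lambda>m\<in>carrier M. \<zero>\<^bsub>N\<^esub>, N),
       add = (\<lambda>(_, f, _) (_, g, _). (M, \<lambda>m\<in>carrier M. f m \<oplus>\<^bsub>N\<^esub> g m, N)),
       module.smult = (\<lambda>a (_, f, _). (M, \<lambda>m\<in>carrier M. a \<odot>\<^bsub>N\<^esub> f m, N)),
       hpart = (\<lambda>r. {(M, f, N) | f. smod_hom n r M N f}) \<rparr>"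

definition Smod :: "nat \<Rightarrow> ('v supermod, 'v smod_arrow) supercat" where
  "Smod n =
     \<lparr> obs = {M. is_supermodule n M},
       homs = smod_homs n,
       ide = (\<lambda>M. (M, \<lambda>m\<in>carrier M. m, M)),
       cmp = (\<lambda>(_, g, P) (M, f, _). (M, compose (carrier M) g f, P)) \<rparr>"


subsection \<open>The universe of vectors\<close>

text \<open>HOL cannot quantify over all carrier types, so the objects of \<open>U\<^sub>q-smod\<close> are the supermodules
  with carrier contained in \<open>'a vect\<close>.  The constructor \<open>Alg\<close> makes room for the regular
  representation, \<open>Atom\<close> for further modules, with an arbitrary supply \<open>'a\<close> of atoms, and \<open>Tup\<close>
  for tensor products: \<open>Tup c\<close> stands for \<open>\<Sum>\<^sub>i b\<^sub>i \<otimes> c i\<close>, an element of the tensor product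
  with \<open>M\<close> of \<open>V\<close> (and \<open>b\<^sub>i = v\<^sub>i\<close>) or of \<open>V\<^sup>*\<close> (and \<open>b\<^sub>i = v\<^sub>i\<^sup>*\<close>).\<close>

datatype 'a vect = Alg (alg: "free set") | Atom 'a | Tup (coord: "int \<Rightarrow> 'a vect")

definition regular :: "nat \<Rightarrow> 'a vect supermod" where
  "regular n =
     \<lparr> carrier = Alg ` carrier (Uq n),
       monoid.mult = undefined, one = undefined,
       ring.zero = Alg \<zero>\<^bsub>Uq n\<^esub>,
       add = (\<lambda>x y. Alg (alg x \<oplus>\<^bsub>Uq n\<^esub> alg y)),
       module.smult = (\<lambda>a x. Alg (a \<odot>\<^bsub>Uq n\<^esub> alg x)),
       hpart = (\<lambda>r. Alg ` hpart (Uq n) r),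
       act = (\<lambda>x y. Alg (x \<otimes>\<^bsub>Uq n\<^esub> alg y)) \<rparr>"


subsection \<open>Tensoring with \<open>V\<close> and with its dual\<close>

text \<open>The supermodule \<open>V\<close>, given by its matrix coefficients: \<open>x v\<^sub>b = \<Sum>\<^sub>a \<rho> x a b \<cdot> v\<^sub>a\<close>.\<close>

definition vector_rep :: "nat \<Rightarrow> (free set \<Rightarrow> int \<Rightarrow> int \<Rightarrow> Cq) \<Rightarrow> bool" where
  "vector_rep n \<rho> \<longleftrightarrow>
     (\<forall>a\<in>Idx n. \<forall>b\<in>Idx n.
        (\<forall>x\<in>carrier (Uq n). \<forall>y\<in>carrier (Uq n).
           \<rho> (x \<oplus>\<^bsub>Uq n\<^esub> y) a b = \<rho> x a b + \<rho> y a b \<and>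
           \<rho> (x \<otimes>\<^bsub>Uq n\<^esub> y) a b = (\<Sum>c\<in>Idx n. \<rho> x a c * \<rho> y c b)) \<and>
        (\<forall>t. \<forall>x\<in>carrier (Uq n). \<rho> (t \<odot>\<^bsub>Uq n\<^esub> x) a b = t * \<rho> x a b) \<and>
        \<rho> \<one>\<^bsub>Uq n\<^esub> a b = (if a = b then 1 else 0) \<and>
        (\<forall>r. \<forall>x\<in>hpart (Uq n) r. pp a b \<noteq> r \<longrightarrow> \<rho> x a b = 0) \<and>
        (\<forall>(i, j)\<in>gens n. \<rho> (u n i j) a b = Theta i j a b))"

text \<open>\<open>V_mat n \<rho> i j\<close> and \<open>Vdual_mat n S \<rho> i j\<close> are the matrices of the action of \<open>u\<^sub>i\<^sub>j\<close> on
  \<open>V\<close> and on \<open>V\<^sup>*\<close> in the bases \<open>v\<^sub>b\<close> and \<open>v\<^sub>b\<^sup>*\<close>.\<close>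

definition V_mat :: "nat \<Rightarrow> (free set \<Rightarrow> int \<Rightarrow> int \<Rightarrow> Cq) \<Rightarrow> int \<Rightarrow> int \<Rightarrow> int \<Rightarrow> int \<Rightarrow> Cq" where
  "V_mat n \<rho> i j a b = \<rho> (u n i j) a b"

definition Vdual_mat ::
  "nat \<Rightarrow> (free set \<Rightarrow> free set) \<Rightarrow> (free set \<Rightarrow> int \<Rightarrow> int \<Rightarrow> Cq) \<Rightarrow> int \<Rightarrow> int \<Rightarrow> int \<Rightarrow> int \<Rightarrow> Cq"
where
  "Vdual_mat n S \<rho> i j a b = ksgn (pp i j * p b) * \<rho> (S (u n i j)) b a"

text \<open>\<open>P\<close> is the tensor product with \<open>M\<close> of the supermodule with basis indexed by \<open>Idx n\<close>, with
  parities \<open>p\<close>, on which \<open>u\<^sub>i\<^sub>j\<close> acts by \<open>A i j\<close>.  Since \<open>P\<close> is a supermodule, its action is determined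
  by the action of the generators, which is given by \<open>\<Delta>(u\<^sub>i\<^sub>j) = \<Sum>\<^sub>k u\<^sub>i\<^sub>k \<otimes> u\<^sub>k\<^sub>j\<close>.\<close>

definition is_tensor ::
  "nat \<Rightarrow> (int \<Rightarrow> int \<Rightarrow> int \<Rightarrow> int \<Rightarrow> Cq) \<Rightarrow> 'a vect supermod \<Rightarrow> 'a vect supermod \<Rightarrow> bool"
where
  "is_tensor n A M P \<longleftrightarrow>
     is_supermodule n P \<and>
     carrier P = Tup ` (Idx n \<rightarrow>\<^sub>E carrier M) \<and>
     (\<forall>r. hpart P r = Tup ` (\<Pi>\<^sub>E i\<in>Idx n. hpart M (r + p i))) \<and>
     \<zero>\<^bsub>P\<^esub> = Tup (\<lambda>i\<in>Idx n. \<zero>\<^bsub>M\<^esub>) \<and>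
     (\<forall>x\<in>carrier P. \<forall>y\<in>carrier P.
        x \<oplus>\<^bsub>P\<^esub> y = Tup (\<lambda>i\<in>Idx n. coord x i \<oplus>\<^bsub>M\<^esub> coord y i)) \<and>
     (\<forall>t. \<forall>x\<in>carrier P. t \<odot>\<^bsub>P\<^esub> x = Tup (\<lambda>i\<in>Idx n. t \<odot>\<^bsub>M\<^esub> coord x i)) \<and>
     (\<forall>(i, j)\<in>gens n. \<forall>x\<in>carrier P.
        act P (u n i j) x =
          Tup (\<lambda>a\<in>Idx n. \<Oplus>\<^bsub>M\<^esub>k\<in>Idx n \<inter> {i..j}. \<Oplus>\<^bsub>M\<^esub>b\<in>Idx n.
                 (ksgn (pp k j * p b) * A i k a b) \<odot>\<^bsub>M\<^esub> act M (u n k j) (coord x b)))"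

definition tensor_functor ::
  "nat \<Rightarrow> (int \<Rightarrow> int \<Rightarrow> int \<Rightarrow> int \<Rightarrow> Cq) \<Rightarrow>
    ('a vect supermod, 'a vect smod_arrow) endo \<Rightarrow> bool"
where
  "tensor_functor n A G \<longleftrightarrow>
     (\<forall>M\<in>obs (Smod n). is_tensor n A M (omap G M)) \<and>
     (\<forall>M\<in>obs (Smod n). \<forall>N\<in>obs (Smod n). \<forall>r f. smod_hom n r M N f \<longrightarrow>
        amap G (M, f, N) =
          (omap G M,
           \<lambda>x\<in>carrier (omap G M). Tup (\<lambda>i\<in>Idx n. ksgn (r * p i) \<odot>\<^bsub>N\<^esub> f (coord x i)),
           omap G N))"


subsection \<open>The maps assigned to the generating morphisms\<close>

text \<open>\<open>Tmat i a b d\<close> is the coefficient of \<open>v\<^sub>i \<otimes> v\<^sub>a\<close> in \<open>T(v\<^sub>b \<otimes> v\<^sub>d)\<close>: the sign \<open>pp i d * p b\<close> comes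
  from moving \<open>E\<^sub>i\<^sub>d\<close> past \<open>v\<^sub>b\<close>, the sign \<open>p a * p i\<close> from the flip.\<close>

definition Tmat :: "int \<Rightarrow> int \<Rightarrow> int \<Rightarrow> int \<Rightarrow> Cq" where
  "Tmat i a b d = ksgn (pp i d * p b + p a * p i) * Theta i d a b"

definition Jmat :: "int \<Rightarrow> int \<Rightarrow> Cq" where
  "Jmat a b = ksgn (p b) * (if a = - b then 1 else 0)"

definition T_tensor :: "nat \<Rightarrow> 'a vect supermod \<Rightarrow> 'a vect \<Rightarrow> 'a vect" where
  "T_tensor n M x =
     Tup (\<lambda>i\<in>Idx n. Tup (\<lambda>a\<in>Idx n. \<Oplus>\<^bsub>M\<^esub>b\<in>Idx n. \<Oplus>\<^bsub>M\<^esub>d\<in>Idx n.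
       Tmat i a b d \<odot>\<^bsub>M\<^esub> coord (coord x b) d))"

definition J_tensor :: "nat \<Rightarrow> 'a vect supermod \<Rightarrow> 'a vect \<Rightarrow> 'a vect" where
  "J_tensor n M x = Tup (\<lambda>a\<in>Idx n. \<Oplus>\<^bsub>M\<^esub>b\<in>Idx n. Jmat a b \<odot>\<^bsub>M\<^esub> coord x b)"

definition ev_tensor :: "nat \<Rightarrow> 'a vect supermod \<Rightarrow> 'a vect \<Rightarrow> 'a vect" where
  "ev_tensor n M x = (\<Oplus>\<^bsub>M\<^esub>b\<in>Idx n. coord (coord x b) b)"

text \<open>In the following four definitions the elements of \<open>M \<otimes> V\<close> are represented in the same way as
  those of \<open>V \<otimes> M\<close>: \<open>Tup c\<close> stands for \<open>\<Sum>\<^sub>i c i \<otimes> v\<^sub>i\<close>.\<close>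

definition L_op :: "nat \<Rightarrow> 'a vect supermod \<Rightarrow> 'a vect \<Rightarrow> 'a vect" where
  "L_op n M x =
     Tup (\<lambda>i\<in>Idx n. \<Oplus>\<^bsub>M\<^esub>j\<in>{j\<in>Idx n. i \<le> j}. act M (u n i j) (twist M (pp i j) (coord x j)))"

definition flip_op :: "nat \<Rightarrow> 'a vect supermod \<Rightarrow> 'a vect \<Rightarrow> 'a vect" where
  "flip_op n M x = Tup (\<lambda>i\<in>Idx n. twist M (p i) (coord x i))"

definition T_op :: "nat \<Rightarrow> 'a vect supermod \<Rightarrow> 'a vect \<Rightarrow> 'a vect" where
  "T_op n M x = flip_op n M (L_op n M x)"

definition tensor_J :: "nat \<Rightarrow> 'a vect supermod \<Rightarrow> 'a vect \<Rightarrow> 'a vect" where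
  "tensor_J n M x =
     Tup (\<lambda>a\<in>Idx n. \<Oplus>\<^bsub>M\<^esub>b\<in>Idx n. Jmat a b \<odot>\<^bsub>M\<^esub> twist M 1 (coord x b))"

definition o_op :: "nat \<Rightarrow> 'a vect supermod \<Rightarrow> 'a vect \<Rightarrow> 'a vect" where
  "o_op n M x =
     T_op n M (tensor_J n M (inv_into (Tup ` (Idx n \<rightarrow>\<^sub>E carrier M)) (T_op n M) x))"


section \<open>The superfunctor to endofunctors of \<open>U\<^sub>q-smod\<close>\<close>

type_synonym 'a aq_functor =
  "(dir list, mor set,
    ('a vect supermod, 'a vect smod_arrow) endo,
    ('a vect supermod, 'a vect smod_arrow) nattrans) sfunctor"

definition component ::
  "('a vect supermod, 'a vect smod_arrow) nattrans \<Rightarrow> 'a vect supermod \<Rightarrow> 'a vect \<Rightarrow> 'a vect"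
where
  "component \<alpha> M = fst (snd (fst (snd \<alpha>) M))"

text \<open>Strictness identifies \<open>F\<^sub>n(X) \<otimes> M\<close>, for \<open>X\<close> a word in the two generating objects, with the
  iterated tensor product bracketed to the right.  The values on the remaining generators (\<open>u\<^sup>-\<close>,
  \<open>cup\<^sub>L\<close>, \<open>r\<^sup>-\<close>) are forced by the relations: \<open>u\<^sup>-\<close> and \<open>r\<^sup>-\<close> are inverse to \<open>u\<^sup>+\<close> and
  \<open>l\<^sup>+\<close>, and \<open>cup\<^sub>L\<close> is determined by \<open>cap\<^sub>L\<close> and the zigzag relations.\<close>

definition is_Fhat ::
  "nat \<Rightarrow> (free set \<Rightarrow> free set) \<Rightarrow> (free set \<Rightarrow> int \<Rightarrow> int \<Rightarrow> Cq) \<Rightarrow> 'a aq_functor \<Rightarrow> bool"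
where
  "is_Fhat n S \<rho> F \<longleftrightarrow>
     strict_monoidal_superfunctor (AQ zz) (SEnd (Smod n)) F \<and>
     tensor_functor n (V_mat n \<rho>) (omap F [Up]) \<and>
     tensor_functor n (Vdual_mat n S \<rho>) (omap F [Down]) \<and>
     (\<forall>M\<in>obs (Smod n).
        (\<forall>x\<in>carrier (omap (omap F [Up, Up]) M).
           component (amap F (cls zz (Gen UPlus))) M x = T_tensor n M x) \<and>
        (\<forall>x\<in>carrier (omap (omap F [Down, Up]) M).
           component (amap F (cls zz (Gen CapL))) M x = ev_tensor n M x) \<and>
        (\<forall>x\<in>carrier (omap (omap F [Up]) M).
           component (amap F (cls zz (Gen CDot))) M x = J_tensor n M x) \<and>
        (\<forall>x\<in>carrier (omap (omap F [Up]) M).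
           component (amap F (cls zz (Gen ODot))) M x = o_op n M x))"

definition eval_one :: "nat \<Rightarrow> ('a vect supermod, 'a vect smod_arrow) nattrans \<Rightarrow> free set" where
  "eval_one n \<alpha> = alg (component \<alpha> (regular n) (Alg \<one>\<^bsub>Uq n\<^esub>))"


section \<open>The elements \<open>y\<^sub>i\<^sub>j\<close> and their products\<close>

definition yel :: "nat \<Rightarrow> (free set \<Rightarrow> free set) \<Rightarrow> int \<Rightarrow> int \<Rightarrow> free set" where
  "yel n S i j =
     \<ominus>\<^bsub>Uq n\<^esub> (\<Oplus>\<^bsub>Uq n\<^esub>k\<in>{k\<in>Idx n. max i j \<le> k}.
        ksgn (pp i k * pp j k) \<odot>\<^bsub>Uq n\<^esub> (S (u n i k) \<otimes>\<^bsub>Uq n\<^esub> u n (- k) (- j)))"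

definition paths :: "nat \<Rightarrow> nat \<Rightarrow> int \<Rightarrow> int \<Rightarrow> (nat \<Rightarrow> int) set" where
  "paths n m i j = {c \<in> {0..m} \<rightarrow>\<^sub>E Idx n. c 0 = i \<and> c m = j}"

definition ypow :: "nat \<Rightarrow> (free set \<Rightarrow> free set) \<Rightarrow> nat \<Rightarrow> int \<Rightarrow> int \<Rightarrow> free set" where
  "ypow n S m i j =
     ksgn (p i * p j) \<odot>\<^bsub>Uq n\<^esub>
       (\<Oplus>\<^bsub>Uq n\<^esub>c\<in>paths n m i j.
          ksgn ((\<Sum>k\<in>{1..<m}. p (c k)) + (\<Sum>k\<in>{0..<m}. p (c k) * p (c (Suc k)))) \<odot>\<^bsub>Uq n\<^esub>
            foldr (\<otimes>\<^bsub>Uq n\<^esub>) (map (\<lambda>k. yel n S (c k) (c (Suc k))) [0..<m]) \<one>\<^bsub>Uq n\<^esub>)"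

end

theory Submission
  imports Defs
begin

text \<open>
  All parity signs can be absorbed into matrix entries: with \<open>N\<close> the matrix of the \<open>u\<^sub>i\<^sub>j\<close>, suitably
  signed, \<open>c \<circ> o\<close> acts on \<open>V \<otimes> U\<^sub>q\<close> as the ordinary matrix \<open>J N J N\<inverse>\<close> over the ring \<open>U\<^sub>q\<close>, while the
  \<open>y\<^sub>i\<^sub>i\<^sup>(\<^sup>m\<^sup>)\<close> are the diagonal entries of \<open>W\<^sup>m\<close> for \<open>W = N\<inverse> J N J\<close>.  The zigzag relations force \<open>cup\<^sub>L\<close>, and inverting
  \<open>l\<^sup>+\<close> gives \<open>cup\<^sub>R\<close> with weights \<open>\<kappa>\<^sub>i\<close> that are, up to sign, proportional to \<open>q\<close> to the power \<open>-2|i|\<close>.  Since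
  \<open>J N J N\<inverse> = N W N\<inverse>\<close>, the bubble is the \<open>\<kappa>\<close>-trace of \<open>N W\<^sup>m N\<inverse>\<close>, and the point is to
  convert it into a trace of \<open>W\<^sup>m\<close> with the inverse weights.  On \<open>V \<otimes> V\<close>, the relation
  \<open>N\<^sub>1 N\<^sub>2 R = R N\<^sub>2 N\<^sub>1\<close> and the fact that \<open>J\<^sub>1\<close> commutes with \<open>R\<close> and \<open>N\<^sub>2\<close> show that \<open>W\<^sub>1\<close> commutes with
  \<open>N\<^sub>2 R\<close>; with \<open>P\<close> the super flip this yields
  \<open>N\<^sub>2 (R P) W\<^sub>2\<^sup>m N\<^sub>2\<inverse> = P (W\<^sub>2\<^sup>m N\<^sub>2\<inverse> (P R) N\<^sub>2) P\<close>.  Because suitable weighted partial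
  traces of \<open>R P\<close> and \<open>P R\<close> are identity matrices, taking both partial traces gives the result.  Centrality
  is naturality with respect to right multiplications of the regular representation.
\<close>

text \<open>The obstacle is that traces over the noncommutative ring \<open>U_q\<close> are not
  cyclic, so the \<open>N\<close> that conjugates \<open>W^m\<close> cannot simply be cancelled
  under the trace. The doubled space supplies the substitute: conjugation by \<open>P\<close> only
  renames the two tensor factors, so it exchanges the order of two partial traces without moving any
  entries past each other. Neither family of weights is guessed. Each is the solution of a
  triangular linear system over the ground field, and the system for \<open>P R\<close> is at the
  same time the condition that \<open>l^+\<close> carry a diagonal element of
  \<open>V^* \<otimes> V\<close> to \<open>cup_L\<close>. This coincidence is why the coefficients
  of \<open>cup_R\<close> fit the trace argument. The parity twists in \<open>T_op\<close> and
  \<open>tensor_J\<close> refer to the homogeneous components of an element of \<open>U_q\<close>.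
  Their uniqueness requires the ideal of relations to be graded, hence the work on homogeneity at
  the beginning.\<close>

section \<open>The free superalgebra and its quotient\<close>

text \<open>The default rules turn parities into \<open>of_bool\<close> expressions, which blocks the sign calculus.\<close>

declare add_bit_eq_xor [simp del] mult_bit_eq_and [simp del]

abbreviation FC :: "nat \<Rightarrow> free set" where
  "FC n \<equiv> carrier (FreeAlg n)"

definition fhom :: "bit \<Rightarrow> free \<Rightarrow> bool" where
  "fhom r f \<longleftrightarrow> (\<forall>w\<in>Poly_Mapping.keys f. wpar w = r)"

definition fpart :: "bit \<Rightarrow> free \<Rightarrow> free" where
  "fpart r f = Poly_Mapping.mapp (\<lambda>w c. if wpar w = r then c else 0) f"

text \<open>As \<open>sig\<close> is multiplicative and preserves the relations up to sign, the ideal is graded.\<close>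

definition sig :: "free \<Rightarrow> free" where
  "sig f = fpart 0 f - fpart 1 f"

lemma ksgn_simps [simp]: "ksgn 0 = 1" "ksgn 1 = -1"
  by (simp_all add: ksgn_def)

lemma bit_cases: "r = 0 \<or> r = (1::bit)"
  by (cases r) auto

lemma bit_mult_self: "(r::bit) * r = r"
  by (cases r) auto

lemma ksgn_add: "ksgn (r + s) = ksgn r * ksgn s"
  using bit_cases[of r] bit_cases[of s] by auto

lemma ksgn_sq [simp]: "ksgn r * ksgn r = 1" "ksgn r * (ksgn r * x) = x"
  using bit_cases[of r] by auto

lemma FC_iff: "f \<in> FC n \<longleftrightarrow> (\<forall>w\<in>Poly_Mapping.keys f. set (letters w) \<subseteq> gens n)"
  by (simp add: FreeAlg_def)

lemma FC_0 [simp]: "0 \<in> FC n" and FC_1 [simp]: "1 \<in> FC n"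
  by (simp_all add: FC_iff zero_uword_def)

lemma FC_add: "f \<in> FC n \<Longrightarrow> g \<in> FC n \<Longrightarrow> f + g \<in> FC n"
  using Poly_Mapping.keys_add[of f g] by (fastforce simp: FC_iff)

lemma FC_uminus: "f \<in> FC n \<Longrightarrow> - f \<in> FC n"
  by (simp add: FC_iff Poly_Mapping.keys_def)

lemma FC_diff: "f \<in> FC n \<Longrightarrow> g \<in> FC n \<Longrightarrow> f - g \<in> FC n"
  using FC_add[of f n "- g"] FC_uminus[of g n] by simp

lemma FC_mult: "f \<in> FC n \<Longrightarrow> g \<in> FC n \<Longrightarrow> f * g \<in> FC n"
  using keys_mult[of f g] unfolding FC_iff
  by (fastforce simp: plus_uword_def)

lemma FC_const [simp]: "const a \<in> FC n"
  by (simp add: FC_iff const_def zero_uword_def)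

lemma FC_ugen: "(i, j) \<in> gens n \<Longrightarrow> ugen i j \<in> FC n"
  by (simp add: FC_iff ugen_def)

lemma FC_sum: "(\<And>i. i \<in> A \<Longrightarrow> f i \<in> FC n) \<Longrightarrow> sum f A \<in> FC n"
  by (induction A rule: infinite_finite_induct) (auto intro: FC_add)

lemmas FC_intros = FC_add FC_uminus FC_diff FC_mult FC_const FC_sum

lemma wpar_add: "wpar (v + w) = wpar v + wpar w"
  by (simp add: wpar_def plus_uword_def)

lemma fhom_add: "fhom r f \<Longrightarrow> fhom r g \<Longrightarrow> fhom r (f + g)"
  using Poly_Mapping.keys_add[of f g] by (fastforce simp: fhom_def)

lemma fhom_uminus: "fhom r f \<Longrightarrow> fhom r (- f)"
  by (simp add: fhom_def Poly_Mapping.keys_def)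

lemma fhom_diff: "fhom r f \<Longrightarrow> fhom r g \<Longrightarrow> fhom r (f - g)"
  using fhom_add[of r f "- g"] fhom_uminus[of r g] by simp

lemma fhom_mult: "fhom r f \<Longrightarrow> fhom s g \<Longrightarrow> fhom (r + s) (f * g)"
  using keys_mult[of f g] unfolding fhom_def by (fastforce simp: wpar_add)

lemma fhom_0 [simp]: "fhom r 0"
  by (simp add: fhom_def)

lemma fhom_const: "fhom 0 (const a)"
  by (simp add: fhom_def const_def wpar_def zero_uword_def)

lemma fhom_1 [simp]: "fhom 0 1"
  by (simp add: fhom_def wpar_def zero_uword_def)

lemma fhom_ugen: "fhom (pp i j) (ugen i j)"
  by (simp add: fhom_def ugen_def wpar_def)

lemma fhom_sum: "(\<And>i. i \<in> A \<Longrightarrow> fhom r (f i)) \<Longrightarrow> fhom r (sum f A)"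
  by (induction A rule: infinite_finite_induct) (auto intro: fhom_add)

lemma lookup_fpart: "Poly_Mapping.lookup (fpart r f) w = (if wpar w = r then Poly_Mapping.lookup f w else 0)"
  by (auto simp: fpart_def lookup_mapp when_def in_keys_iff)

lemma fhom_fpart: "fhom r (fpart r f)"
  by (auto simp: fhom_def in_keys_iff lookup_fpart split: if_splits)

lemma FC_fpart: "f \<in> FC n \<Longrightarrow> fpart r f \<in> FC n"
  by (auto simp: FC_iff in_keys_iff lookup_fpart split: if_splits)

lemma fpart_sum: "fpart 0 f + fpart 1 f = f"
proof (rule poly_mapping_eqI)
  fix w show "Poly_Mapping.lookup (fpart 0 f + fpart 1 f) w = Poly_Mapping.lookup f w"
    using bit_cases[of "wpar w"] by (auto simp: lookup_add lookup_fpart)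
qed

lemma fpart_add: "fpart r (f + g) = fpart r f + fpart r g"
  by (rule poly_mapping_eqI) (simp add: lookup_add lookup_fpart)

lemma fpart_fhom: "fhom s f \<Longrightarrow> fpart r f = (if r = s then f else 0)"
  by (rule poly_mapping_eqI) (auto simp: lookup_fpart fhom_def in_keys_iff)

lemma sig_add: "sig (f + g) = sig f + sig g"
  by (simp add: sig_def fpart_add)

lemma sig_fhom: "fhom r f \<Longrightarrow> sig f = const (ksgn r) * f"
proof -
  have c: "const 1 = 1" "const (-1) = -1"
    by (simp_all add: const_def) (metis single_one single_uminus)
  assume "fhom r f" then show ?thesis
    using bit_cases[of r] by (auto simp: sig_def fpart_fhom c)
qed

lemma FC_sig: "f \<in> FC n \<Longrightarrow> sig f \<in> FC n"
  by (simp add: sig_def FC_diff FC_fpart)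

lemma const_simps: "const 1 = 1" "const (-1) = -1" "const 0 = 0"
    "const (a + b) = const a + const b" "const (a * b) = const a * const b" "const (- a) = - const a"
  by (simp_all add: const_def single_add mult_single single_uminus)

text \<open>\<open>const\<close> is supported on the empty word, the neutral element of the word
  monoid, and the ground field is commutative.\<close>

lemma const_mult_commute: "const a * f = f * const a"
proof (induction f rule: update_induct)
  case const then show ?case by simp
next
  case (update f w b)
  have "Poly_Mapping.update w b f = f + Poly_Mapping.single w b"
    using update(1) by (intro poly_mapping_eqI)
      (auto simp: lookup_update lookup_add lookup_single in_keys_iff when_def)
  moreover have "const a * Poly_Mapping.single w b = Poly_Mapping.single w b * const a"
    by (simp add: const_def mult_single mult.commute)
  ultimately show ?case using update by (simp add: algebra_simps)
qed

text \<open>Splitting both factors reduces this to homogeneous ones, where parities add. So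
  \<open>sig\<close> is the grading automorphism of the free superalgebra.\<close>

lemma sig_mult: "sig (f * g) = sig f * sig g"
proof -
  let ?f = "\<lambda>r. fpart r f" and ?g = "\<lambda>r. fpart r g"
  have h: "sig (?f r * ?g s) = const (ksgn (r + s)) * (?f r * ?g s)" for r s
    by (intro sig_fhom fhom_mult fhom_fpart)
  have "sig (f * g) = sig ((?f 0 + ?f 1) * (?g 0 + ?g 1))"
    by (simp add: fpart_sum)
  also have "\<dots> = (?f 0 - ?f 1) * (?g 0 - ?g 1)"
    by (simp add: distrib_left distrib_right sig_add h const_simps algebra_simps)
  finally show ?thesis by (simp add: sig_def)
qed

lemma sig_0 [simp]: "sig 0 = 0"
  using sig_add[of 0 0] by simp

lemma FreeAlg_simps [simp]:
  "f \<otimes>\<^bsub>FreeAlg n\<^esub> g = f * g" "f \<oplus>\<^bsub>FreeAlg n\<^esub> g = f + g"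
  "\<zero>\<^bsub>FreeAlg n\<^esub> = 0" "\<one>\<^bsub>FreeAlg n\<^esub> = 1"
  by (simp_all add: FreeAlg_def)

lemma ring_FreeAlg: "ring (FreeAlg n)"
proof (rule ringI)
  show "abelian_group (FreeAlg n)"
  proof (rule abelian_groupI)
    fix x assume "x \<in> FC n"
    then show "\<exists>y\<in>FC n. y \<oplus>\<^bsub>FreeAlg n\<^esub> x = \<zero>\<^bsub>FreeAlg n\<^esub>"
      by (intro bexI[of _ "- x"]) (auto intro: FC_uminus)
  qed (auto intro: FC_add simp: algebra_simps)
  show "Group.monoid (FreeAlg n)"
    by (rule Group.monoidI) (auto intro: FC_mult simp: algebra_simps)
qed (auto simp: algebra_simps)

text \<open>Each summand of \<open>\<Theta>\<close> is even. The index 0 is excluded because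
  negation flips \<open>p i\<close> only for nonzero \<open>i\<close>.\<close>

lemma Theta_parity: "Theta i j a b \<noteq> 0 \<Longrightarrow> a \<noteq> 0 \<Longrightarrow> b \<noteq> 0 \<Longrightarrow> pp i j = pp a b"
  by (auto simp: Theta_def E_def pp_def p_def split: if_splits)

lemma bit_add_self [simp]: "(r::bit) + r = 0"
  by (cases r) auto

section \<open>Homogeneity of the defining relations\<close>

definition tens_hom :: "nat \<Rightarrow> tens3 \<Rightarrow> bool" where
  "tens_hom n X \<longleftrightarrow> (\<forall>a\<in>Idx n. \<forall>b\<in>Idx n. \<forall>c\<in>Idx n. \<forall>d\<in>Idx n.
     X a b c d \<in> FC n \<and> fhom (pp a b + pp c d) (X a b c d))"

text \<open>Evenness is the condition under which the sign in \<open>mult3\<close> is that of the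
  super tensor product. Its stability under products makes both sides of the RLL relation
  homogeneous, of the same parity at each position.\<close>

lemma tens_hom_mult3:
  assumes "tens_hom n X" "tens_hom n Y" shows "tens_hom n (mult3 n X Y)"
  unfolding tens_hom_def
proof (intro ballI conjI)
  fix a b c d assume I: "a \<in> Idx n" "b \<in> Idx n" "c \<in> Idx n" "d \<in> Idx n"
  show "mult3 n X Y a b c d \<in> FC n"
    unfolding mult3_def using assms I by (intro FC_intros) (auto simp: tens_hom_def)
  show "fhom (pp a b + pp c d) (mult3 n X Y a b c d)"
    unfolding mult3_def
  proof (intro fhom_sum)
    fix e f assume "e \<in> Idx n" "f \<in> Idx n"
    then have "fhom (0 + ((pp a e + pp c f) + (pp e b + pp f d)))
       (const (ksgn ((pp e b + pp f d) * (pp a e + pp c f) + pp e b * pp c f)) * (X a e c f * Y e b f d))"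
      using assms I by (intro fhom_mult fhom_const) (auto simp: tens_hom_def)
    moreover have "0 + ((pp a e + pp c f) + (pp e b + pp f d)) = pp a b + pp c d"
      by (cases "p a"; cases "p b"; cases "p c"; cases "p d"; cases "p e"; cases "p f") (simp_all add: pp_def)
    ultimately show "fhom (pp a b + pp c d)
       (const (ksgn ((pp e b + pp f d) * (pp a e + pp c f) + pp e b * pp c f)) * (X a e c f * Y e b f d))"
      by simp
  qed
qed

lemma pp_self [simp]: "pp a a = 0"
  by (simp add: pp_def)

lemma Idx_0: "0 \<notin> Idx n"
  by (simp add: Idx_def)

lemma tens_hom_L12: "tens_hom n L12" and tens_hom_L13: "tens_hom n L13"
  using fhom_ugen by (auto simp: tens_hom_def L12_def L13_def gens_def intro: FC_ugen)

lemma tens_hom_Theta23: "tens_hom n Theta23"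
  unfolding tens_hom_def Theta23_def
proof (intro ballI conjI)
  fix a b c d assume I: "a \<in> Idx n" "b \<in> Idx n" "c \<in> Idx n" "d \<in> Idx n"
  show "fhom (pp a b + pp c d) (const (Theta c d a b))"
  proof (cases "Theta c d a b = 0")
    case True then show ?thesis by (simp add: const_simps)
  next
    case False
    then have "pp c d = pp a b" using I Idx_0 by (intro Theta_parity) auto
    then show ?thesis by (simp add: fhom_const)
  qed
qed simp

lemma p_minus: "i \<noteq> 0 \<Longrightarrow> p (- i) = p i + 1"
  by (auto simp: p_def)

lemma Idx_minus: "i \<in> Idx n \<Longrightarrow> - i \<in> Idx n"
  by (auto simp: Idx_def)

lemma finite_Idx [simp]: "finite (Idx n)"
  by (simp add: Idx_def)

lemma U_rels_hom:
  assumes "x \<in> U_rels n" shows "x \<in> FC n \<and> (\<exists>r. fhom r x)"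
  using assms unfolding U_rels_def
proof (elim UnE CollectE exE conjE)
  fix i assume x: "x = ugen i i * ugen (- i) (- i) - 1" and i: "i \<in> Idx n"
  have "fhom (0 + 0) (ugen i i * ugen (- i) (- i))"
    using fhom_ugen[of i i] fhom_ugen[of "-i" "-i"] by (intro fhom_mult) auto
  then have "fhom 0 x" unfolding x by (intro fhom_diff) auto
  moreover have "x \<in> FC n"
    unfolding x using i Idx_minus[OF i] by (intro FC_diff FC_mult FC_ugen) (auto simp: gens_def)
  ultimately show ?thesis by blast
next
  fix a b c d
  assume x: "x = mult3 n L12 (mult3 n L13 Theta23) a b c d - mult3 n Theta23 (mult3 n L13 L12) a b c d"
    and I: "a \<in> Idx n" "b \<in> Idx n" "c \<in> Idx n" "d \<in> Idx n"
  have h: "tens_hom n (mult3 n L12 (mult3 n L13 Theta23))" "tens_hom n (mult3 n Theta23 (mult3 n L13 L12))"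
    by (intro tens_hom_mult3 tens_hom_L12 tens_hom_L13 tens_hom_Theta23)+
  show ?thesis
    unfolding x using h I unfolding tens_hom_def by (blast intro: FC_diff fhom_diff)
qed

lemma ideal_U: "ideal (U_ideal n) (FreeAlg n)"
  unfolding U_ideal_def using U_rels_hom by (intro ring.genideal_ideal ring_FreeAlg) auto

lemma U_rels_sub: "U_rels n \<subseteq> U_ideal n"
  unfolding U_ideal_def using U_rels_hom by (intro ring.genideal_self ring_FreeAlg) auto

context
  fixes n :: nat
begin

interpretation FR: ring "FreeAlg n" by (rule ring_FreeAlg)
interpretation UI: ideal "U_ideal n" "FreeAlg n" by (rule ideal_U)

lemma FreeAlg_a_inv: "f \<in> FC n \<Longrightarrow> \<ominus>\<^bsub>FreeAlg n\<^esub> f = - f"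
  by (rule FR.minus_equality) (auto intro: FC_uminus)

lemma FreeAlg_a_minus: "f \<in> FC n \<Longrightarrow> g \<in> FC n \<Longrightarrow> f \<ominus>\<^bsub>FreeAlg n\<^esub> g = f - g"
  by (simp add: a_minus_def FreeAlg_a_inv)

lemma U_ideal_0: "0 \<in> U_ideal n"
  using UI.zero_closed by simp

lemma U_ideal_add: "x \<in> U_ideal n \<Longrightarrow> y \<in> U_ideal n \<Longrightarrow> x + y \<in> U_ideal n"
  using UI.a_closed[of x y] by simp

lemma U_ideal_lmult: "x \<in> U_ideal n \<Longrightarrow> f \<in> FC n \<Longrightarrow> f * x \<in> U_ideal n"
  using UI.I_l_closed[of x f] by simp

lemma U_ideal_rmult: "x \<in> U_ideal n \<Longrightarrow> f \<in> FC n \<Longrightarrow> x * f \<in> U_ideal n"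
  using UI.I_r_closed[of x f] by simp

text \<open>The preimage of the ideal under the ring homomorphism \<open>sig\<close> is again an
  ideal. It contains the generators, which \<open>sig\<close> only multiplies by a sign, so
  minimality of the generated ideal applies.\<close>

lemma sig_U_ideal: "x \<in> U_ideal n \<Longrightarrow> sig x \<in> U_ideal n"
proof -
  let ?K = "{x \<in> FC n. sig x \<in> U_ideal n}"
  have K: "ideal ?K (FreeAlg n)"
  proof (rule idealI[OF ring_FreeAlg])
    show "subgroup ?K (add_monoid (FreeAlg n))"
    proof (rule subgroup.intro)
      fix x assume x: "x \<in> ?K"
      have e: "inv\<^bsub>add_monoid (FreeAlg n)\<^esub> x = - x"
        using FreeAlg_a_inv x unfolding a_inv_def by auto
      have "sig (- x) = (- 1) * sig x"
        using sig_add[of x "- x"] by (simp add: eq_neg_iff_add_eq_0 add.commute)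
      moreover have "(- 1) * sig x \<in> U_ideal n"
        using x U_ideal_lmult[of "sig x" "-1"] FC_uminus[of 1] by auto
      ultimately show "inv\<^bsub>add_monoid (FreeAlg n)\<^esub> x \<in> ?K"
        using x unfolding e by (auto intro: FC_uminus)
    qed (auto simp: sig_add U_ideal_0 intro: FC_add U_ideal_add)
  qed (auto simp: sig_mult intro: FC_mult FC_sig U_ideal_lmult U_ideal_rmult)
  have "U_rels n \<subseteq> ?K"
  proof
    fix x assume x: "x \<in> U_rels n"
    then obtain r where "x \<in> FC n" "fhom r x" using U_rels_hom by blast
    then show "x \<in> ?K"
      using subsetD[OF U_rels_sub x] by (auto simp: sig_fhom intro: U_ideal_lmult)
  qed
  then have "U_ideal n \<subseteq> ?K"
    using FR.genideal_minimal[OF K] by (simp add: U_ideal_def)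
  then show "x \<in> U_ideal n \<Longrightarrow> sig x \<in> U_ideal n" by auto
qed

section \<open>The quotient superalgebra and its grading\<close>

lemma Uclass_eq_iff:
  assumes "f \<in> FC n" "g \<in> FC n"
  shows "Uclass n f = Uclass n g \<longleftrightarrow> f - g \<in> U_ideal n"
  using FR.quotient_eq_iff_same_a_r_cos[OF ideal_U assms] FreeAlg_a_minus[OF assms]
  by (simp add: Uclass_def)

lemma Uq_simps:
  "carrier (Uq n) = Uclass n ` FC n"
  "hpart (Uq n) r = {Uclass n f | f. f \<in> FC n \<and> fhom r f}"
  "\<zero>\<^bsub>Uq n\<^esub> = Uclass n 0" "\<one>\<^bsub>Uq n\<^esub> = Uclass n 1"
proof -
  show "carrier (Uq n) = Uclass n ` FC n"
    by (auto simp: Uq_def Let_def FactRing_def A_RCOSETS_def' Uclass_def)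
  show "\<zero>\<^bsub>Uq n\<^esub> = Uclass n 0"
    using FR.a_rcos_zero[OF ideal_U U_ideal_0]
    by (simp add: Uq_def Let_def FactRing_def Uclass_def)
qed (simp_all add: Uq_def Let_def FactRing_def Uclass_def fhom_def)

lemma Uclass_add: "f \<in> FC n \<Longrightarrow> g \<in> FC n \<Longrightarrow> Uclass n f \<oplus>\<^bsub>Uq n\<^esub> Uclass n g = Uclass n (f + g)"
  using UI.a_rcos_sum[of f g] by (simp add: Uq_def Let_def FactRing_def Uclass_def)

lemma Uclass_mult: "f \<in> FC n \<Longrightarrow> g \<in> FC n \<Longrightarrow> Uclass n f \<otimes>\<^bsub>Uq n\<^esub> Uclass n g = Uclass n (f * g)"
  using UI.rcoset_mult_add[of f g] by (simp add: Uq_def Let_def FactRing_def Uclass_def)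

lemma Uclass_smult: "f \<in> FC n \<Longrightarrow> a \<odot>\<^bsub>Uq n\<^esub> Uclass n f = Uclass n (const a * f)"
  using UI.rcoset_mult_add[of "const a" f] by (simp add: Uq_def Let_def FactRing_def Uclass_def)

lemma Uclass_carrier [simp]: "f \<in> FC n \<Longrightarrow> Uclass n f \<in> carrier (Uq n)"
  by (simp add: Uq_simps)

lemma Uq_cases:
  assumes "x \<in> carrier (Uq n)" obtains f where "f \<in> FC n" "x = Uclass n f"
  using assms by (auto simp: Uq_simps)

lemma ring_Uq: "ring (Uq n)"
proof (rule ringI)
  show "abelian_group (Uq n)"
  proof (rule abelian_groupI)
    fix x assume "x \<in> carrier (Uq n)"
    then obtain f where f: "f \<in> FC n" "x = Uclass n f" by (rule Uq_cases)
    then show "\<exists>y\<in>carrier (Uq n). y \<oplus>\<^bsub>Uq n\<^esub> x = \<zero>\<^bsub>Uq n\<^esub>"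
      by (intro bexI[of _ "Uclass n (- f)"]) (auto simp: Uclass_add FC_uminus Uq_simps)
  qed (auto elim!: Uq_cases simp: Uclass_add FC_add Uq_simps(3) algebra_simps)
  show "Group.monoid (Uq n)"
    by (rule Group.monoidI) (auto elim!: Uq_cases simp: Uclass_mult FC_mult Uq_simps(4) algebra_simps)
qed (auto elim!: Uq_cases simp: Uclass_mult Uclass_add FC_mult FC_add algebra_simps)

lemma kring_simps [simp]: "carrier kring = UNIV" "a \<oplus>\<^bsub>kring\<^esub> b = a + b" "a \<otimes>\<^bsub>kring\<^esub> b = a * b"
  "\<one>\<^bsub>kring\<^esub> = 1" "\<zero>\<^bsub>kring\<^esub> = 0"
  by (simp_all add: ring_of_type_algebra_def)

lemma module_Uq: "module kring (Uq n)"
proof (rule moduleI)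
  show "abelian_group (Uq n)" by (rule ring.is_abelian_group[OF ring_Uq])
qed (auto elim!: Uq_cases simp: Uclass_smult Uclass_add FC_mult FC_add const_simps algebra_simps
      intro: cring_from_type_algebra)

lemma two_neq_zero: "(2::Cq) \<noteq> 0"
proof -
  have "(2::Cq) = of_nat 2" by simp
  also have "\<dots> \<noteq> 0" by (simp only: of_nat_fract Zero_fract_def) (simp add: eq_fract)
  finally show ?thesis .
qed

text \<open>Applying \<open>sig\<close> to \<open>f + g\<close> gives \<open>f - g\<close>, and half
  the sum of the two recovers \<open>f\<close>; this is where 2 has to be invertible.\<close>

lemma fhom_sum_ideal:
  assumes "f \<in> FC n" "g \<in> FC n" "fhom 0 f" "fhom 1 g" "f + g \<in> U_ideal n"
  shows "f \<in> U_ideal n" "g \<in> U_ideal n"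
proof -
  have "sig (f + g) = f - g"
    using assms by (simp add: sig_add sig_fhom const_simps)
  then have d: "f - g \<in> U_ideal n" using sig_U_ideal[OF assms(5)] by simp
  have c: "const (1/2) + const (1/2) = 1"
    using two_neq_zero by (subst const_simps(4)[symmetric]) (simp add: const_simps)
  have "const (1/2) * ((f + g) + (f - g)) \<in> U_ideal n"
    by (intro U_ideal_lmult U_ideal_add d assms) simp
  also have "const (1/2) * ((f + g) + (f - g)) = (const (1/2) + const (1/2)) * f"
    by (simp add: algebra_simps)
  finally show f: "f \<in> U_ideal n" by (simp add: c)
  have "(- 1) * (f - g) + f \<in> U_ideal n"
    using d f by (intro U_ideal_add U_ideal_lmult FC_uminus) auto
  then show "g \<in> U_ideal n" by simp
qed

lemma Uq_submodule: "submodule (hpart (Uq n) r) kring (Uq n)"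
proof (rule module.submoduleI[OF module_Uq])
  show "hpart (Uq n) r \<subseteq> carrier (Uq n)" by (auto simp: Uq_simps)
  show "\<zero>\<^bsub>Uq n\<^esub> \<in> hpart (Uq n) r" by (auto simp: Uq_simps intro!: exI[of _ 0])
  fix a assume a: "a \<in> hpart (Uq n) r"
  then obtain f where f: "a = Uclass n f" "f \<in> FC n" "fhom r f" by (auto simp: Uq_simps)
  have "\<ominus>\<^bsub>Uq n\<^esub> a = Uclass n (- f)"
    using f by (intro abelian_group.minus_equality[OF ring.is_abelian_group[OF ring_Uq]])
      (auto simp: Uclass_add FC_uminus Uq_simps)
  then show "\<ominus>\<^bsub>Uq n\<^esub> a \<in> hpart (Uq n) r"
    using f by (auto simp: Uq_simps intro!: exI[of _ "- f"] FC_uminus fhom_uminus)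
  show "c \<odot>\<^bsub>Uq n\<^esub> a \<in> hpart (Uq n) r" for c
    using f fhom_mult[OF fhom_const f(3), of c]
    by (auto simp: Uq_simps Uclass_smult intro!: exI[of _ "const c * f"] FC_mult)
  fix b assume "b \<in> hpart (Uq n) r"
  then obtain g where "b = Uclass n g" "g \<in> FC n" "fhom r g" by (auto simp: Uq_simps)
  with f show "a \<oplus>\<^bsub>Uq n\<^esub> b \<in> hpart (Uq n) r"
    by (auto simp: Uq_simps Uclass_add intro!: exI[of _ "f + g"] FC_add fhom_add)
qed

text \<open>Existence comes from \<open>fpart\<close>; uniqueness is \<open>fhom_sum_ideal\<close>
  applied to the differences of two decompositions.\<close>

lemma superspace_Uq: "is_superspace (Uq n)"
  unfolding is_superspace_def
proof (intro conjI ballI allI)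
  fix x assume "x \<in> carrier (Uq n)"
  then obtain f where f: "f \<in> FC n" "x = Uclass n f" by (rule Uq_cases)
  show "\<exists>!w. fst w \<in> hpart (Uq n) 0 \<and> snd w \<in> hpart (Uq n) 1 \<and> x = fst w \<oplus>\<^bsub>Uq n\<^esub> snd w"
  proof (intro ex1I[of _ "(Uclass n (fpart 0 f), Uclass n (fpart 1 f))"])
    show "fst (Uclass n (fpart 0 f), Uclass n (fpart 1 f)) \<in> hpart (Uq n) 0 \<and>
      snd (Uclass n (fpart 0 f), Uclass n (fpart 1 f)) \<in> hpart (Uq n) 1 \<and>
      x = fst (Uclass n (fpart 0 f), Uclass n (fpart 1 f)) \<oplus>\<^bsub>Uq n\<^esub> snd (Uclass n (fpart 0 f), Uclass n (fpart 1 f))"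
      using f by (auto simp: Uq_simps Uclass_add FC_fpart fpart_sum intro: FC_fpart fhom_fpart)
    fix w assume w: "fst w \<in> hpart (Uq n) 0 \<and> snd w \<in> hpart (Uq n) 1 \<and> x = fst w \<oplus>\<^bsub>Uq n\<^esub> snd w"
    then obtain g h where gh: "g \<in> FC n" "h \<in> FC n" "fhom 0 g" "fhom 1 h" "w = (Uclass n g, Uclass n h)"
      by (cases w) (auto simp: Uq_simps)
    with w f have "Uclass n (g + h) = Uclass n f" by (simp add: Uclass_add)
    then have "g + h - f \<in> U_ideal n" using f gh by (simp add: Uclass_eq_iff FC_add)
    then have "(g - fpart 0 f) + (h - fpart 1 f) \<in> U_ideal n"
      by (subst (asm) fpart_sum[of f, symmetric]) (simp add: algebra_simps)
    from fhom_sum_ideal[OF _ _ _ _ this]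
    have "g - fpart 0 f \<in> U_ideal n" "h - fpart 1 f \<in> U_ideal n"
      using f gh by (auto intro: FC_diff FC_fpart fhom_diff fhom_fpart)
    then show "w = (Uclass n (fpart 0 f), Uclass n (fpart 1 f))"
      using f gh by (simp add: Uclass_eq_iff FC_fpart)
  qed
qed (auto intro: module_Uq Uq_submodule)

lemma Uq_hpart_mult:
  assumes "x \<in> hpart (Uq n) r" "y \<in> hpart (Uq n) s" shows "x \<otimes>\<^bsub>Uq n\<^esub> y \<in> hpart (Uq n) (r + s)"
proof -
  obtain f g where "x = Uclass n f" "f \<in> FC n" "fhom r f" "y = Uclass n g" "g \<in> FC n" "fhom s g"
    using assms by (auto simp: Uq_simps)
  then show ?thesis
    by (auto simp: Uq_simps Uclass_mult intro!: exI[of _ "f * g"] FC_mult fhom_mult)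
qed

lemma Uq_smult_mult:
  assumes "x \<in> carrier (Uq n)" "y \<in> carrier (Uq n)"
  shows "(a \<odot>\<^bsub>Uq n\<^esub> x) \<otimes>\<^bsub>Uq n\<^esub> y = a \<odot>\<^bsub>Uq n\<^esub> (x \<otimes>\<^bsub>Uq n\<^esub> y)"
    and "x \<otimes>\<^bsub>Uq n\<^esub> (a \<odot>\<^bsub>Uq n\<^esub> y) = a \<odot>\<^bsub>Uq n\<^esub> (x \<otimes>\<^bsub>Uq n\<^esub> y)"
proof -
  obtain f g where fg: "f \<in> FC n" "x = Uclass n f" "g \<in> FC n" "y = Uclass n g"
    using assms by (metis Uq_cases)
  show "(a \<odot>\<^bsub>Uq n\<^esub> x) \<otimes>\<^bsub>Uq n\<^esub> y = a \<odot>\<^bsub>Uq n\<^esub> (x \<otimes>\<^bsub>Uq n\<^esub> y)"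
    using fg by (simp add: Uclass_mult Uclass_smult FC_mult mult.assoc)
  have "f * (const a * g) = const a * (f * g)"
    by (metis const_mult_commute mult.assoc)
  then show "x \<otimes>\<^bsub>Uq n\<^esub> (a \<odot>\<^bsub>Uq n\<^esub> y) = a \<odot>\<^bsub>Uq n\<^esub> (x \<otimes>\<^bsub>Uq n\<^esub> y)"
    using fg by (simp add: Uclass_mult Uclass_smult FC_mult)
qed

lemma u_carrier: "(i, j) \<in> gens n \<Longrightarrow> u n i j \<in> carrier (Uq n)"
  by (simp add: u_def FC_ugen)

lemma u_hpart: "(i, j) \<in> gens n \<Longrightarrow> u n i j \<in> hpart (Uq n) (pp i j)"
  by (auto simp: u_def Uq_simps intro!: exI[of _ "ugen i j"] FC_ugen fhom_ugen)

end

section \<open>Matrices over an algebra\<close>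

lemma (in abelian_monoid) finsum_delta:
  assumes "finite A" "i \<in> A" "f i \<in> carrier G"
  shows "(\<Oplus>j\<in>A. if j = i then f j else \<zero>) = f i"
    and "(\<Oplus>j\<in>A. if i = j then f j else \<zero>) = f i"
proof -
  have "(\<Oplus>j\<in>A. if j = i then f j else \<zero>) = (\<Oplus>j\<in>A. if i = j then f i else \<zero>)"
    using assms by (intro finsum_cong') auto
  then show "(\<Oplus>j\<in>A. if j = i then f j else \<zero>) = f i"
    using finsum_singleton[of i A "\<lambda>_. f i"] assms by simp
  then show "(\<Oplus>j\<in>A. if i = j then f j else \<zero>) = f i"
    by (simp add: eq_commute)
qed

text \<open>Scalars are central: matrix entries keep their order throughout, while signs and weights
  may be pulled out of any product.\<close>

locale kalgebra = ring R for R :: "(complex poly fract, 'a, 'b) module_scheme" (structure) +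
  assumes mod: "module kring R"
    and smult_left: "x \<in> carrier R \<Longrightarrow> y \<in> carrier R \<Longrightarrow> (a \<odot> x) \<otimes> y = a \<odot> (x \<otimes> y)"
    and smult_right: "x \<in> carrier R \<Longrightarrow> y \<in> carrier R \<Longrightarrow> x \<otimes> (a \<odot> y) = a \<odot> (x \<otimes> y)"
begin

lemma smult_closed [simp]: "x \<in> carrier R \<Longrightarrow> a \<odot> x \<in> carrier R"
  using module.smult_closed[OF mod, of a x] by simp

lemma smult_smult: "x \<in> carrier R \<Longrightarrow> a \<odot> (b \<odot> x) = (a * b) \<odot> x"
  using module.smult_assoc1[OF mod, of a b x] by simp

lemma smult_one [simp]: "x \<in> carrier R \<Longrightarrow> 1 \<odot> x = x"
  using module.smult_one[OF mod, of x] by simp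

lemma smult_0 [simp]: "x \<in> carrier R \<Longrightarrow> 0 \<odot> x = \<zero>" "a \<odot> \<zero> = \<zero>"
  using module.smult_l_null[OF mod, of x] module.smult_r_null[OF mod, of a] by simp_all

lemma smult_finsum:
  "finite A \<Longrightarrow> (\<And>i. i \<in> A \<Longrightarrow> f i \<in> carrier R) \<Longrightarrow> a \<odot> (\<Oplus>i\<in>A. f i) = (\<Oplus>i\<in>A. a \<odot> f i)"
  using module.finsum_smult_ldistr[OF mod, of A a f] by auto

lemma smult_sum:
  "finite A \<Longrightarrow> x \<in> carrier R \<Longrightarrow> sum f A \<odot> x = (\<Oplus>i\<in>A. f i \<odot> x)"
proof (induction A rule: finite_induct)
  case (insert i A)
  then show ?case
    using module.smult_l_distr[OF mod, of "f i" "sum f A" x]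
    by (simp add: finsum_insert)
qed simp

lemma finsum_swap:
  assumes "finite A" "finite B" "\<And>i j. i \<in> A \<Longrightarrow> j \<in> B \<Longrightarrow> f i j \<in> carrier R"
  shows "(\<Oplus>i\<in>A. \<Oplus>j\<in>B. f i j) = (\<Oplus>j\<in>B. \<Oplus>i\<in>A. f i j)"
  using assms(1,3)
proof (induction A rule: finite_induct)
  case (insert i A)
  then have "(\<Oplus>i\<in>insert i A. \<Oplus>j\<in>B. f i j) = (\<Oplus>j\<in>B. f i j) \<oplus> (\<Oplus>j\<in>B. \<Oplus>i\<in>A. f i j)"
    by (subst finsum_insert) auto
  also have "\<dots> = (\<Oplus>j\<in>B. f i j \<oplus> (\<Oplus>i\<in>A. f i j))"
    using insert by (subst finsum_addf) auto
  also have "\<dots> = (\<Oplus>j\<in>B. \<Oplus>i\<in>insert i A. f i j)"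
    using insert by (intro finsum_cong') (auto simp: finsum_insert)
  finally show ?case .
qed (use assms in \<open>simp add: finsum_zero\<close>)

text \<open>Entries off \<open>I\<close> are set to zero so that equality of matrices is equality in
  HOL.\<close>

definition mat :: "'i set \<Rightarrow> ('i \<Rightarrow> 'i \<Rightarrow> 'a) \<Rightarrow> 'i \<Rightarrow> 'i \<Rightarrow> 'a" where
  "mat I f = (\<lambda>i j. if i \<in> I \<and> j \<in> I then f i j else \<zero>)"

text \<open>Only the multiplicative monoid is recorded: matrices are multiplied, inverted and
  traced, but never added.\<close>

definition Mat :: "'i set \<Rightarrow> ('i \<Rightarrow> 'i \<Rightarrow> 'a) monoid" where
  "Mat I = \<lparr> carrier = {A. (\<forall>i\<in>I. \<forall>j\<in>I. A i j \<in> carrier R) \<and> A = mat I A},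
     monoid.mult = (\<lambda>A B. mat I (\<lambda>i j. \<Oplus>k\<in>I. A i k \<otimes> B k j)),
     one = mat I (\<lambda>i j. if i = j then \<one> else \<zero>) \<rparr>"

lemma mat_cong: "(\<And>i j. i \<in> I \<Longrightarrow> j \<in> I \<Longrightarrow> f i j = g i j) \<Longrightarrow> mat I f = mat I g"
  by (auto simp: mat_def fun_eq_iff)

lemma mat_apply [simp]: "i \<in> I \<Longrightarrow> j \<in> I \<Longrightarrow> mat I f i j = f i j"
  by (simp add: mat_def)

lemma mat_mat [simp]: "mat I (mat I f) = mat I f"
  by (auto simp: mat_def fun_eq_iff)

lemma mat_in_Mat: "(\<And>i j. i \<in> I \<Longrightarrow> j \<in> I \<Longrightarrow> f i j \<in> carrier R) \<Longrightarrow> mat I f \<in> carrier (Mat I)"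
  by (simp add: Mat_def)

lemma Mat_entry: "A \<in> carrier (Mat I) \<Longrightarrow> i \<in> I \<Longrightarrow> j \<in> I \<Longrightarrow> A i j \<in> carrier R"
  by (simp add: Mat_def)

lemma Mat_eqI:
  "A \<in> carrier (Mat I) \<Longrightarrow> B \<in> carrier (Mat I) \<Longrightarrow> (\<And>i j. i \<in> I \<Longrightarrow> j \<in> I \<Longrightarrow> A i j = B i j) \<Longrightarrow> A = B"
  unfolding Mat_def by (smt (verit) mat_cong mem_Collect_eq partial_object.select_convs(1))

lemma Mat_mult: "i \<in> I \<Longrightarrow> j \<in> I \<Longrightarrow> (A \<otimes>\<^bsub>Mat I\<^esub> B) i j = (\<Oplus>k\<in>I. A i k \<otimes> B k j)"
  by (simp add: Mat_def)

lemma Mat_one: "i \<in> I \<Longrightarrow> j \<in> I \<Longrightarrow> \<one>\<^bsub>Mat I\<^esub> i j = (if i = j then \<one> else \<zero>)"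
  by (simp add: Mat_def)

lemma monoid_Mat:
  assumes I: "finite I" shows "Group.monoid (Mat I)"
proof (rule Group.monoidI)
  show m: "A \<otimes>\<^bsub>Mat I\<^esub> B \<in> carrier (Mat I)" if "A \<in> carrier (Mat I)" "B \<in> carrier (Mat I)" for A B
    using that I by (auto simp: Mat_def intro!: finsum_closed)
  show o: "\<one>\<^bsub>Mat I\<^esub> \<in> carrier (Mat I)"
    by (simp add: Mat_def)
  fix A assume A: "A \<in> carrier (Mat I)"
  note eA = Mat_entry[OF A]
  show "\<one>\<^bsub>Mat I\<^esub> \<otimes>\<^bsub>Mat I\<^esub> A = A"
  proof (rule Mat_eqI[OF m[OF o A] A])
    fix i j assume ij: "i \<in> I" "j \<in> I"
    have "(\<Oplus>k\<in>I. \<one>\<^bsub>Mat I\<^esub> i k \<otimes> A k j) = (\<Oplus>k\<in>I. if i = k then A k j else \<zero>)"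
      using ij eA by (intro finsum_cong') (auto simp: Mat_one)
    then show "(\<one>\<^bsub>Mat I\<^esub> \<otimes>\<^bsub>Mat I\<^esub> A) i j = A i j"
      using ij eA I by (simp add: Mat_mult finsum_delta)
  qed
  show "A \<otimes>\<^bsub>Mat I\<^esub> \<one>\<^bsub>Mat I\<^esub> = A"
  proof (rule Mat_eqI[OF m[OF A o] A])
    fix i j assume ij: "i \<in> I" "j \<in> I"
    have "(\<Oplus>k\<in>I. A i k \<otimes> \<one>\<^bsub>Mat I\<^esub> k j) = (\<Oplus>k\<in>I. if k = j then A i k else \<zero>)"
      using ij eA by (intro finsum_cong') (auto simp: Mat_one)
    then show "(A \<otimes>\<^bsub>Mat I\<^esub> \<one>\<^bsub>Mat I\<^esub>) i j = A i j"
      using ij eA I by (simp add: Mat_mult finsum_delta)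
  qed
  fix B C assume B: "B \<in> carrier (Mat I)" and C: "C \<in> carrier (Mat I)"
  note eB = Mat_entry[OF B] and eC = Mat_entry[OF C]
  show "A \<otimes>\<^bsub>Mat I\<^esub> B \<otimes>\<^bsub>Mat I\<^esub> C = A \<otimes>\<^bsub>Mat I\<^esub> (B \<otimes>\<^bsub>Mat I\<^esub> C)"
  proof (rule Mat_eqI)
    fix i j assume ij: "i \<in> I" "j \<in> I"
    have "(A \<otimes>\<^bsub>Mat I\<^esub> B \<otimes>\<^bsub>Mat I\<^esub> C) i j = (\<Oplus>k\<in>I. (\<Oplus>l\<in>I. A i l \<otimes> B l k) \<otimes> C k j)"
      using ij eA eB eC by (simp add: Mat_mult cong: finsum_cong)
    also have "\<dots> = (\<Oplus>k\<in>I. \<Oplus>l\<in>I. A i l \<otimes> (B l k \<otimes> C k j))"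
      using ij I eA eB eC by (intro finsum_cong') (auto simp: finsum_ldistr m_assoc cong: finsum_cong intro!: finsum_closed)
    also have "\<dots> = (\<Oplus>l\<in>I. \<Oplus>k\<in>I. A i l \<otimes> (B l k \<otimes> C k j))"
      using ij I eA eB eC by (intro finsum_swap) auto
    also have "\<dots> = (\<Oplus>l\<in>I. A i l \<otimes> (\<Oplus>k\<in>I. B l k \<otimes> C k j))"
      using ij I eA eB eC by (intro finsum_cong') (auto simp: finsum_rdistr cong: finsum_cong intro!: finsum_closed)
    also have "\<dots> = (A \<otimes>\<^bsub>Mat I\<^esub> (B \<otimes>\<^bsub>Mat I\<^esub> C)) i j"
      using ij eA eB eC by (simp add: Mat_mult cong: finsum_cong)
    finally show "(A \<otimes>\<^bsub>Mat I\<^esub> B \<otimes>\<^bsub>Mat I\<^esub> C) i j = (A \<otimes>\<^bsub>Mat I\<^esub> (B \<otimes>\<^bsub>Mat I\<^esub> C)) i j" .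
  qed (intro m A B C)+
qed

definition monomial :: "'i set \<Rightarrow> ('i \<Rightarrow> 'i) \<Rightarrow> ('i \<Rightarrow> Cq) \<Rightarrow> 'i \<Rightarrow> 'i \<Rightarrow> 'a" where
  "monomial I \<pi> s = mat I (\<lambda>i j. if j = \<pi> i then s i \<odot> \<one> else \<zero>)"

lemma monomial_Mat [simp]: "monomial I \<pi> s \<in> carrier (Mat I)"
  unfolding monomial_def by (rule mat_in_Mat) auto

lemma monomial_mult:
  assumes "finite I" "A \<in> carrier (Mat I)" "\<pi> ` I \<subseteq> I" "i \<in> I" "j \<in> I"
  shows "(monomial I \<pi> s \<otimes>\<^bsub>Mat I\<^esub> A) i j = s i \<odot> A (\<pi> i) j"
proof -
  note eA = Mat_entry[OF assms(2)]
  have pi: "\<pi> i \<in> I" using assms by auto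
  have "(monomial I \<pi> s \<otimes>\<^bsub>Mat I\<^esub> A) i j = (\<Oplus>k\<in>I. if k = \<pi> i then s i \<odot> A k j else \<zero>)"
    using assms eA by (auto simp: Mat_mult monomial_def smult_left intro!: finsum_cong')
  then show ?thesis using assms eA pi by (simp add: finsum_delta)
qed

text \<open>Because \<open>\<pi>\<close> is an involution on \<open>I\<close>, the row of the
  monomial matrix with its entry in column \<open>j\<close> is \<open>\<pi> j\<close>.\<close>

lemma mult_monomial:
  assumes "finite I" "A \<in> carrier (Mat I)" "\<And>k. k \<in> I \<Longrightarrow> \<pi> k \<in> I \<and> \<pi> (\<pi> k) = k" "i \<in> I" "j \<in> I"
  shows "(A \<otimes>\<^bsub>Mat I\<^esub> monomial I \<pi> s) i j = s (\<pi> j) \<odot> A i (\<pi> j)"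
proof -
  note eA = Mat_entry[OF assms(2)]
  have pi: "\<pi> j \<in> I" using assms by auto
  have "(A \<otimes>\<^bsub>Mat I\<^esub> monomial I \<pi> s) i j = (\<Oplus>k\<in>I. if k = \<pi> j then s k \<odot> A i k else \<zero>)"
    using assms(1,4,5) assms(3)[of j] eA assms(3)
    by (auto simp: Mat_mult monomial_def smult_right intro!: finsum_cong')
  then show ?thesis using assms eA pi by (simp add: finsum_delta)
qed

lemma monomial_monomial:
  assumes "finite I" "\<pi> ` I \<subseteq> I"
  shows "monomial I \<pi> s \<otimes>\<^bsub>Mat I\<^esub> monomial I \<tau> t = monomial I (\<lambda>i. \<tau> (\<pi> i)) (\<lambda>i. s i * t (\<pi> i))"
proof -
  interpret M: Group.monoid "Mat I" by (rule monoid_Mat[OF assms(1)])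
  show ?thesis
  proof (rule Mat_eqI)
    fix i j assume "i \<in> I" "j \<in> I"
    moreover then have "\<pi> i \<in> I" using assms by auto
    ultimately show "(monomial I \<pi> s \<otimes>\<^bsub>Mat I\<^esub> monomial I \<tau> t) i j = monomial I (\<lambda>i. \<tau> (\<pi> i)) (\<lambda>i. s i * t (\<pi> i)) i j"
      using assms by (simp add: monomial_mult) (simp add: monomial_def smult_smult)
  qed (auto intro: M.m_closed)
qed

lemma monomial_cong: "(\<And>i. i \<in> I \<Longrightarrow> \<pi> i = \<tau> i) \<Longrightarrow> (\<And>i. i \<in> I \<Longrightarrow> s i = t i) \<Longrightarrow> monomial I \<pi> s = monomial I \<tau> t"
  unfolding monomial_def by (rule mat_cong) auto

lemma monomial_one: "monomial I (\<lambda>i. i) (\<lambda>i. 1) = \<one>\<^bsub>Mat I\<^esub>"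
  unfolding monomial_def Mat_def by (auto intro!: mat_cong)

section \<open>Weighted traces and the super flip\<close>

definition tr :: "('i \<Rightarrow> Cq) \<Rightarrow> 'i set \<Rightarrow> ('i \<Rightarrow> 'i \<Rightarrow> 'a) \<Rightarrow> 'a" where
  "tr \<kappa> I A = (\<Oplus>i\<in>I. \<kappa> i \<odot> A i i)"

text \<open>\<open>id2 I A\<close> is \<open>1 \<otimes> A\<close>, and \<open>ptr \<kappa> I X\<close> is the \<open>\<kappa>\<close>-weighted trace of \<open>X\<close> over the first factor.\<close>

definition id2 :: "'i set \<Rightarrow> ('i \<Rightarrow> 'i \<Rightarrow> 'a) \<Rightarrow> 'i \<times> 'i \<Rightarrow> 'i \<times> 'i \<Rightarrow> 'a" where
  "id2 I A = mat (I \<times> I) (\<lambda>(a, c) (b, d). if a = b then A c d else \<zero>)"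

definition ptr :: "('i \<Rightarrow> Cq) \<Rightarrow> 'i set \<Rightarrow> ('i \<times> 'i \<Rightarrow> 'i \<times> 'i \<Rightarrow> 'a) \<Rightarrow> 'i \<Rightarrow> 'i \<Rightarrow> 'a" where
  "ptr \<kappa> I X = mat I (\<lambda>c d. \<Oplus>a\<in>I. \<kappa> a \<odot> X (a, c) (a, d))"

lemma id2_Mat [simp]: "A \<in> carrier (Mat I) \<Longrightarrow> id2 I A \<in> carrier (Mat (I \<times> I))"
  unfolding id2_def by (rule mat_in_Mat) (auto simp: Mat_entry)

lemma ptr_Mat [simp]: "finite I \<Longrightarrow> X \<in> carrier (Mat (I \<times> I)) \<Longrightarrow> ptr \<kappa> I X \<in> carrier (Mat I)"
  unfolding ptr_def by (rule mat_in_Mat) (auto simp: Mat_entry intro!: finsum_closed)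

lemma finsum_product:
  assumes "finite A" "finite B" "\<And>i j. i \<in> A \<Longrightarrow> j \<in> B \<Longrightarrow> f (i, j) \<in> carrier R"
  shows "(\<Oplus>k\<in>A \<times> B. f k) = (\<Oplus>i\<in>A. \<Oplus>j\<in>B. f (i, j))"
  using assms(1,3)
proof (induction A rule: finite_induct)
  case (insert i A)
  have e: "insert i A \<times> B = Pair i ` B \<union> A \<times> B" by auto
  have "(\<Oplus>k\<in>insert i A \<times> B. f k) = (\<Oplus>k\<in>Pair i ` B. f k) \<oplus> (\<Oplus>k\<in>A \<times> B. f k)"
    unfolding e using insert assms(2) by (intro finsum_Un_disjoint) auto
  also have "(\<Oplus>k\<in>Pair i ` B. f k) = (\<Oplus>j\<in>B. f (i, j))"
    using insert by (intro finsum_reindex) (auto simp: inj_on_def)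
  finally show ?case using insert by (subst finsum_insert) (auto intro!: finsum_closed)
qed simp

lemma id2_mult_entry:
  assumes "finite I" "A \<in> carrier (Mat I)" "X \<in> carrier (Mat (I \<times> I))"
    and "a \<in> I" "c \<in> I" "y \<in> I \<times> I"
  shows "(id2 I A \<otimes>\<^bsub>Mat (I \<times> I)\<^esub> X) (a, c) y = (\<Oplus>e\<in>I. A c e \<otimes> X (a, e) y)"
proof -
  note e = Mat_entry[OF assms(2)] Mat_entry[OF assms(3)]
  have "(id2 I A \<otimes>\<^bsub>Mat (I \<times> I)\<^esub> X) (a, c) y = (\<Oplus>k\<in>I \<times> I. case k of (b, e) \<Rightarrow> if a = b then A c e \<otimes> X (b, e) y else \<zero>)"
    using assms e by (auto simp: Mat_mult id2_def intro!: finsum_cong')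
  also have "\<dots> = (\<Oplus>b\<in>I. \<Oplus>e\<in>I. if a = b then A c e \<otimes> X (b, e) y else \<zero>)"
    using assms e by (subst finsum_product) auto
  also have "\<dots> = (\<Oplus>b\<in>I. if a = b then \<Oplus>e\<in>I. A c e \<otimes> X (b, e) y else \<zero>)"
    using assms e by (intro finsum_cong') (auto intro!: finsum_closed)
  also have "\<dots> = (\<Oplus>e\<in>I. A c e \<otimes> X (a, e) y)"
    using assms e by (subst finsum_delta(2)) (auto intro!: finsum_closed)
  finally show ?thesis .
qed

lemma mult_id2_entry:
  assumes "finite I" "A \<in> carrier (Mat I)" "X \<in> carrier (Mat (I \<times> I))"
    and "b \<in> I" "d \<in> I" "x \<in> I \<times> I"
  shows "(X \<otimes>\<^bsub>Mat (I \<times> I)\<^esub> id2 I A) x (b, d) = (\<Oplus>e\<in>I. X x (b, e) \<otimes> A e d)"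
proof -
  note e = Mat_entry[OF assms(2)] Mat_entry[OF assms(3)]
  have "(X \<otimes>\<^bsub>Mat (I \<times> I)\<^esub> id2 I A) x (b, d) = (\<Oplus>k\<in>I \<times> I. case k of (a, e) \<Rightarrow> if b = a then X x (a, e) \<otimes> A e d else \<zero>)"
    using assms e by (auto simp: Mat_mult id2_def intro!: finsum_cong')
  also have "\<dots> = (\<Oplus>a\<in>I. \<Oplus>e\<in>I. if b = a then X x (a, e) \<otimes> A e d else \<zero>)"
    using assms e by (subst finsum_product) auto
  also have "\<dots> = (\<Oplus>a\<in>I. if b = a then \<Oplus>e\<in>I. X x (a, e) \<otimes> A e d else \<zero>)"
    using assms e by (intro finsum_cong') (auto intro!: finsum_closed)
  also have "\<dots> = (\<Oplus>e\<in>I. X x (b, e) \<otimes> A e d)"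
    using assms e by (subst finsum_delta(2)) (auto intro!: finsum_closed)
  finally show ?thesis .
qed

lemma id2_id2:
  assumes "finite I" "A \<in> carrier (Mat I)" "B \<in> carrier (Mat I)"
  shows "id2 I A \<otimes>\<^bsub>Mat (I \<times> I)\<^esub> id2 I B = id2 I (A \<otimes>\<^bsub>Mat I\<^esub> B)"
proof -
  interpret M: Group.monoid "Mat I" by (rule monoid_Mat[OF assms(1)])
  interpret MM: Group.monoid "Mat (I \<times> I)" using assms(1) by (intro monoid_Mat) simp
  note e = Mat_entry[OF assms(2)] Mat_entry[OF assms(3)]
  show ?thesis
  proof (rule Mat_eqI)
    fix x y assume xy: "x \<in> I \<times> I" "y \<in> I \<times> I"
    obtain a c b d where [simp]: "x = (a, c)" "y = (b, d)" by (cases x; cases y)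
    have "(id2 I A \<otimes>\<^bsub>Mat (I \<times> I)\<^esub> id2 I B) x y = (\<Oplus>e\<in>I. A c e \<otimes> id2 I B (a, e) y)"
      using xy assms by (simp add: id2_mult_entry)
    also have "\<dots> = (\<Oplus>e\<in>I. if a = b then A c e \<otimes> B e d else \<zero>)"
      using xy e by (intro finsum_cong') (auto simp: id2_def)
    also have "\<dots> = id2 I (A \<otimes>\<^bsub>Mat I\<^esub> B) x y"
      using xy by (simp add: id2_def Mat_mult)
    finally show "(id2 I A \<otimes>\<^bsub>Mat (I \<times> I)\<^esub> id2 I B) x y = id2 I (A \<otimes>\<^bsub>Mat I\<^esub> B) x y" .
  qed (use assms in auto)
qed

lemma id2_one: "id2 I \<one>\<^bsub>Mat I\<^esub> = \<one>\<^bsub>Mat (I \<times> I)\<^esub>"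
  unfolding id2_def by (auto simp: Mat_def mat_def fun_eq_iff)

text \<open>The index that is summed is untouched by \<open>id2 I A\<close>, and the entries of
  \<open>A\<close> stay to the left of those of \<open>X\<close>. Only scalar weights change places,
  so the identity holds over a noncommutative ring.\<close>

lemma ptr_id2_left:
  assumes I: "finite I" and "A \<in> carrier (Mat I)" "X \<in> carrier (Mat (I \<times> I))"
  shows "ptr \<kappa> I (id2 I A \<otimes>\<^bsub>Mat (I \<times> I)\<^esub> X) = A \<otimes>\<^bsub>Mat I\<^esub> ptr \<kappa> I X"
proof -
  interpret M: Group.monoid "Mat I" by (rule monoid_Mat[OF I])
  interpret MM: Group.monoid "Mat (I \<times> I)" using I by (intro monoid_Mat) simp
  note e = Mat_entry[OF assms(2)] Mat_entry[OF assms(3)]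
  show ?thesis
  proof (rule Mat_eqI)
    fix c d assume cd: "c \<in> I" "d \<in> I"
    have "ptr \<kappa> I (id2 I A \<otimes>\<^bsub>Mat (I \<times> I)\<^esub> X) c d = (\<Oplus>a\<in>I. \<kappa> a \<odot> (\<Oplus>f\<in>I. A c f \<otimes> X (a, f) (a, d)))"
      using cd assms e by (auto simp: ptr_def id2_mult_entry intro!: finsum_cong' finsum_closed)
    also have "\<dots> = (\<Oplus>a\<in>I. \<Oplus>f\<in>I. A c f \<otimes> (\<kappa> a \<odot> X (a, f) (a, d)))"
      using cd I e by (intro finsum_cong') (auto simp: smult_finsum smult_right cong: finsum_cong intro!: finsum_closed)
    also have "\<dots> = (\<Oplus>f\<in>I. \<Oplus>a\<in>I. A c f \<otimes> (\<kappa> a \<odot> X (a, f) (a, d)))"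
      using cd I e by (intro finsum_swap) auto
    also have "\<dots> = (\<Oplus>f\<in>I. A c f \<otimes> (\<Oplus>a\<in>I. \<kappa> a \<odot> X (a, f) (a, d)))"
      using cd I e by (intro finsum_cong') (auto simp: finsum_rdistr cong: finsum_cong intro!: finsum_closed)
    also have "\<dots> = (A \<otimes>\<^bsub>Mat I\<^esub> ptr \<kappa> I X) c d"
      using cd I e by (auto simp: Mat_mult ptr_def intro!: finsum_cong' finsum_closed)
    finally show "ptr \<kappa> I (id2 I A \<otimes>\<^bsub>Mat (I \<times> I)\<^esub> X) c d = (A \<otimes>\<^bsub>Mat I\<^esub> ptr \<kappa> I X) c d" .
  qed (use assms in auto)
qed

lemma ptr_id2_right:
  assumes I: "finite I" and "A \<in> carrier (Mat I)" "X \<in> carrier (Mat (I \<times> I))"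
  shows "ptr \<kappa> I (X \<otimes>\<^bsub>Mat (I \<times> I)\<^esub> id2 I A) = ptr \<kappa> I X \<otimes>\<^bsub>Mat I\<^esub> A"
proof -
  interpret M: Group.monoid "Mat I" by (rule monoid_Mat[OF I])
  interpret MM: Group.monoid "Mat (I \<times> I)" using I by (intro monoid_Mat) simp
  note e = Mat_entry[OF assms(2)] Mat_entry[OF assms(3)]
  show ?thesis
  proof (rule Mat_eqI)
    fix c d assume cd: "c \<in> I" "d \<in> I"
    have "ptr \<kappa> I (X \<otimes>\<^bsub>Mat (I \<times> I)\<^esub> id2 I A) c d = (\<Oplus>a\<in>I. \<kappa> a \<odot> (\<Oplus>f\<in>I. X (a, c) (a, f) \<otimes> A f d))"
      using cd assms e by (auto simp: ptr_def mult_id2_entry intro!: finsum_cong' finsum_closed)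
    also have "\<dots> = (\<Oplus>a\<in>I. \<Oplus>f\<in>I. (\<kappa> a \<odot> X (a, c) (a, f)) \<otimes> A f d)"
      using cd I e by (intro finsum_cong') (auto simp: smult_finsum smult_left cong: finsum_cong intro!: finsum_closed)
    also have "\<dots> = (\<Oplus>f\<in>I. \<Oplus>a\<in>I. (\<kappa> a \<odot> X (a, c) (a, f)) \<otimes> A f d)"
      using cd I e by (intro finsum_swap) auto
    also have "\<dots> = (\<Oplus>f\<in>I. (\<Oplus>a\<in>I. \<kappa> a \<odot> X (a, c) (a, f)) \<otimes> A f d)"
      using cd I e by (intro finsum_cong') (auto simp: finsum_ldistr cong: finsum_cong intro!: finsum_closed)
    also have "\<dots> = (ptr \<kappa> I X \<otimes>\<^bsub>Mat I\<^esub> A) c d"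
      using cd I e by (auto simp: Mat_mult ptr_def intro!: finsum_cong' finsum_closed)
    finally show "ptr \<kappa> I (X \<otimes>\<^bsub>Mat (I \<times> I)\<^esub> id2 I A) c d = (ptr \<kappa> I X \<otimes>\<^bsub>Mat I\<^esub> A) c d" .
  qed (use assms in auto)
qed

definition sflip :: "('i \<Rightarrow> bit) \<Rightarrow> 'i set \<Rightarrow> 'i \<times> 'i \<Rightarrow> 'i \<times> 'i \<Rightarrow> 'a" where
  "sflip g I = monomial (I \<times> I) (\<lambda>(a, c). (c, a)) (\<lambda>(a, c). ksgn (g a * g c))"

lemma sflip_Mat [simp]: "sflip g I \<in> carrier (Mat (I \<times> I))"
  by (simp add: sflip_def)

lemma sflip_left:
  assumes "finite I" "X \<in> carrier (Mat (I \<times> I))" "a \<in> I" "c \<in> I" "y \<in> I \<times> I"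
  shows "(sflip g I \<otimes>\<^bsub>Mat (I \<times> I)\<^esub> X) (a, c) y = ksgn (g a * g c) \<odot> X (c, a) y"
  unfolding sflip_def using assms by (subst monomial_mult) auto

lemma sflip_right:
  assumes "finite I" "X \<in> carrier (Mat (I \<times> I))" "b \<in> I" "d \<in> I" "x \<in> I \<times> I"
  shows "(X \<otimes>\<^bsub>Mat (I \<times> I)\<^esub> sflip g I) x (b, d) = ksgn (g b * g d) \<odot> X x (d, b)"
  unfolding sflip_def using assms by (subst mult_monomial) (auto simp: mult.commute)

lemma sflip_sflip:
  assumes "finite I" shows "sflip g I \<otimes>\<^bsub>Mat (I \<times> I)\<^esub> sflip g I = \<one>\<^bsub>Mat (I \<times> I)\<^esub>"
  unfolding sflip_def monomial_one[symmetric] using assms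
  by (subst monomial_monomial) (auto intro!: monomial_cong simp: mult.commute)

text \<open>Conjugation by the flip renames the two tensor factors, and its two signs cancel on the
  diagonal. This stands in for the cyclicity of the trace.\<close>

lemma tr_ptr_sflip:
  assumes I: "finite I" and "X \<in> carrier (Mat (I \<times> I))"
  shows "tr \<kappa> I (ptr \<mu> I (sflip g I \<otimes>\<^bsub>Mat (I \<times> I)\<^esub> X \<otimes>\<^bsub>Mat (I \<times> I)\<^esub> sflip g I)) = tr \<mu> I (ptr \<kappa> I X)"
proof -
  interpret MM: Group.monoid "Mat (I \<times> I)" using I by (intro monoid_Mat) simp
  note e = Mat_entry[OF assms(2)]
  have x: "(sflip g I \<otimes>\<^bsub>Mat (I \<times> I)\<^esub> X \<otimes>\<^bsub>Mat (I \<times> I)\<^esub> sflip g I) (a, c) (a, c) = X (c, a) (c, a)"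
    if "a \<in> I" "c \<in> I" for a c
    using that assms e by (simp add: sflip_left sflip_right smult_smult mult.commute)
  have "tr \<kappa> I (ptr \<mu> I (sflip g I \<otimes>\<^bsub>Mat (I \<times> I)\<^esub> X \<otimes>\<^bsub>Mat (I \<times> I)\<^esub> sflip g I))
      = (\<Oplus>c\<in>I. \<kappa> c \<odot> (\<Oplus>a\<in>I. \<mu> a \<odot> X (c, a) (c, a)))"
    unfolding tr_def ptr_def using assms e
    by (auto simp: x cong: finsum_cong intro!: finsum_cong' finsum_closed)
  also have "\<dots> = (\<Oplus>c\<in>I. \<Oplus>a\<in>I. \<mu> a \<odot> (\<kappa> c \<odot> X (c, a) (c, a)))"
    using I e by (auto simp: smult_finsum smult_smult mult.commute cong: finsum_cong intro!: finsum_cong' finsum_closed)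
  also have "\<dots> = (\<Oplus>a\<in>I. \<Oplus>c\<in>I. \<mu> a \<odot> (\<kappa> c \<odot> X (c, a) (c, a)))"
    using I e by (intro finsum_swap) auto
  also have "\<dots> = tr \<mu> I (ptr \<kappa> I X)"
    unfolding tr_def ptr_def using I e
    by (auto simp: smult_finsum cong: finsum_cong intro!: finsum_cong' finsum_closed)
  finally show ?thesis .
qed

end

lemma kalgebra_Uq: "kalgebra (Uq n)"
  by (intro kalgebra.intro kalgebra_axioms.intro ring_Uq module_Uq Uq_smult_mult)

section \<open>Weights\<close>

text \<open>The sum telescopes: \<open>(x - inverse x) * w a\<close> is
  \<open>T a - T (a - 1)\<close> for positive \<open>a\<close> and \<open>T (a + 1) - T a\<close>
  for negative \<open>a\<close>, and the upper end contributes \<open>T n = 1\<close>.\<close>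

lemma weight_sum:
  fixes x :: "'a::field"
  assumes x: "x \<noteq> 0" and c: "c \<in> Idx n"
  shows "(x - inverse x) * (\<Sum>a\<in>Idx n \<inter> {c<..}. (if p a = 0 then 1 else - 1) * x powi (2 * \<bar>a\<bar> - 2 * int n - 1))
    = 1 - x powi (2 * \<bar>c\<bar> - 2 * int n - 1 + sgn c)"
proof -
  define w where "w a = (if p a = 0 then 1 else - 1) * x powi (2 * \<bar>a\<bar> - 2 * int n - 1)" for a
  define T where "T a = x powi (2 * \<bar>a\<bar> - 2 * int n)" for a
  have t: "(x - inverse x) * x powi (k - 1) = x powi k - x powi (k - 2)" for k
  proof -
    have "x powi k = x * x powi (k - 1)" "x powi (k - 1) = x * x powi (k - 2)"
      using x power_int_add_1'[of x "k - 1"] power_int_add_1'[of x "k - 2"] by (simp_all add: algebra_simps)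
    then show ?thesis using x by (simp add: field_simps)
  qed
  have pos: "(x - inverse x) * w a = T a - T (a - 1)" if "a > 0" for a
    using that t[of "2 * \<bar>a\<bar> - 2 * int n"] by (simp add: w_def T_def p_def algebra_simps)
  have neg: "(x - inverse x) * w a = T (a + 1) - T a" if "a < 0" for a
  proof -
    have "w a = - (x powi ((- 2 * a - 2 * int n) - 1))" "T a = x powi (- 2 * a - 2 * int n)"
      using that by (simp_all add: w_def T_def p_def algebra_simps)
    moreover have "T (a + 1) = x powi ((- 2 * a - 2 * int n) - 2)"
      unfolding T_def by (rule arg_cong[where f = "power_int x"]) (use that in simp)
    ultimately show ?thesis using t[of "- 2 * a - 2 * int n"] by simp
  qed
  \<comment> \<open>Downward induction from \<open>int n\<close>, over all integers because it has
    to cross 0. The lower bound keeps every newly added index inside \<open>Idx n\<close>.\<close>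
  have "- int n - 1 \<le> c \<longrightarrow> (x - inverse x) * (\<Sum>a\<in>Idx n \<inter> {c<..}. w a) = 1 - (if c \<ge> 0 then T c else T (c + 1))"
    if "c \<le> int n" for c
    using that
  proof (induction c rule: int_le_induct)
    case base
    have "Idx n \<inter> {int n<..} = {}" by (auto simp: Idx_def)
    then show ?case by (simp add: T_def)
  next
    case (step i)
    show ?case
    proof
      assume i: "- int n - 1 \<le> i - 1"
      show "(x - inverse x) * (\<Sum>a\<in>Idx n \<inter> {i - 1<..}. w a) = 1 - (if i - 1 \<ge> 0 then T (i - 1) else T (i - 1 + 1))"
      \<comment> \<open>0 is not an index, so the sum does not change between 0 and -1. Neither does
        the right-hand side, as both of its branches give \<open>T 0\<close>.\<close>
      proof (cases "i = 0")
        case True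
        have "Idx n \<inter> {i - 1<..} = Idx n \<inter> {i<..}" using True by (auto simp: Idx_def)
        then show ?thesis using step i True by simp
      next
        case False
        have "Idx n \<inter> {i - 1<..} = insert i (Idx n \<inter> {i<..})"
          using False i step by (auto simp: Idx_def)
        then have "(x - inverse x) * (\<Sum>a\<in>Idx n \<inter> {i - 1<..}. w a)
            = (x - inverse x) * w i + (x - inverse x) * (\<Sum>a\<in>Idx n \<inter> {i<..}. w a)"
          by (simp add: algebra_simps)
        then show ?thesis using step i False pos[of i] neg[of i] by auto
      qed
    qed
  qed
  moreover have "- int n - 1 \<le> c" "c \<le> int n" "c \<noteq> 0" using c by (auto simp: Idx_def)
  moreover have "(if c \<ge> 0 then T c else T (c + 1)) = x powi (2 * \<bar>c\<bar> - 2 * int n - 1 + sgn c)"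
  proof (cases "c \<ge> 0")
    case True
    then have "2 * \<bar>c\<bar> - 2 * int n = 2 * \<bar>c\<bar> - 2 * int n - 1 + sgn c" using \<open>c \<noteq> 0\<close> by simp
    then show ?thesis using True by (simp add: T_def)
  next
    case False
    then have "2 * \<bar>c + 1\<bar> - 2 * int n = 2 * \<bar>c\<bar> - 2 * int n - 1 + sgn c" by simp
    then show ?thesis using False by (simp only: T_def if_False)
  qed
  ultimately show ?thesis
    by (simp add: w_def)
qed

lemma qq_neq_0: "qq \<noteq> 0"
  by (simp add: qq_def Zero_fract_def eq_fract)

text \<open>\<open>wt\<close> are the coefficients of \<open>cup\<^sub>R\<close>, \<open>wt'\<close> those in the claim.  They solve the triangular systems
  \<open>wt_sum\<close> and \<open>wt'_sum\<close>, which arise from the two partial traces of the R-matrix.\<close>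

definition wt :: "nat \<Rightarrow> int \<Rightarrow> Cq" where
  "wt n i = ksgn (p i) * qq powi (2 * int n - 2 * \<bar>i\<bar> + 1)"

definition wt' :: "nat \<Rightarrow> int \<Rightarrow> Cq" where
  "wt' n i = ksgn (p i) * qq powi (2 * \<bar>i\<bar> - 2 * int n - 1)"

lemma wt'_sum:
  assumes c: "c \<in> Idx n"
  shows "ksgn (p c) * wt' n c * qq powi sgn c + zz * (\<Sum>a\<in>Idx n \<inter> {c<..}. wt' n a) = 1"
proof -
  have "ksgn (p c) * wt' n c * qq powi sgn c = qq powi (2 * \<bar>c\<bar> - 2 * int n - 1 + sgn c)"
    by (simp add: wt'_def power_int_add qq_neq_0 mult.assoc)
  then show ?thesis
    using weight_sum[OF qq_neq_0 c] by (simp add: wt'_def zz_def ksgn_def)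
qed

text \<open>The mirror image of \<open>wt'_sum\<close>: negating the index and inverting
  \<open>q\<close> turn lower sums into upper ones. The sign from \<open>p (- a)\<close> is
  compensated by the sign of \<open>zz\<close>.\<close>

lemma wt_sum:
  assumes c: "c \<in> Idx n"
  shows "ksgn (p c) * wt n c * qq powi sgn c + zz * (\<Sum>a\<in>Idx n \<inter> {..<c}. wt n a) = 1"
proof -
  let ?x = "inverse qq"
  have x: "?x powi k = qq powi (- k)" for k
    by (simp add: power_int_minus power_int_inverse)
  have e: "ksgn (p c) * wt n c * qq powi sgn c = qq powi (2 * int n - 2 * \<bar>c\<bar> + 1 + sgn c)"
    by (simp add: wt_def power_int_add qq_neq_0 mult.assoc)
  have "(\<Sum>a\<in>Idx n \<inter> {..<c}. wt n a) = (\<Sum>a\<in>Idx n \<inter> {- c<..}. wt n (- a))"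
    by (rule sum.reindex_bij_witness[of _ uminus uminus]) (auto simp: Idx_def)
  also have "\<dots> = - (\<Sum>a\<in>Idx n \<inter> {- c<..}. (if p a = 0 then 1 else - 1) * ?x powi (2 * \<bar>a\<bar> - 2 * int n - 1))"
    unfolding sum_negf[symmetric]
    by (intro sum.cong refl) (auto simp: wt_def x p_minus ksgn_def Idx_def p_def algebra_simps)
  also have "zz * \<dots> = (?x - inverse ?x) * (\<Sum>a\<in>Idx n \<inter> {- c<..}. (if p a = 0 then 1 else - 1) * ?x powi (2 * \<bar>a\<bar> - 2 * int n - 1))"
    by (simp add: zz_def algebra_simps)
  also have "\<dots> = 1 - ?x powi (2 * \<bar>c\<bar> - 2 * int n - 1 + sgn (- c))"
    using weight_sum[of ?x "- c" n] qq_neq_0 Idx_minus[OF c] by simp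
  finally have "zz * (\<Sum>a\<in>Idx n \<inter> {..<c}. wt n a) = 1 - qq powi (2 * int n - 2 * \<bar>c\<bar> + 1 + sgn c)"
    unfolding x by (simp add: algebra_simps sgn_minus)
  then show ?thesis unfolding e by simp
qed

text \<open>Off the diagonal every term vanishes: a nonzero \<open>Theta a d c a\<close> forces
  \<open>c = d\<close>, since the summand with negated indices would need \<open>a = - a\<close>. On
  the diagonal this is \<open>wt_sum\<close>. The exponent stays close to the form in which products
  of \<open>Pmat\<close> and \<open>Rmat\<close> produce it.\<close>

lemma Theta_sum_wt:
  assumes "c \<in> Idx n" "d \<in> Idx n"
  shows "(\<Sum>a\<in>Idx n. wt n a * (ksgn (p a * p c + (p c + p a) * (p c + p d) + (p a + p d) * p a) * Theta a d c a))
    = (if c = d then 1 else 0)"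
proof (cases "c = d")
  case True
  have "wt n a * (ksgn (p a * p c + (p c + p a) * (p c + p d) + (p a + p d) * p a) * Theta a d c a)
     = (if a = c then ksgn (p c) * wt n c * qq powi sgn c else 0) + (if a \<in> {..<c} then zz * wt n a else 0)"
    if a: "a \<in> Idx n" for a
  proof -
    have "ksgn (p a * p c + (p c + p a) * (p c + p d) + (p a + p d) * p a) = ksgn (p a)"
      unfolding True by (cases "p a"; cases "p d") simp_all
    then show ?thesis
      using True a assms by (auto simp: Theta_def E_def phi_def mult.assoc Idx_def)
  qed
  then have "(\<Sum>a\<in>Idx n. wt n a * (ksgn (p a * p c + (p c + p a) * (p c + p d) + (p a + p d) * p a) * Theta a d c a))
     = (\<Sum>a\<in>Idx n. (if a = c then ksgn (p c) * wt n c * qq powi sgn c else 0) + (if a \<in> {..<c} then zz * wt n a else 0))"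
    by (intro sum.cong) auto
  also have "\<dots> = ksgn (p c) * wt n c * qq powi sgn c + zz * (\<Sum>a\<in>Idx n \<inter> {..<c}. wt n a)"
    unfolding sum.distrib sum.inter_restrict[OF finite_Idx, symmetric] using assms
    by (simp add: sum_distrib_left)
  finally show ?thesis using wt_sum[OF assms(1)] True by simp
next
  case False
  then have "Theta a d c a = 0" if "a \<in> Idx n" for a
    using that by (auto simp: Theta_def E_def Idx_def)
  then show ?thesis using False by simp
qed

lemma Theta_sum_wt':
  assumes "c \<in> Idx n" "d \<in> Idx n"
  shows "(\<Sum>a\<in>Idx n. wt' n a * (ksgn (p a * p d + (p a + p c) * (p c + p d) + (p c + p a) * p d) * Theta c a a d))
    = (if c = d then 1 else 0)"
proof (cases "c = d")
  case True
  have "wt' n a * (ksgn (p a * p d + (p a + p c) * (p c + p d) + (p c + p a) * p d) * Theta c a a d)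
     = (if a = c then ksgn (p c) * wt' n c * qq powi sgn c else 0) + (if a \<in> {c<..} then zz * wt' n a else 0)"
    if a: "a \<in> Idx n" for a
  proof -
    have "ksgn (p a * p d + (p a + p c) * (p c + p d) + (p c + p a) * p d) = ksgn (p c)"
      unfolding True by (cases "p a"; cases "p d") simp_all
    then show ?thesis
      using True a assms by (auto simp: Theta_def E_def phi_def mult.assoc Idx_def)
  qed
  then have "(\<Sum>a\<in>Idx n. wt' n a * (ksgn (p a * p d + (p a + p c) * (p c + p d) + (p c + p a) * p d) * Theta c a a d))
     = (\<Sum>a\<in>Idx n. (if a = c then ksgn (p c) * wt' n c * qq powi sgn c else 0) + (if a \<in> {c<..} then zz * wt' n a else 0))"
    by (intro sum.cong) auto
  also have "\<dots> = ksgn (p c) * wt' n c * qq powi sgn c + zz * (\<Sum>a\<in>Idx n \<inter> {c<..}. wt' n a)"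
    unfolding sum.distrib sum.inter_restrict[OF finite_Idx, symmetric] using assms
    by (simp add: sum_distrib_left)
  finally show ?thesis using wt'_sum[OF assms(1)] True by simp
next
  case False
  then have "Theta c a a d = 0" if "a \<in> Idx n" for a
    using that by (auto simp: Theta_def E_def Idx_def)
  then show ?thesis using False by simp
qed

section \<open>The matrix of generators\<close>

text \<open>\<open>A\<close> intertwines \<open>B R\<close> with \<open>R B\<close>,
  \<open>J\<close> commutes with both, and \<open>Ai\<close> leads back from \<open>R B\<close> to
  \<open>B R\<close>; so the whole word \<open>Ai J A J\<close> commutes with \<open>B R\<close>. It
  is applied with \<open>A = N1\<close> and \<open>B = N2\<close>.\<close>

lemma (in Group.monoid) intertwine:
  assumes [simp]: "A \<in> carrier G" "Ai \<in> carrier G" "B \<in> carrier G" "R \<in> carrier G" "J \<in> carrier G"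
    and inv: "A \<otimes> Ai = \<one>" "Ai \<otimes> A = \<one>"
    and rll: "A \<otimes> (B \<otimes> R) = R \<otimes> (B \<otimes> A)"
    and JR: "J \<otimes> R = R \<otimes> J" and JB: "J \<otimes> B = B \<otimes> J"
  shows "B \<otimes> (R \<otimes> Ai) = Ai \<otimes> (R \<otimes> B)"
    and "(Ai \<otimes> J \<otimes> A \<otimes> J) \<otimes> (B \<otimes> R) = (B \<otimes> R) \<otimes> (Ai \<otimes> J \<otimes> A \<otimes> J)"
proof -
  have "B \<otimes> (R \<otimes> Ai) = (Ai \<otimes> A) \<otimes> (B \<otimes> (R \<otimes> Ai))" by (simp add: inv)
  also have "\<dots> = Ai \<otimes> (A \<otimes> (B \<otimes> R)) \<otimes> Ai" by (simp add: m_assoc)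
  also have "\<dots> = Ai \<otimes> (R \<otimes> (B \<otimes> (A \<otimes> Ai)))" by (simp add: rll m_assoc)
  finally show 1: "B \<otimes> (R \<otimes> Ai) = Ai \<otimes> (R \<otimes> B)" by (simp add: inv)
  have JBR: "J \<otimes> (B \<otimes> R) = (B \<otimes> R) \<otimes> J" and JRB: "J \<otimes> (R \<otimes> B) = (R \<otimes> B) \<otimes> J"
    using JR JB by (metis assms(3,4,5) m_assoc)+
  have "(Ai \<otimes> J \<otimes> A \<otimes> J) \<otimes> (B \<otimes> R) = Ai \<otimes> (J \<otimes> (A \<otimes> (J \<otimes> (B \<otimes> R))))" by (simp add: m_assoc)
  also have "\<dots> = Ai \<otimes> (J \<otimes> ((A \<otimes> (B \<otimes> R)) \<otimes> J))" by (simp add: JBR m_assoc)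
  also have "\<dots> = Ai \<otimes> ((J \<otimes> (R \<otimes> B)) \<otimes> (A \<otimes> J))" by (simp add: rll m_assoc)
  also have "\<dots> = (Ai \<otimes> (R \<otimes> B)) \<otimes> (J \<otimes> (A \<otimes> J))" by (simp add: JRB m_assoc)
  also have "\<dots> = (B \<otimes> R) \<otimes> (Ai \<otimes> J \<otimes> A \<otimes> J)" by (simp add: 1[symmetric] m_assoc)
  finally show "(Ai \<otimes> J \<otimes> A \<otimes> J) \<otimes> (B \<otimes> R) = (B \<otimes> R) \<otimes> (Ai \<otimes> J \<otimes> A \<otimes> J)" .
qed

lemma (in Group.monoid) conj_pow:
  assumes "A \<in> carrier G" "B \<in> carrier G" "X \<in> carrier G" "B \<otimes> A = \<one>" "A \<otimes> B = \<one>"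
  shows "(A \<otimes> X \<otimes> B) [^] (m::nat) = A \<otimes> X [^] m \<otimes> B"
proof (induction m)
  case (Suc m)
  have "(A \<otimes> X \<otimes> B) [^] Suc m = A \<otimes> X [^] m \<otimes> ((B \<otimes> A) \<otimes> (X \<otimes> B))"
    using assms(1-3) Suc by (simp add: m_assoc)
  also have "\<dots> = A \<otimes> X [^] m \<otimes> (\<one> \<otimes> (X \<otimes> B))" by (simp only: assms(4))
  finally show ?case using assms(1-3) by (simp add: m_assoc)
qed (use assms in simp)

lemma (in Group.monoid) commute_pow:
  assumes "X \<in> carrier G" "Q \<in> carrier G" "X \<otimes> Q = Q \<otimes> X"
  shows "X [^] (m::nat) \<otimes> Q = Q \<otimes> X [^] m"
proof (induction m)
  case (Suc m)
  have "X [^] Suc m \<otimes> Q = X [^] m \<otimes> Q \<otimes> X" using assms by (simp add: m_assoc)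
  then show ?case using assms Suc by (simp add: m_assoc)
qed (use assms in simp)

lemma finite_paths: "finite (paths n m i j)"
proof (rule finite_subset)
  show "paths n m i j \<subseteq> {0..m} \<rightarrow>\<^sub>E Idx n" by (auto simp: paths_def)
qed (auto intro: finite_PiE)

lemma paths_Suc:
  assumes "j \<in> Idx n"
  shows "paths n (Suc m) i j = (\<Union>k\<in>Idx n. (\<lambda>c. c(Suc m := j)) ` paths n m i k)" (is "?L = ?R")
proof
  show "?L \<subseteq> ?R"
  proof
    fix c assume c: "c \<in> ?L"
    then have cE: "c \<in> {0..Suc m} \<rightarrow>\<^sub>E Idx n" and e: "c 0 = i" "c (Suc m) = j"
      by (auto simp: paths_def)
    \<comment> \<open>Paths are extensional on \<open>{0..m}\<close>, so shortening one means
      resetting its last value to \<open>undefined\<close>.\<close>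
    let ?d = "c(Suc m := undefined)"
    have "?d \<in> paths n m i (c m)"
      using cE e by (auto simp: paths_def PiE_def extensional_def Pi_def)
    moreover have "c = ?d(Suc m := j)" using e by auto
    moreover have "c m \<in> Idx n" using cE by (auto simp: PiE_def Pi_def)
    ultimately show "c \<in> ?R" by blast
  qed
  show "?R \<subseteq> ?L"
    using assms by (auto simp: paths_def PiE_def extensional_def Pi_def)
qed

lemma paths_upd_inj: "inj_on (\<lambda>c. c(Suc m := j)) (paths n m i k)"
proof (rule inj_onI)
  fix c d assume cd: "c \<in> paths n m i k" "d \<in> paths n m i k" "c(Suc m := j) = d(Suc m := j)"
  show "c = d"
  proof
    fix x show "c x = d x"
    proof (cases "x = Suc m")
      case True then show ?thesis using cd(1,2) by (auto simp: paths_def PiE_def extensional_def)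
    next
      case False then show ?thesis using fun_cong[OF cd(3), of x] by simp
    qed
  qed
qed

locale Uq_antipode =
  fixes n :: nat and S :: "free set \<Rightarrow> free set"
  assumes antipode: "antipode n S"
begin

sublocale U: kalgebra "Uq n"
  by (rule kalgebra_Uq)

abbreviation "I \<equiv> Idx n"
abbreviation "K \<equiv> Idx n \<times> Idx n"
abbreviation "M1 \<equiv> U.Mat (Idx n)"
abbreviation "M2 \<equiv> U.Mat (Idx n \<times> Idx n)"

sublocale M1: Group.monoid "U.Mat (Idx n)"
  by (rule U.monoid_Mat) simp

sublocale M2: Group.monoid "U.Mat (Idx n \<times> Idx n)"
  by (rule U.monoid_Mat) simp

text \<open>The sign is a cochain whose coboundary is the sign in the antipode relations, so that \<open>Nmat\<close> and
  \<open>Nimat\<close> are inverse as ordinary matrices.\<close>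

definition "Nmat = U.mat I (\<lambda>i j. if i \<le> j then ksgn (p i + p i * p j) \<odot>\<^bsub>Uq n\<^esub> u n i j else \<zero>\<^bsub>Uq n\<^esub>)"

definition "Nimat = U.mat I (\<lambda>i j. if i \<le> j then ksgn (p i + p i * p j) \<odot>\<^bsub>Uq n\<^esub> S (u n i j) else \<zero>\<^bsub>Uq n\<^esub>)"

lemma u_closed [simp]: "i \<in> I \<Longrightarrow> j \<in> I \<Longrightarrow> i \<le> j \<Longrightarrow> u n i j \<in> carrier (Uq n)"
  by (rule u_carrier) (simp add: gens_def)

lemma S_closed [simp]: "x \<in> carrier (Uq n) \<Longrightarrow> S x \<in> carrier (Uq n)"
  using antipode by (auto simp: antipode_def)

lemma Nmat_Mat [simp]: "Nmat \<in> carrier M1"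
  unfolding Nmat_def by (rule U.mat_in_Mat) (auto intro: u_closed)

lemma Nimat_Mat [simp]: "Nimat \<in> carrier M1"
  unfolding Nimat_def by (rule U.mat_in_Mat) (auto intro: u_closed S_closed)

lemma ksgn_cocycle:
  "ksgn (p i + p i * p k) * ksgn (p k + p k * p j) = ksgn (p i + p i * p j) * ksgn (pp i k * pp k j)"
  by (cases "p i"; cases "p j"; cases "p k") (simp_all add: pp_def)

text \<open>The two halves of the antipode condition have this shape with \<open>u\<close> and
  \<open>S u\<close> exchanged, whence two arbitrary families. By \<open>ksgn_cocycle\<close> the
  signs leave a common factor depending on \<open>i\<close> and \<open>j\<close> only, which is 1
  for \<open>i = j\<close>.\<close>

lemma triangular_product:
  assumes a: "\<And>i j. i \<in> I \<Longrightarrow> j \<in> I \<Longrightarrow> i \<le> j \<Longrightarrow> a i j \<in> carrier (Uq n)"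
    and b: "\<And>i j. i \<in> I \<Longrightarrow> j \<in> I \<Longrightarrow> i \<le> j \<Longrightarrow> b i j \<in> carrier (Uq n)"
    and e: "\<And>i j. i \<in> I \<Longrightarrow> j \<in> I \<Longrightarrow> i \<le> j \<Longrightarrow>
       (\<Oplus>\<^bsub>Uq n\<^esub>k\<in>I \<inter> {i..j}. ksgn (pp i k * pp k j) \<odot>\<^bsub>Uq n\<^esub> (a i k \<otimes>\<^bsub>Uq n\<^esub> b k j))
          = (if i = j then \<one>\<^bsub>Uq n\<^esub> else \<zero>\<^bsub>Uq n\<^esub>)"
  shows "U.mat I (\<lambda>i j. if i \<le> j then ksgn (p i + p i * p j) \<odot>\<^bsub>Uq n\<^esub> a i j else \<zero>\<^bsub>Uq n\<^esub>) \<otimes>\<^bsub>M1\<^esub>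
     U.mat I (\<lambda>i j. if i \<le> j then ksgn (p i + p i * p j) \<odot>\<^bsub>Uq n\<^esub> b i j else \<zero>\<^bsub>Uq n\<^esub>) = \<one>\<^bsub>M1\<^esub>" (is "?A \<otimes>\<^bsub>M1\<^esub> ?B = _")
proof (rule U.Mat_eqI)
  have AB: "?A \<in> carrier M1" "?B \<in> carrier M1"
    by (rule U.mat_in_Mat, simp add: a b)+
  then show "?A \<otimes>\<^bsub>M1\<^esub> ?B \<in> carrier M1" "\<one>\<^bsub>M1\<^esub> \<in> carrier M1"
    by (simp_all only: M1.m_closed M1.one_closed)
  fix i j assume ij: "i \<in> I" "j \<in> I"
  have "(?A \<otimes>\<^bsub>M1\<^esub> ?B) i j = (\<Oplus>\<^bsub>Uq n\<^esub>k\<in>I. ?A i k \<otimes>\<^bsub>Uq n\<^esub> ?B k j)"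
    using ij by (simp add: U.Mat_mult del: U.mat_apply)
  also have "\<dots> = (\<Oplus>\<^bsub>Uq n\<^esub>k\<in>I \<inter> {i..j}. ksgn (p i + p i * p j) \<odot>\<^bsub>Uq n\<^esub>
      (ksgn (pp i k * pp k j) \<odot>\<^bsub>Uq n\<^esub> (a i k \<otimes>\<^bsub>Uq n\<^esub> b k j)))"
  proof (intro U.add.finprod_mono_neutral_cong_right)
    fix k assume k: "k \<in> I \<inter> {i..j}"
    then show "?A i k \<otimes>\<^bsub>Uq n\<^esub> ?B k j = ksgn (p i + p i * p j) \<odot>\<^bsub>Uq n\<^esub>
      (ksgn (pp i k * pp k j) \<odot>\<^bsub>Uq n\<^esub> (a i k \<otimes>\<^bsub>Uq n\<^esub> b k j))"
      using ij a b ksgn_cocycle[of i k j]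
      by (simp add: U.smult_left U.smult_right U.smult_smult mult.commute)
  next
    fix k assume "k \<in> I - I \<inter> {i..j}"
    then show "?A i k \<otimes>\<^bsub>Uq n\<^esub> ?B k j = \<zero>\<^bsub>Uq n\<^esub>"
      using ij a b by auto
  qed (use ij a b in auto)
  also have "\<dots> = ksgn (p i + p i * p j) \<odot>\<^bsub>Uq n\<^esub> (\<Oplus>\<^bsub>Uq n\<^esub>k\<in>I \<inter> {i..j}.
      ksgn (pp i k * pp k j) \<odot>\<^bsub>Uq n\<^esub> (a i k \<otimes>\<^bsub>Uq n\<^esub> b k j))"
    using ij a b by (subst U.smult_finsum) auto
  also have "\<dots> = (if i = j then \<one>\<^bsub>Uq n\<^esub> else \<zero>\<^bsub>Uq n\<^esub>)"
  proof (cases "i \<le> j")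
    case True
    have "ksgn (p i + p i * p i) = 1" by (cases "p i") auto
    then show ?thesis using e[OF ij True] by (auto simp: U.smult_one)
  next
    case False then show ?thesis by simp
  qed
  finally show "(?A \<otimes>\<^bsub>M1\<^esub> ?B) i j = \<one>\<^bsub>M1\<^esub> i j" using ij by (simp add: U.Mat_one)
qed

lemma Nmat_inv: "Nmat \<otimes>\<^bsub>M1\<^esub> Nimat = \<one>\<^bsub>M1\<^esub>" "Nimat \<otimes>\<^bsub>M1\<^esub> Nmat = \<one>\<^bsub>M1\<^esub>"
  unfolding Nmat_def Nimat_def
  using antipode by (auto intro!: triangular_product u_closed S_closed simp: antipode_def gens_def)

text \<open>The same device for \<open>End(V)\<^sup>\<otimes>\<^sup>2\<close>: \<open>hsg\<close> turns the super product \<open>mult3\<close> into the ordinary matrix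
  product.  It is \<open>pp c d * p b\<close>, from letting \<open>E\<^sub>a\<^sub>b \<otimes> E\<^sub>c\<^sub>d\<close> act on \<open>v\<^sub>b \<otimes> v\<^sub>d\<close>, plus the cochain that
  compensates for the parity of the coefficient.\<close>

definition hsg :: "int \<Rightarrow> int \<Rightarrow> int \<Rightarrow> int \<Rightarrow> bit" where
  "hsg a b c d = (p a + p c) * (p a + p b + p c + p d) + pp c d * p b"

definition Hmat :: "tens3 \<Rightarrow> int \<times> int \<Rightarrow> int \<times> int \<Rightarrow> free set" where
  "Hmat X = U.mat K (\<lambda>x y. Uclass n (const (ksgn (hsg (fst x) (fst y) (snd x) (snd y)))
       * X (fst x) (fst y) (snd x) (snd y)))"

lemma Hmat_Mat: "tens_hom n X \<Longrightarrow> Hmat X \<in> carrier M2"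
  unfolding Hmat_def by (rule U.mat_in_Mat) (auto simp: tens_hom_def intro!: Uclass_carrier FC_mult)

lemma Uclass_sum: "finite A \<Longrightarrow> (\<And>i. i \<in> A \<Longrightarrow> f i \<in> FC n) \<Longrightarrow>
    Uclass n (sum f A) = (\<Oplus>\<^bsub>Uq n\<^esub>i\<in>A. Uclass n (f i))"
proof (induction A rule: finite_induct)
  case empty then show ?case by (simp add: Uq_simps)
next
  case (insert i A)
  moreover have "sum f A \<in> FC n" using insert by (intro FC_sum) simp
  ultimately have "Uclass n (sum f (insert i A)) = Uclass n (f i) \<oplus>\<^bsub>Uq n\<^esub> Uclass n (sum f A)"
    by (subst Uclass_add) auto
  then show ?case using insert by (subst U.finsum_insert) auto
qed

text \<open>The identity \<open>s\<close> says that the sign in \<open>mult3\<close> is the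
  coboundary of \<open>hsg\<close>. It is checked on all parities of the six indices.\<close>

lemma Hmat_mult3:
  assumes X: "tens_hom n X" and Y: "tens_hom n Y"
  shows "Hmat (mult3 n X Y) = Hmat X \<otimes>\<^bsub>M2\<^esub> Hmat Y"
proof (rule U.Mat_eqI)
  show "Hmat (mult3 n X Y) \<in> carrier M2" "Hmat X \<otimes>\<^bsub>M2\<^esub> Hmat Y \<in> carrier M2"
    using X Y by (auto intro!: Hmat_Mat tens_hom_mult3)
  fix x y assume "x \<in> K" "y \<in> K"
  then obtain a b c d where xy: "x = (a, c)" "y = (b, d)" and I: "a \<in> I" "b \<in> I" "c \<in> I" "d \<in> I" by auto
  have FX: "e \<in> I \<Longrightarrow> f \<in> I \<Longrightarrow> X a e c f \<in> FC n" and FY: "e \<in> I \<Longrightarrow> f \<in> I \<Longrightarrow> Y e b f d \<in> FC n" for e f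
    using X Y I by (auto simp: tens_hom_def)
  note HX = Hmat_Mat[OF X] and HY = Hmat_Mat[OF Y]
  have s: "const (ksgn (hsg a b c d)) * (const (ksgn ((pp e b + pp f d) * (pp a e + pp c f) + pp e b * pp c f)) * (X a e c f * Y e b f d))
      = (const (ksgn (hsg a e c f)) * X a e c f) * (const (ksgn (hsg e b f d)) * Y e b f d)" for e f
  proof -
    have "ksgn (hsg a b c d + ((pp e b + pp f d) * (pp a e + pp c f) + pp e b * pp c f)) = ksgn (hsg a e c f + hsg e b f d)"
      by (rule arg_cong[where f = ksgn], cases "p a"; cases "p b"; cases "p c"; cases "p d"; cases "p e"; cases "p f")
        (simp_all add: hsg_def pp_def)
    then have "const (ksgn (hsg a b c d)) * const (ksgn ((pp e b + pp f d) * (pp a e + pp c f) + pp e b * pp c f))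
        = const (ksgn (hsg a e c f)) * const (ksgn (hsg e b f d))"
      by (simp only: const_simps(5)[symmetric] ksgn_add)
    then have "const (ksgn (hsg a b c d)) * (const (ksgn ((pp e b + pp f d) * (pp a e + pp c f) + pp e b * pp c f)) * (X a e c f * Y e b f d))
        = const (ksgn (hsg a e c f)) * ((const (ksgn (hsg e b f d)) * X a e c f) * Y e b f d)"
      by (simp only: mult.assoc[symmetric])
    then show ?thesis
      by (simp only: const_mult_commute[of "ksgn (hsg e b f d)" "X a e c f"] mult.assoc)
  qed
  have "Hmat (mult3 n X Y) x y = Uclass n (\<Sum>e\<in>I. \<Sum>f\<in>I.
      (const (ksgn (hsg a e c f)) * X a e c f) * (const (ksgn (hsg e b f d)) * Y e b f d))"
    using I by (simp add: Hmat_def xy mult3_def sum_distrib_left s)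
  also have "\<dots> = Uclass n (\<Sum>z\<in>K.
      (const (ksgn (hsg a (fst z) c (snd z))) * X a (fst z) c (snd z)) * (const (ksgn (hsg (fst z) b (snd z) d)) * Y (fst z) b (snd z) d))"
    by (simp add: sum.cartesian_product case_prod_unfold)
  also have "\<dots> = (\<Oplus>\<^bsub>Uq n\<^esub>z\<in>K. Uclass n
      ((const (ksgn (hsg a (fst z) c (snd z))) * X a (fst z) c (snd z)) * (const (ksgn (hsg (fst z) b (snd z) d)) * Y (fst z) b (snd z) d)))"
    using FX FY by (subst Uclass_sum) (auto intro!: FC_mult)
  also have "\<dots> = (\<Oplus>\<^bsub>Uq n\<^esub>z\<in>K. Hmat X x z \<otimes>\<^bsub>Uq n\<^esub> Hmat Y z y)"
  proof (rule U.finsum_cong')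
    fix z assume z: "z \<in> K"
    have "const (ksgn (hsg a (fst z) c (snd z))) * X a (fst z) c (snd z) \<in> FC n"
      "const (ksgn (hsg (fst z) b (snd z) d)) * Y (fst z) b (snd z) d \<in> FC n"
      using z FX FY by (auto intro!: FC_mult)
    then show "Uclass n
      ((const (ksgn (hsg a (fst z) c (snd z))) * X a (fst z) c (snd z)) * (const (ksgn (hsg (fst z) b (snd z) d)) * Y (fst z) b (snd z) d))
      = Hmat X x z \<otimes>\<^bsub>Uq n\<^esub> Hmat Y z y"
      using I z by (simp add: Hmat_def xy Uclass_mult del: mult_cancel_left mult_cancel_right)
  qed (use xy I in \<open>auto intro!: U.m_closed U.Mat_entry[OF HX] U.Mat_entry[OF HY]\<close>)
  finally show "Hmat (mult3 n X Y) x y = (Hmat X \<otimes>\<^bsub>M2\<^esub> Hmat Y) x y"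
    using xy I by (simp add: U.Mat_mult)
qed

section \<open>The two copies of the generator matrix and the R-matrix\<close>

definition "Pmat = U.sflip p I"
definition "N2 = U.id2 I Nmat"
definition "Ni2 = U.id2 I Nimat"
text \<open>The copy on the first factor is obtained by flipping the one on the second, so its
  inverse and its relations follow from \<open>N2\<close>. \<open>Hmat_L12\<close> identifies it
  with the matrix of \<open>L12\<close>.\<close>

definition "N1 = Pmat \<otimes>\<^bsub>M2\<^esub> N2 \<otimes>\<^bsub>M2\<^esub> Pmat"
definition "Ni1 = Pmat \<otimes>\<^bsub>M2\<^esub> Ni2 \<otimes>\<^bsub>M2\<^esub> Pmat"
definition "Rmat = Hmat Theta23"

lemma M2_closed [simp]: "Pmat \<in> carrier M2" "N2 \<in> carrier M2" "Ni2 \<in> carrier M2" "N1 \<in> carrier M2"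
    "Ni1 \<in> carrier M2" "Rmat \<in> carrier M2"
  by (simp_all add: Pmat_def N2_def Ni2_def N1_def Ni1_def Rmat_def Hmat_Mat tens_hom_Theta23)

lemma PP: "Pmat \<otimes>\<^bsub>M2\<^esub> Pmat = \<one>\<^bsub>M2\<^esub>"
  unfolding Pmat_def by (rule U.sflip_sflip) simp

lemma PP_cancel: "X \<in> carrier M2 \<Longrightarrow> Pmat \<otimes>\<^bsub>M2\<^esub> (Pmat \<otimes>\<^bsub>M2\<^esub> X) = X"
  by (simp add: M2.m_assoc[symmetric] PP)

lemma P_conj:
  assumes "X \<in> carrier M2" "a \<in> I" "b \<in> I" "c \<in> I" "d \<in> I"
  shows "(Pmat \<otimes>\<^bsub>M2\<^esub> X \<otimes>\<^bsub>M2\<^esub> Pmat) (a, c) (b, d) = ksgn (p a * p c + p b * p d) \<odot>\<^bsub>Uq n\<^esub> X (c, a) (d, b)"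
  using assms U.Mat_entry[OF assms(1)]
  by (simp add: Pmat_def U.sflip_left U.sflip_right U.smult_smult ksgn_add mult.commute)

lemma N2_inv: "N2 \<otimes>\<^bsub>M2\<^esub> Ni2 = \<one>\<^bsub>M2\<^esub>" "Ni2 \<otimes>\<^bsub>M2\<^esub> N2 = \<one>\<^bsub>M2\<^esub>"
  by (simp_all add: N2_def Ni2_def U.id2_id2 Nmat_inv U.id2_one)

lemma N1_inv: "N1 \<otimes>\<^bsub>M2\<^esub> Ni1 = \<one>\<^bsub>M2\<^esub>" "Ni1 \<otimes>\<^bsub>M2\<^esub> N1 = \<one>\<^bsub>M2\<^esub>"
proof -
  have "N1 \<otimes>\<^bsub>M2\<^esub> Ni1 = Pmat \<otimes>\<^bsub>M2\<^esub> ((N2 \<otimes>\<^bsub>M2\<^esub> Ni2) \<otimes>\<^bsub>M2\<^esub> Pmat)"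
    by (simp add: N1_def Ni1_def M2.m_assoc PP_cancel)
  then show "N1 \<otimes>\<^bsub>M2\<^esub> Ni1 = \<one>\<^bsub>M2\<^esub>" by (simp add: N2_inv PP)
  have "Ni1 \<otimes>\<^bsub>M2\<^esub> N1 = Pmat \<otimes>\<^bsub>M2\<^esub> ((Ni2 \<otimes>\<^bsub>M2\<^esub> N2) \<otimes>\<^bsub>M2\<^esub> Pmat)"
    by (simp add: N1_def Ni1_def M2.m_assoc PP_cancel)
  then show "Ni1 \<otimes>\<^bsub>M2\<^esub> N1 = \<one>\<^bsub>M2\<^esub>" by (simp add: N2_inv PP)
qed

text \<open>For \<open>a = b\<close> the cochain \<open>hsg\<close> restricts to the sign in
  \<open>Nmat\<close>.\<close>

lemma Hmat_L13: "Hmat L13 = N2"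
proof (rule U.Mat_eqI)
  show "Hmat L13 \<in> carrier M2" "N2 \<in> carrier M2" by (simp_all add: Hmat_Mat tens_hom_L13)
  fix x y assume "x \<in> K" "y \<in> K"
  then obtain a b c d where xy: "x = (a, c)" "y = (b, d)" and I: "a \<in> I" "b \<in> I" "c \<in> I" "d \<in> I" by auto
  have "hsg b b c d = p c + p c * p d"
    by (cases "p b"; cases "p c"; cases "p d") (simp_all add: hsg_def pp_def)
  then show "Hmat L13 x y = N2 x y"
    using I by (simp add: xy Hmat_def N2_def U.id2_def Nmat_def L13_def u_def Uclass_smult FC_ugen gens_def Uq_simps)
qed

lemma Hmat_L12: "Hmat L12 = N1"
proof (rule U.Mat_eqI)
  show "Hmat L12 \<in> carrier M2" "N1 \<in> carrier M2" by (simp_all add: Hmat_Mat tens_hom_L12)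
  fix x y assume "x \<in> K" "y \<in> K"
  then obtain a b c d where xy: "x = (a, c)" "y = (b, d)" and I: "a \<in> I" "b \<in> I" "c \<in> I" "d \<in> I" by auto
  have h: "hsg a b d d = p a * p d + p b * p d + (p a + p a * p b)"
    by (cases "p a"; cases "p b"; cases "p d") (simp_all add: hsg_def pp_def)
  have "N1 x y = ksgn (p a * p c + p b * p d) \<odot>\<^bsub>Uq n\<^esub> N2 (c, a) (d, b)"
    unfolding N1_def xy using I by (intro P_conj) auto
  also have "\<dots> = (if a \<le> b \<and> c = d then ksgn (hsg a b d d) \<odot>\<^bsub>Uq n\<^esub> u n a b else \<zero>\<^bsub>Uq n\<^esub>)"
    using I by (simp add: N2_def U.id2_def Nmat_def U.smult_smult ksgn_add h)
  also have "\<dots> = Hmat L12 x y"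
    using I by (simp add: xy Hmat_def L12_def u_def Uclass_smult FC_ugen gens_def Uq_simps)
  finally show "Hmat L12 x y = N1 x y" ..
qed

text \<open>At each position both sides of the defining relation acquire the same sign from
  \<open>Hmat\<close>, so all the relations together become one matrix identity.\<close>

lemma RLL: "N1 \<otimes>\<^bsub>M2\<^esub> (N2 \<otimes>\<^bsub>M2\<^esub> Rmat) = Rmat \<otimes>\<^bsub>M2\<^esub> (N2 \<otimes>\<^bsub>M2\<^esub> N1)"
proof -
  note h = tens_hom_L12 tens_hom_L13 tens_hom_Theta23 tens_hom_mult3
  let ?X = "mult3 n L12 (mult3 n L13 Theta23)" and ?Y = "mult3 n Theta23 (mult3 n L13 L12)"
  have X: "tens_hom n ?X" and Y: "tens_hom n ?Y" by (intro h)+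
  have "Hmat ?X = Hmat ?Y"
    unfolding Hmat_def
  proof (rule U.mat_cong)
    fix x y assume "x \<in> K" "y \<in> K"
    then obtain a b c d where xy: "x = (a, c)" "y = (b, d)" and I: "a \<in> I" "b \<in> I" "c \<in> I" "d \<in> I" by auto
    have XY: "?X a b c d \<in> FC n" "?Y a b c d \<in> FC n" using X Y I by (auto simp: tens_hom_def)
    have "?X a b c d - ?Y a b c d \<in> U_ideal n"
      using I by (intro subsetD[OF U_rels_sub]) (auto simp: U_rels_def)
    then have "const (ksgn (hsg a b c d)) * ?X a b c d - const (ksgn (hsg a b c d)) * ?Y a b c d \<in> U_ideal n"
      unfolding right_diff_distrib[symmetric] by (intro U_ideal_lmult) auto
    then show "Uclass n (const (ksgn (hsg (fst x) (fst y) (snd x) (snd y))) * ?X (fst x) (fst y) (snd x) (snd y))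
        = Uclass n (const (ksgn (hsg (fst x) (fst y) (snd x) (snd y))) * ?Y (fst x) (fst y) (snd x) (snd y))"
      using XY by (simp add: xy Uclass_eq_iff FC_mult)
  qed
  then show ?thesis
    by (simp add: Hmat_mult3 h Hmat_L12 Hmat_L13 Rmat_def)
qed

lemma Rmat_entry:
  assumes "a \<in> I" "b \<in> I" "c \<in> I" "d \<in> I"
  shows "Rmat (a, c) (b, d) = (ksgn (hsg a b c d) * Theta c d a b) \<odot>\<^bsub>Uq n\<^esub> \<one>\<^bsub>Uq n\<^esub>"
  using assms by (simp add: Rmat_def Hmat_def Theta23_def const_simps(5) Uq_simps Uclass_smult FC_mult)

lemma scalar_finsum:
  assumes "finite A"
  shows "(\<Oplus>\<^bsub>Uq n\<^esub>i\<in>A. f i \<odot>\<^bsub>Uq n\<^esub> \<one>\<^bsub>Uq n\<^esub>) = sum f A \<odot>\<^bsub>Uq n\<^esub> \<one>\<^bsub>Uq n\<^esub>"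
  using U.smult_sum[OF assms U.one_closed, of f] by simp

text \<open>All entries of \<open>Rmat\<close> are scalars, so this is \<open>Theta_sum_wt'\<close>
  over the ground field.\<close>

lemma ptr_RP: "U.ptr (wt' n) I (Rmat \<otimes>\<^bsub>M2\<^esub> Pmat) = \<one>\<^bsub>M1\<^esub>"
proof (rule U.Mat_eqI)
  fix c d assume cd: "c \<in> I" "d \<in> I"
  have "U.ptr (wt' n) I (Rmat \<otimes>\<^bsub>M2\<^esub> Pmat) c d = (\<Oplus>\<^bsub>Uq n\<^esub>a\<in>I.
      (wt' n a * (ksgn (p a * p d + (p a + p c) * (p c + p d) + (p c + p a) * p d) * Theta c a a d)) \<odot>\<^bsub>Uq n\<^esub> \<one>\<^bsub>Uq n\<^esub>)"
    unfolding U.ptr_def U.mat_apply[OF cd]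
  proof (rule U.finsum_cong')
    fix a assume a: "a \<in> I"
    show "wt' n a \<odot>\<^bsub>Uq n\<^esub> (Rmat \<otimes>\<^bsub>M2\<^esub> Pmat) (a, c) (a, d) = (wt' n a * (ksgn (p a * p d + (p a + p c) * (p c + p d) + (p c + p a) * p d) * Theta c a a d)) \<odot>\<^bsub>Uq n\<^esub> \<one>\<^bsub>Uq n\<^esub>"
      using a cd by (simp add: Pmat_def U.sflip_right Rmat_entry U.smult_smult hsg_def pp_def ksgn_add)
        (simp add: ac_simps ksgn_add)
  qed auto
  also have "\<dots> = (if c = d then \<one>\<^bsub>Uq n\<^esub> else \<zero>\<^bsub>Uq n\<^esub>)"
    using cd by (subst scalar_finsum) (auto simp: Theta_sum_wt')
  finally show "U.ptr (wt' n) I (Rmat \<otimes>\<^bsub>M2\<^esub> Pmat) c d = \<one>\<^bsub>M1\<^esub> c d" using cd by (simp add: U.Mat_one)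
qed auto

lemma ptr_PR: "U.ptr (wt n) I (Pmat \<otimes>\<^bsub>M2\<^esub> Rmat) = \<one>\<^bsub>M1\<^esub>"
proof (rule U.Mat_eqI)
  fix c d assume cd: "c \<in> I" "d \<in> I"
  have "U.ptr (wt n) I (Pmat \<otimes>\<^bsub>M2\<^esub> Rmat) c d = (\<Oplus>\<^bsub>Uq n\<^esub>a\<in>I.
      (wt n a * (ksgn (p a * p c + (p c + p a) * (p c + p d) + (p a + p d) * p a) * Theta a d c a)) \<odot>\<^bsub>Uq n\<^esub> \<one>\<^bsub>Uq n\<^esub>)"
    unfolding U.ptr_def U.mat_apply[OF cd]
  proof (rule U.finsum_cong')
    fix a assume a: "a \<in> I"
    show "wt n a \<odot>\<^bsub>Uq n\<^esub> (Pmat \<otimes>\<^bsub>M2\<^esub> Rmat) (a, c) (a, d) = (wt n a * (ksgn (p a * p c + (p c + p a) * (p c + p d) + (p a + p d) * p a) * Theta a d c a)) \<odot>\<^bsub>Uq n\<^esub> \<one>\<^bsub>Uq n\<^esub>"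
      using a cd by (simp add: Pmat_def U.sflip_left Rmat_entry U.smult_smult hsg_def pp_def ksgn_add)
        (simp add: ac_simps ksgn_add)
  qed auto
  also have "\<dots> = (if c = d then \<one>\<^bsub>Uq n\<^esub> else \<zero>\<^bsub>Uq n\<^esub>)"
    using cd by (subst scalar_finsum) (auto simp: Theta_sum_wt)
  finally show "U.ptr (wt n) I (Pmat \<otimes>\<^bsub>M2\<^esub> Rmat) c d = \<one>\<^bsub>M1\<^esub> c d" using cd by (simp add: U.Mat_one)
qed auto

text \<open>\<open>J1\<close> is \<open>J \<otimes> 1\<close> without sign, which commutes with \<open>N2\<close>; conjugating \<open>1 \<otimes> J\<close> by the super flip
  gives \<open>J1\<close> times the sign matrix \<open>D2\<close>, which drops out of \<open>W\<^sub>1\<close> because \<open>J\<close> occurs there twice.\<close>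

definition "Jm = U.monomial I uminus (\<lambda>i. ksgn (p (- i)))"
definition "J1 = U.monomial K (\<lambda>x. (- fst x, snd x)) (\<lambda>x. ksgn (p (- fst x)))"
definition "D2 = U.monomial K (\<lambda>x. x) (\<lambda>x. ksgn (p (snd x)))"
definition "Wmat = Nimat \<otimes>\<^bsub>M1\<^esub> Jm \<otimes>\<^bsub>M1\<^esub> Nmat \<otimes>\<^bsub>M1\<^esub> Jm"
definition "J2 = U.id2 I Jm"

lemma J_closed [simp]: "Jm \<in> carrier M1" "J1 \<in> carrier M2" "D2 \<in> carrier M2" "Wmat \<in> carrier M1" "J2 \<in> carrier M2"
  by (simp_all add: Jm_def J1_def D2_def Wmat_def J2_def)

lemma J2_eq: "J2 = U.monomial K (\<lambda>x. (fst x, - snd x)) (\<lambda>x. ksgn (p (- snd x)))"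
  unfolding J2_def Jm_def U.id2_def U.monomial_def by (rule U.mat_cong) (auto simp: U.mat_def split: prod.splits)

lemma PJ2P: "Pmat \<otimes>\<^bsub>M2\<^esub> J2 \<otimes>\<^bsub>M2\<^esub> Pmat = J1 \<otimes>\<^bsub>M2\<^esub> D2"
proof -
  have "ksgn (p a * p c) * ksgn (p (- a)) * ksgn (p c * p (- a)) = ksgn (p (- a)) * ksgn (p c)" if "a \<in> I" for a c
  proof -
    have "a \<noteq> 0" using that Idx_0 by auto
    then show ?thesis by (cases "p a"; cases "p c") (simp_all add: p_minus)
  qed
  then show ?thesis
    unfolding J2_eq Pmat_def U.sflip_def J1_def D2_def
    by (subst U.monomial_monomial, simp, force, subst U.monomial_monomial, simp, force dest: Idx_minus, subst U.monomial_monomial, simp, force dest: Idx_minus)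
      (auto intro!: U.monomial_cong)
qed

lemma D2_J1: "D2 \<otimes>\<^bsub>M2\<^esub> J1 = J1 \<otimes>\<^bsub>M2\<^esub> D2"
  unfolding J1_def D2_def
  by (subst U.monomial_monomial, simp, force, subst U.monomial_monomial, simp, force dest: Idx_minus) (auto intro!: U.monomial_cong)

lemma D2_D2: "D2 \<otimes>\<^bsub>M2\<^esub> D2 = \<one>\<^bsub>M2\<^esub>"
  unfolding D2_def U.monomial_one[symmetric]
  by (subst U.monomial_monomial, simp, force) (auto intro!: U.monomial_cong)

text \<open>\<open>N1\<close> acts on the first factor only, while \<open>D2\<close> is a sign
  depending on the second index.\<close>

lemma D2_N1: "D2 \<otimes>\<^bsub>M2\<^esub> N1 = N1 \<otimes>\<^bsub>M2\<^esub> D2"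
proof (rule U.Mat_eqI)
  fix x y assume xy': "x \<in> K" "y \<in> K"
  then obtain a b c d where xy: "x = (a, c)" "y = (b, d)" and I: "a \<in> I" "b \<in> I" "c \<in> I" "d \<in> I" by auto
  have "(D2 \<otimes>\<^bsub>M2\<^esub> N1) x y = ksgn (p c) \<odot>\<^bsub>Uq n\<^esub> N1 x y"
    unfolding D2_def using xy' xy by (subst U.monomial_mult) auto
  moreover have "(N1 \<otimes>\<^bsub>M2\<^esub> D2) x y = ksgn (p d) \<odot>\<^bsub>Uq n\<^esub> N1 x y"
    unfolding D2_def using xy' xy by (subst U.mult_monomial) auto
  moreover have "N1 x y = \<zero>\<^bsub>Uq n\<^esub>" if "c \<noteq> d"
    using that I by (simp add: N1_def xy P_conj) (simp add: N2_def U.id2_def)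
  ultimately show "(D2 \<otimes>\<^bsub>M2\<^esub> N1) x y = (N1 \<otimes>\<^bsub>M2\<^esub> D2) x y"
    by (cases "c = d") auto
qed auto

lemma J1_left:
  "X \<in> carrier M2 \<Longrightarrow> a \<in> I \<Longrightarrow> c \<in> I \<Longrightarrow> y \<in> K \<Longrightarrow>
    (J1 \<otimes>\<^bsub>M2\<^esub> X) (a, c) y = ksgn (p (- a)) \<odot>\<^bsub>Uq n\<^esub> X (- a, c) y"
  unfolding J1_def by (subst U.monomial_mult) (auto dest: Idx_minus)

lemma J1_right:
  "X \<in> carrier M2 \<Longrightarrow> b \<in> I \<Longrightarrow> d \<in> I \<Longrightarrow> x \<in> K \<Longrightarrow>
    (X \<otimes>\<^bsub>M2\<^esub> J1) x (b, d) = ksgn (p b) \<odot>\<^bsub>Uq n\<^esub> X x (- b, d)"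
  unfolding J1_def by (subst U.mult_monomial) (auto dest: Idx_minus)

lemma J1_N2: "J1 \<otimes>\<^bsub>M2\<^esub> N2 = N2 \<otimes>\<^bsub>M2\<^esub> J1"
proof (rule U.Mat_eqI)
  fix x y assume "x \<in> K" "y \<in> K"
  then obtain a b c d where xy: "x = (a, c)" "y = (b, d)" and I: "a \<in> I" "b \<in> I" "c \<in> I" "d \<in> I" by auto
  have m: "- a = b \<longleftrightarrow> a = - b" by auto
  show "(J1 \<otimes>\<^bsub>M2\<^esub> N2) x y = (N2 \<otimes>\<^bsub>M2\<^esub> J1) x y"
    using I by (simp add: xy J1_left J1_right) (auto simp: N2_def U.id2_def Idx_minus m)
qed auto

text \<open>Each \<open>\<Theta>_ij\<close> commutes with \<open>J\<close> up to sign: the diagonal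
  exponents see only \<open>|a|\<close>, and the other terms come in pairs
  \<open>E_ji + E_-j,-i\<close>.\<close>

lemma J1_R: "J1 \<otimes>\<^bsub>M2\<^esub> Rmat = Rmat \<otimes>\<^bsub>M2\<^esub> J1"
proof (rule U.Mat_eqI)
  fix x y assume "x \<in> K" "y \<in> K"
  then obtain a b c d where xy: "x = (a, c)" "y = (b, d)" and I: "a \<in> I" "b \<in> I" "c \<in> I" "d \<in> I" by auto
  have nz: "a \<noteq> 0" "b \<noteq> 0" "c \<noteq> 0" "d \<noteq> 0" using I Idx_0 by auto
  have "ksgn (p (- a)) * (ksgn (hsg (- a) b c d) * Theta c d (- a) b) = ksgn (p b) * (ksgn (hsg a (- b) c d) * Theta c d a (- b))"
  proof (cases "Theta c d (- a) b = 0 \<and> Theta c d a (- b) = 0")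
    case False
    then have par: "pp c d = p a + p b + 1"
      using Theta_parity[of c d "- a" b] Theta_parity[of c d a "- b"] nz
      by (auto simp: pp_def p_minus algebra_simps)
    have t: "Theta c d (- a) b = Theta c d a (- b)"
      using nz by (auto simp: Theta_def E_def phi_def)
    have "ksgn (p (- a) + hsg (- a) b c d) = ksgn (p b + hsg a (- b) c d)"
      using par nz by (cases "p a"; cases "p b"; cases "p c"; cases "p d") (simp_all add: hsg_def pp_def p_minus)
    then show ?thesis unfolding t by (simp only: ksgn_add mult.assoc[symmetric])
  qed simp
  then show "(J1 \<otimes>\<^bsub>M2\<^esub> Rmat) x y = (Rmat \<otimes>\<^bsub>M2\<^esub> J1) x y"
    using I by (simp add: xy J1_left J1_right Rmat_entry Idx_minus U.smult_smult)
qed auto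

lemma PWP: "Pmat \<otimes>\<^bsub>M2\<^esub> U.id2 I Wmat \<otimes>\<^bsub>M2\<^esub> Pmat = Ni1 \<otimes>\<^bsub>M2\<^esub> J1 \<otimes>\<^bsub>M2\<^esub> N1 \<otimes>\<^bsub>M2\<^esub> J1"
proof -
  have W: "U.id2 I Wmat = Ni2 \<otimes>\<^bsub>M2\<^esub> J2 \<otimes>\<^bsub>M2\<^esub> N2 \<otimes>\<^bsub>M2\<^esub> J2"
    by (simp add: Wmat_def Ni2_def J2_def N2_def U.id2_id2)
  have "Pmat \<otimes>\<^bsub>M2\<^esub> U.id2 I Wmat \<otimes>\<^bsub>M2\<^esub> Pmat =
      Ni1 \<otimes>\<^bsub>M2\<^esub> (Pmat \<otimes>\<^bsub>M2\<^esub> J2 \<otimes>\<^bsub>M2\<^esub> Pmat) \<otimes>\<^bsub>M2\<^esub> N1 \<otimes>\<^bsub>M2\<^esub> (Pmat \<otimes>\<^bsub>M2\<^esub> J2 \<otimes>\<^bsub>M2\<^esub> Pmat)"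
    by (simp add: W Ni1_def N1_def M2.m_assoc PP_cancel)
  also have "\<dots> = Ni1 \<otimes>\<^bsub>M2\<^esub> J1 \<otimes>\<^bsub>M2\<^esub> (D2 \<otimes>\<^bsub>M2\<^esub> N1) \<otimes>\<^bsub>M2\<^esub> (J1 \<otimes>\<^bsub>M2\<^esub> D2)"
    by (simp add: PJ2P M2.m_assoc)
  also have "\<dots> = Ni1 \<otimes>\<^bsub>M2\<^esub> J1 \<otimes>\<^bsub>M2\<^esub> N1 \<otimes>\<^bsub>M2\<^esub> ((D2 \<otimes>\<^bsub>M2\<^esub> J1) \<otimes>\<^bsub>M2\<^esub> D2)"
    by (simp add: D2_N1 M2.m_assoc)
  also have "\<dots> = Ni1 \<otimes>\<^bsub>M2\<^esub> J1 \<otimes>\<^bsub>M2\<^esub> N1 \<otimes>\<^bsub>M2\<^esub> (J1 \<otimes>\<^bsub>M2\<^esub> (D2 \<otimes>\<^bsub>M2\<^esub> D2))"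
    by (simp add: D2_J1 M2.m_assoc)
  finally show ?thesis by (simp add: D2_D2)
qed

lemma id2_pow: "A \<in> carrier M1 \<Longrightarrow> U.id2 I (A [^]\<^bsub>M1\<^esub> (m::nat)) = U.id2 I A [^]\<^bsub>M2\<^esub> m"
  by (induction m) (simp_all add: U.id2_one U.id2_id2[symmetric])

text \<open>Both sides are double traces over \<open>K\<close> of matrices that are flips of each
  other, by the identity \<open>e\<close>; the exchange of the two traces exchanges the two
  weights.\<close>

lemma tr_conj:
  "U.tr (wt n) I (Nmat \<otimes>\<^bsub>M1\<^esub> Wmat [^]\<^bsub>M1\<^esub> (m::nat) \<otimes>\<^bsub>M1\<^esub> Nimat) = U.tr (wt' n) I (Wmat [^]\<^bsub>M1\<^esub> m)"
proof -
  let ?V = "Wmat [^]\<^bsub>M1\<^esub> m" and ?W1 = "Ni1 \<otimes>\<^bsub>M2\<^esub> J1 \<otimes>\<^bsub>M2\<^esub> N1 \<otimes>\<^bsub>M2\<^esub> J1"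
  let ?V2 = "U.id2 I ?V"
  have V [simp]: "?V \<in> carrier M1" "?V2 \<in> carrier M2" by auto
  note tw = M2.intertwine[OF _ _ _ _ _ N1_inv RLL J1_R J1_N2, simplified]
  have V1: "?W1 [^]\<^bsub>M2\<^esub> m = Pmat \<otimes>\<^bsub>M2\<^esub> ?V2 \<otimes>\<^bsub>M2\<^esub> Pmat"
    by (simp add: PWP[symmetric] M2.conj_pow PP id2_pow)
  have V1': "?W1 [^]\<^bsub>M2\<^esub> m \<otimes>\<^bsub>M2\<^esub> (N2 \<otimes>\<^bsub>M2\<^esub> Rmat) = (N2 \<otimes>\<^bsub>M2\<^esub> Rmat) \<otimes>\<^bsub>M2\<^esub> ?W1 [^]\<^bsub>M2\<^esub> m"
    by (rule M2.commute_pow) (auto simp: tw(2))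
  have PNi: "Pmat \<otimes>\<^bsub>M2\<^esub> Ni2 = Ni1 \<otimes>\<^bsub>M2\<^esub> Pmat" and NP: "N2 \<otimes>\<^bsub>M2\<^esub> Pmat = Pmat \<otimes>\<^bsub>M2\<^esub> N1"
    by (simp_all add: Ni1_def N1_def M2.m_assoc PP PP_cancel)
  have "N2 \<otimes>\<^bsub>M2\<^esub> (Rmat \<otimes>\<^bsub>M2\<^esub> Pmat) \<otimes>\<^bsub>M2\<^esub> ?V2 \<otimes>\<^bsub>M2\<^esub> Ni2
      = ((N2 \<otimes>\<^bsub>M2\<^esub> Rmat) \<otimes>\<^bsub>M2\<^esub> (Pmat \<otimes>\<^bsub>M2\<^esub> ?V2 \<otimes>\<^bsub>M2\<^esub> Pmat)) \<otimes>\<^bsub>M2\<^esub> (Pmat \<otimes>\<^bsub>M2\<^esub> Ni2)"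
    by (simp add: M2.m_assoc PP_cancel)
  \<comment> \<open>Here \<open>W_1^m\<close>, in the guise of the flipped \<open>?V2\<close>,
    crosses \<open>N2 R\<close>.\<close>
  also have "\<dots> = (Pmat \<otimes>\<^bsub>M2\<^esub> ?V2 \<otimes>\<^bsub>M2\<^esub> Pmat) \<otimes>\<^bsub>M2\<^esub> (N2 \<otimes>\<^bsub>M2\<^esub> (Rmat \<otimes>\<^bsub>M2\<^esub> Ni1)) \<otimes>\<^bsub>M2\<^esub> Pmat"
    unfolding V1[symmetric] V1'[symmetric] PNi by (simp add: M2.m_assoc)
  \<comment> \<open>The first conclusion of \<open>intertwine\<close> takes \<open>Ni1\<close> from
    the right of \<open>N2 R\<close> to the left of \<open>R N2\<close>.\<close>
  also have "\<dots> = (Pmat \<otimes>\<^bsub>M2\<^esub> ?V2 \<otimes>\<^bsub>M2\<^esub> Pmat) \<otimes>\<^bsub>M2\<^esub> Ni1 \<otimes>\<^bsub>M2\<^esub> Rmat \<otimes>\<^bsub>M2\<^esub> (N2 \<otimes>\<^bsub>M2\<^esub> Pmat)"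
    by (simp add: tw(1) M2.m_assoc)
  also have "\<dots> = Pmat \<otimes>\<^bsub>M2\<^esub> (?V2 \<otimes>\<^bsub>M2\<^esub> Ni2 \<otimes>\<^bsub>M2\<^esub> (Pmat \<otimes>\<^bsub>M2\<^esub> Rmat) \<otimes>\<^bsub>M2\<^esub> N2) \<otimes>\<^bsub>M2\<^esub> Pmat"
    by (simp add: Ni1_def M2.m_assoc PP_cancel)
  finally have e: "N2 \<otimes>\<^bsub>M2\<^esub> (Rmat \<otimes>\<^bsub>M2\<^esub> Pmat) \<otimes>\<^bsub>M2\<^esub> ?V2 \<otimes>\<^bsub>M2\<^esub> Ni2
      = Pmat \<otimes>\<^bsub>M2\<^esub> (?V2 \<otimes>\<^bsub>M2\<^esub> Ni2 \<otimes>\<^bsub>M2\<^esub> (Pmat \<otimes>\<^bsub>M2\<^esub> Rmat) \<otimes>\<^bsub>M2\<^esub> N2) \<otimes>\<^bsub>M2\<^esub> Pmat" .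
  \<comment> \<open>\<open>N2\<close>, \<open>?V2\<close> and \<open>Ni2\<close> act on the second
    factor and come out of the partial trace, which leaves the trace of \<open>R P\<close>, an
    identity matrix, between them.\<close>
  have 1: "Nmat \<otimes>\<^bsub>M1\<^esub> ?V \<otimes>\<^bsub>M1\<^esub> Nimat
      = U.ptr (wt' n) I (N2 \<otimes>\<^bsub>M2\<^esub> (Rmat \<otimes>\<^bsub>M2\<^esub> Pmat) \<otimes>\<^bsub>M2\<^esub> ?V2 \<otimes>\<^bsub>M2\<^esub> Ni2)"
    by (simp add: N2_def Ni2_def U.ptr_id2_right U.ptr_id2_left ptr_RP)
  have 2: "U.tr (wt n) I (U.ptr (wt' n) I (N2 \<otimes>\<^bsub>M2\<^esub> (Rmat \<otimes>\<^bsub>M2\<^esub> Pmat) \<otimes>\<^bsub>M2\<^esub> ?V2 \<otimes>\<^bsub>M2\<^esub> Ni2))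
     = U.tr (wt' n) I (U.ptr (wt n) I (?V2 \<otimes>\<^bsub>M2\<^esub> Ni2 \<otimes>\<^bsub>M2\<^esub> (Pmat \<otimes>\<^bsub>M2\<^esub> Rmat) \<otimes>\<^bsub>M2\<^esub> N2))"
    unfolding e unfolding Pmat_def by (rule U.tr_ptr_sflip) (auto simp: Pmat_def[symmetric])
  have "U.ptr (wt n) I (?V2 \<otimes>\<^bsub>M2\<^esub> Ni2 \<otimes>\<^bsub>M2\<^esub> (Pmat \<otimes>\<^bsub>M2\<^esub> Rmat) \<otimes>\<^bsub>M2\<^esub> N2)
      = ?V \<otimes>\<^bsub>M1\<^esub> Nimat \<otimes>\<^bsub>M1\<^esub> \<one>\<^bsub>M1\<^esub> \<otimes>\<^bsub>M1\<^esub> Nmat"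
    by (simp add: N2_def Ni2_def U.id2_id2 U.ptr_id2_right U.ptr_id2_left ptr_PR)
  also have "\<dots> = ?V" by (simp add: M1.m_assoc Nmat_inv)
  finally show ?thesis unfolding 1 2 by simp
qed

lemma yel_closed [simp]:
  assumes "i \<in> I" "j \<in> I" shows "yel n S i j \<in> carrier (Uq n)"
  unfolding yel_def using assms Idx_minus
  by (intro U.a_inv_closed U.finsum_closed) auto

lemma U_minus: "x \<in> carrier (Uq n) \<Longrightarrow> \<ominus>\<^bsub>Uq n\<^esub> x = (- 1) \<odot>\<^bsub>Uq n\<^esub> x"
proof (rule U.minus_equality)
  assume x: "x \<in> carrier (Uq n)"
  have "((- 1) + 1) \<odot>\<^bsub>Uq n\<^esub> x = (- 1) \<odot>\<^bsub>Uq n\<^esub> x \<oplus>\<^bsub>Uq n\<^esub> 1 \<odot>\<^bsub>Uq n\<^esub> x"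
    using module.smult_l_distr[OF U.mod, of "- 1" 1 x] x by simp
  then show "(- 1) \<odot>\<^bsub>Uq n\<^esub> x \<oplus>\<^bsub>Uq n\<^esub> x = \<zero>\<^bsub>Uq n\<^esub>" using x by simp
qed auto

text \<open>Triangularity of \<open>Nimat\<close> demands \<open>i \<le> k\<close>, that of
  \<open>Nmat\<close> at \<open>(- k, - j)\<close> demands \<open>j \<le> k\<close>: together this
  is the range \<open>max i j \<le> k\<close> in \<open>yel\<close>. The minus sign of
  \<open>yel\<close> comes from the negated indices that \<open>J\<close> introduces.\<close>

lemma Wmat_entry:
  assumes ij: "i \<in> I" "j \<in> I"
  shows "Wmat i j = ksgn (p i * p j + p i) \<odot>\<^bsub>Uq n\<^esub> yel n S i j"
proof -
  have mj: "- j \<in> I" using ij by (rule_tac Idx_minus)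
  have nz: "k \<noteq> 0" if "k \<in> I" for k using that Idx_0 by auto
  let ?f = "\<lambda>k. ksgn (pp i k * pp j k) \<odot>\<^bsub>Uq n\<^esub> (S (u n i k) \<otimes>\<^bsub>Uq n\<^esub> u n (- k) (- j))"
  have cl: "S (u n i k) \<otimes>\<^bsub>Uq n\<^esub> u n (- k) (- j) \<in> carrier (Uq n)" if "k \<in> I" "max i j \<le> k" for k
    using that ij mj Idx_minus[of k n] by auto
  have "Wmat i j = ksgn (p j) \<odot>\<^bsub>Uq n\<^esub> (Nimat \<otimes>\<^bsub>M1\<^esub> Jm \<otimes>\<^bsub>M1\<^esub> Nmat) i (- j)"
    unfolding Wmat_def Jm_def[of] using ij Idx_minus
    by (subst U.mult_monomial) (auto simp flip: Jm_def)
  also have "(Nimat \<otimes>\<^bsub>M1\<^esub> Jm \<otimes>\<^bsub>M1\<^esub> Nmat) i (- j) = (\<Oplus>\<^bsub>Uq n\<^esub>k\<in>I. Nimat i k \<otimes>\<^bsub>Uq n\<^esub> (Jm \<otimes>\<^bsub>M1\<^esub> Nmat) k (- j))"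
    using ij mj by (simp add: M1.m_assoc U.Mat_mult)
  also have "\<dots> = (\<Oplus>\<^bsub>Uq n\<^esub>k\<in>{k \<in> I. max i j \<le> k}. (- ksgn (p i * p j + p i + p j)) \<odot>\<^bsub>Uq n\<^esub> ?f k)"
  proof (rule U.add.finprod_mono_neutral_cong_right)
    have e: "(Jm \<otimes>\<^bsub>M1\<^esub> Nmat) k (- j) = ksgn (p (- k)) \<odot>\<^bsub>Uq n\<^esub> Nmat (- k) (- j)" if "k \<in> I" for k
      unfolding Jm_def using that mj Idx_minus by (subst U.monomial_mult) auto
    fix k
    { assume k: "k \<in> I - {k \<in> I. max i j \<le> k}"
      then have kI: "k \<in> I" "- k \<in> I" using Idx_minus by auto
      have cN: "Nimat i k \<in> carrier (Uq n)" "Nmat (- k) (- j) \<in> carrier (Uq n)"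
        using kI ij mj by (auto intro: U.Mat_entry[OF Nimat_Mat] U.Mat_entry[OF Nmat_Mat])
      consider "\<not> i \<le> k" | "\<not> j \<le> k" using k by fastforce
      then show "Nimat i k \<otimes>\<^bsub>Uq n\<^esub> (Jm \<otimes>\<^bsub>M1\<^esub> Nmat) k (- j) = \<zero>\<^bsub>Uq n\<^esub>"
      proof cases
        case 1
        then have "Nimat i k = \<zero>\<^bsub>Uq n\<^esub>" using kI ij by (simp add: Nimat_def)
        then show ?thesis using e[OF kI(1)] cN by simp
      next
        case 2
        then have "Nmat (- k) (- j) = \<zero>\<^bsub>Uq n\<^esub>" using kI mj by (simp add: Nmat_def)
        then show ?thesis using e[OF kI(1)] cN by simp
      qed }
    assume "k \<in> {k \<in> I. max i j \<le> k}"
    then have k: "k \<in> I" "- k \<in> I" "i \<le> k" "- k \<le> - j" using Idx_minus by auto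
    have "ksgn (p (- k)) * (ksgn (p (- k) + p (- k) * p (- j)) * ksgn (p i + p i * p k)) = - (ksgn (p i * p j + p i + p j) * ksgn (pp i k * pp j k))"
      using nz[OF k(1)] nz[OF ij(2)]
      by (cases "p i"; cases "p j"; cases "p k") (simp_all add: p_minus pp_def)
    then show "Nimat i k \<otimes>\<^bsub>Uq n\<^esub> (Jm \<otimes>\<^bsub>M1\<^esub> Nmat) k (- j) = (- ksgn (p i * p j + p i + p j)) \<odot>\<^bsub>Uq n\<^esub> ?f k"
      unfolding e[OF k(1)] using k ij mj
      by (simp add: Nimat_def Nmat_def U.smult_left U.smult_right U.smult_smult mult.assoc)
  qed (use ij mj Idx_minus in \<open>auto intro!: U.m_closed U.Mat_entry[OF Nimat_Mat] U.Mat_entry[of _ I]\<close>)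
  also have "\<dots> = (- ksgn (p i * p j + p i + p j)) \<odot>\<^bsub>Uq n\<^esub> (\<Oplus>\<^bsub>Uq n\<^esub>k\<in>{k \<in> I. max i j \<le> k}. ?f k)"
    using cl by (subst U.smult_finsum) auto
  finally have "Wmat i j = (ksgn (p j) * (- ksgn (p i * p j + p i + p j))) \<odot>\<^bsub>Uq n\<^esub> (\<Oplus>\<^bsub>Uq n\<^esub>k\<in>{k \<in> I. max i j \<le> k}. ?f k)"
    using cl by (simp add: U.smult_smult U.finsum_closed Pi_def)
  moreover have "ksgn (p j) * (- ksgn (p i * p j + p i + p j)) = ksgn (p i * p j + p i) * (- 1)"
    by (cases "p i"; cases "p j") simp_all
  ultimately show ?thesis
    unfolding yel_def using cl by (subst U_minus) (simp_all add: U.smult_smult U.finsum_closed Pi_def)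
qed

section \<open>Powers of a matrix as sums over paths\<close>

definition pathprod :: "(int \<Rightarrow> int \<Rightarrow> free set) \<Rightarrow> (nat \<Rightarrow> int) \<Rightarrow> nat \<Rightarrow> free set" where
  "pathprod A c m = foldr (\<otimes>\<^bsub>Uq n\<^esub>) (map (\<lambda>k. A (c k) (c (Suc k))) [0..<m]) \<one>\<^bsub>Uq n\<^esub>"

lemma foldr_closed: "set xs \<subseteq> carrier (Uq n) \<Longrightarrow> foldr (\<otimes>\<^bsub>Uq n\<^esub>) xs \<one>\<^bsub>Uq n\<^esub> \<in> carrier (Uq n)"
  by (induction xs) auto

lemma foldr_snoc:
  assumes "x \<in> carrier (Uq n)"
  shows "set xs \<subseteq> carrier (Uq n) \<Longrightarrow>
    foldr (\<otimes>\<^bsub>Uq n\<^esub>) (xs @ [x]) \<one>\<^bsub>Uq n\<^esub> = foldr (\<otimes>\<^bsub>Uq n\<^esub>) xs \<one>\<^bsub>Uq n\<^esub> \<otimes>\<^bsub>Uq n\<^esub> x"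
  using assms by (induction xs) (simp_all add: U.m_assoc foldr_closed)

lemma pathprod_0: "pathprod A c 0 = \<one>\<^bsub>Uq n\<^esub>"
  by (simp add: pathprod_def)

lemma
  assumes A: "\<And>i j. i \<in> I \<Longrightarrow> j \<in> I \<Longrightarrow> A i j \<in> carrier (Uq n)"
  shows pathprod_closed: "(\<And>k. k \<le> m \<Longrightarrow> c k \<in> I) \<Longrightarrow> pathprod A c m \<in> carrier (Uq n)"
    and pathprod_Suc: "(\<And>k. k \<le> Suc m \<Longrightarrow> c k \<in> I) \<Longrightarrow>
       pathprod A c (Suc m) = pathprod A c m \<otimes>\<^bsub>Uq n\<^esub> A (c m) (c (Suc m))"
proof -
  show "(\<And>k. k \<le> m \<Longrightarrow> c k \<in> I) \<Longrightarrow> pathprod A c m \<in> carrier (Uq n)"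
    unfolding pathprod_def by (rule foldr_closed) (auto intro!: A)
  assume c: "\<And>k. k \<le> Suc m \<Longrightarrow> c k \<in> I"
  have l: "map (\<lambda>k. A (c k) (c (Suc k))) [0..<Suc m] = map (\<lambda>k. A (c k) (c (Suc k))) [0..<m] @ [A (c m) (c (Suc m))]"
    by simp
  show "pathprod A c (Suc m) = pathprod A c m \<otimes>\<^bsub>Uq n\<^esub> A (c m) (c (Suc m))"
    unfolding pathprod_def l by (rule foldr_snoc) (auto intro!: A c)
qed

lemma pathprod_upd: "pathprod A (c(Suc m := j)) m = pathprod A c m"
  unfolding pathprod_def by (intro arg_cong2[where f = "foldr _"] map_cong) auto

lemma paths_I: "c \<in> paths n m i j \<Longrightarrow> k \<le> m \<Longrightarrow> c k \<in> I"
  by (auto simp: paths_def)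

text \<open>The induction splits off the last step of a path, so the endpoint \<open>j\<close> must
  stay general.\<close>

lemma Mat_pow:
  assumes A: "A \<in> carrier M1" and i: "i \<in> I"
  shows "j \<in> I \<Longrightarrow> (A [^]\<^bsub>M1\<^esub> (m::nat)) i j = (\<Oplus>\<^bsub>Uq n\<^esub>c\<in>paths n m i j. pathprod A c m)"
proof (induction m arbitrary: j)
  case 0
  show ?case
  proof (cases "i = j")
    case True
    have "paths n 0 i j = {\<lambda>x\<in>{0}. i}"
      using i True by (auto simp: paths_def PiE_def extensional_def fun_eq_iff)
    then show ?thesis using True i by (simp add: U.Mat_one pathprod_0)
  next
    case False
    then have "paths n 0 i j = {}" by (auto simp: paths_def)
    then show ?thesis using False 0 i by (simp add: U.Mat_one)
  qed
next
  case (Suc m)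
  note eA = U.Mat_entry[OF A]
  have cl: "pathprod A c m \<in> carrier (Uq n)" if "c \<in> paths n m i k" for c k
    using that by (intro pathprod_closed eA) (auto dest: paths_I)
  have "(A [^]\<^bsub>M1\<^esub> Suc m) i j = (\<Oplus>\<^bsub>Uq n\<^esub>k\<in>I. (A [^]\<^bsub>M1\<^esub> m) i k \<otimes>\<^bsub>Uq n\<^esub> A k j)"
    using i Suc.prems by (simp add: U.Mat_mult)
  also have "\<dots> = (\<Oplus>\<^bsub>Uq n\<^esub>k\<in>I. \<Oplus>\<^bsub>Uq n\<^esub>c\<in>(\<lambda>c. c(Suc m := j)) ` paths n m i k. pathprod A c (Suc m))"
  proof (rule U.finsum_cong')
    fix k assume k: "k \<in> I"
    have s: "pathprod A (c(Suc m := j)) (Suc m) = pathprod A c m \<otimes>\<^bsub>Uq n\<^esub> A k j" if c: "c \<in> paths n m i k" for c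
    proof -
      have "pathprod A (c(Suc m := j)) (Suc m) = pathprod A (c(Suc m := j)) m \<otimes>\<^bsub>Uq n\<^esub> A ((c(Suc m := j)) m) ((c(Suc m := j)) (Suc m))"
        using c Suc.prems by (intro pathprod_Suc eA) (auto simp: le_Suc_eq dest: paths_I)
      also have "\<dots> = pathprod A c m \<otimes>\<^bsub>Uq n\<^esub> A k j"
        using c by (simp add: pathprod_upd paths_def)
      finally show ?thesis .
    qed
    have "(\<Oplus>\<^bsub>Uq n\<^esub>c\<in>(\<lambda>c. c(Suc m := j)) ` paths n m i k. pathprod A c (Suc m))
        = (\<Oplus>\<^bsub>Uq n\<^esub>c\<in>paths n m i k. pathprod A (c(Suc m := j)) (Suc m))"
      using paths_upd_inj cl eA k Suc.prems by (intro U.finsum_reindex) (auto simp: s)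
    also have "\<dots> = (\<Oplus>\<^bsub>Uq n\<^esub>c\<in>paths n m i k. pathprod A c m \<otimes>\<^bsub>Uq n\<^esub> A k j)"
      using cl eA k Suc.prems by (intro U.finsum_cong') (simp_all add: s)
    also have "\<dots> = (A [^]\<^bsub>M1\<^esub> m) i k \<otimes>\<^bsub>Uq n\<^esub> A k j"
      unfolding Suc.IH[OF k] using cl eA k Suc.prems by (intro U.finsum_ldistr[symmetric]) (auto simp: finite_paths)
    finally show "(A [^]\<^bsub>M1\<^esub> m) i k \<otimes>\<^bsub>Uq n\<^esub> A k j
       = (\<Oplus>\<^bsub>Uq n\<^esub>c\<in>(\<lambda>c. c(Suc m := j)) ` paths n m i k. pathprod A c (Suc m))" ..
  next
    show "(\<lambda>k. \<Oplus>\<^bsub>Uq n\<^esub>c\<in>(\<lambda>c. c(Suc m := j)) ` paths n m i k. pathprod A c (Suc m)) \<in> I \<rightarrow> carrier (Uq n)"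
      using Suc.prems by (intro Pi_I U.finsum_closed) (auto intro!: pathprod_closed eA simp: le_Suc_eq dest: paths_I)
  qed simp
  also have "\<dots> = (\<Oplus>\<^bsub>Uq n\<^esub>c\<in>paths n (Suc m) i j. pathprod A c (Suc m))"
    unfolding paths_Suc[OF Suc.prems]
  proof (rule U.add.finprod_UN_disjoint[symmetric])
    show "pairwise (\<lambda>k l. disjnt ((\<lambda>c. c(Suc m := j)) ` paths n m i k) ((\<lambda>c. c(Suc m := j)) ` paths n m i l)) I"
    proof (rule pairwiseI)
      fix k l :: int assume "k \<noteq> l"
      then show "disjnt ((\<lambda>c. c(Suc m := j)) ` paths n m i k) ((\<lambda>c. c(Suc m := j)) ` paths n m i l)"
        by (auto simp: disjnt_def paths_def dest!: fun_cong[of _ _ m])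
    qed
    fix k :: int and c assume "k \<in> I" "c \<in> (\<lambda>c. c(Suc m := j)) ` paths n m i k"
    then show "pathprod A c (Suc m) \<in> carrier (Uq n)"
      using Suc.prems by (auto intro!: pathprod_closed eA simp: le_Suc_eq dest: paths_I)
  qed (auto simp: finite_paths)
  finally show ?case .
qed

lemma pathprod_Wmat:
  "(\<And>k. k \<le> m \<Longrightarrow> c k \<in> I) \<Longrightarrow>
    pathprod Wmat c m = ksgn (\<Sum>k\<in>{0..<m}. p (c k) * p (c (Suc k)) + p (c k)) \<odot>\<^bsub>Uq n\<^esub> pathprod (yel n S) c m"
proof (induction m)
  case 0 then show ?case by (simp add: pathprod_0)
next
  case (Suc m)
  have c: "c m \<in> I" "c (Suc m) \<in> I" using Suc.prems by auto
  have y: "pathprod (yel n S) c m \<in> carrier (Uq n)" using Suc.prems by (intro pathprod_closed) auto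
  have "pathprod Wmat c (Suc m) = pathprod Wmat c m \<otimes>\<^bsub>Uq n\<^esub> Wmat (c m) (c (Suc m))"
    using Suc.prems by (intro pathprod_Suc U.Mat_entry[of _ I]) auto
  moreover have "pathprod (yel n S) c (Suc m) = pathprod (yel n S) c m \<otimes>\<^bsub>Uq n\<^esub> yel n S (c m) (c (Suc m))"
    using Suc.prems by (intro pathprod_Suc) auto
  ultimately show ?case
    using Suc c y by (simp add: Wmat_entry U.smult_left U.smult_right U.smult_smult ksgn_add ac_simps)
qed

lemma Wmat_pow:
  assumes m: "m > 0" and i: "i \<in> I"
  shows "(Wmat [^]\<^bsub>M1\<^esub> m) i i = ypow n S m i i"
proof -
  have y: "pathprod (yel n S) c m \<in> carrier (Uq n)" if "c \<in> paths n m i i" for c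
    using that by (intro pathprod_closed) (auto dest: paths_I)
  have "(Wmat [^]\<^bsub>M1\<^esub> m) i i = (\<Oplus>\<^bsub>Uq n\<^esub>c\<in>paths n m i i. pathprod Wmat c m)"
    using i by (intro Mat_pow) auto
  also have "\<dots> = (\<Oplus>\<^bsub>Uq n\<^esub>c\<in>paths n m i i. ksgn (p i * p i) \<odot>\<^bsub>Uq n\<^esub>
      (ksgn ((\<Sum>k\<in>{1..<m}. p (c k)) + (\<Sum>k\<in>{0..<m}. p (c k) * p (c (Suc k)))) \<odot>\<^bsub>Uq n\<^esub> pathprod (yel n S) c m))"
  proof (rule U.finsum_cong')
    fix c assume c: "c \<in> paths n m i i"
    \<comment> \<open>The starting vertex is split off, which is possible for \<open>m > 0\<close>.
      As \<open>p i = p i * p i\<close>, its sign is the prefactor of \<open>ypow\<close> on the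
      diagonal.\<close>
    have "(\<Sum>k\<in>{0..<m}. p (c k)) = p i + (\<Sum>k\<in>{1..<m}. p (c k))"
      using m c by (simp add: sum.atLeast_Suc_lessThan paths_def)
    then have "ksgn (\<Sum>k\<in>{0..<m}. p (c k) * p (c (Suc k)) + p (c k))
      = ksgn (p i * p i) * ksgn ((\<Sum>k\<in>{1..<m}. p (c k)) + (\<Sum>k\<in>{0..<m}. p (c k) * p (c (Suc k))))"
      by (simp add: sum.distrib ksgn_add bit_mult_self ac_simps)
    then show "pathprod Wmat c m = ksgn (p i * p i) \<odot>\<^bsub>Uq n\<^esub>
      (ksgn ((\<Sum>k\<in>{1..<m}. p (c k)) + (\<Sum>k\<in>{0..<m}. p (c k) * p (c (Suc k)))) \<odot>\<^bsub>Uq n\<^esub> pathprod (yel n S) c m)"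
      using y[OF c] pathprod_Wmat[of m c] paths_I[OF c] by (simp add: U.smult_smult)
  qed (use y in auto)
  also have "\<dots> = ypow n S m i i"
    unfolding ypow_def pathprod_def[symmetric] using y by (subst U.smult_finsum) (auto simp: finite_paths)
  finally show ?thesis .
qed

lemma tr_Wmat_pow:
  assumes "m > 0"
  shows "U.tr (wt' n) I (Wmat [^]\<^bsub>M1\<^esub> m) =
    (\<Oplus>\<^bsub>Uq n\<^esub>i\<in>I. (ksgn (p i) * qq powi (2 * \<bar>i\<bar> - 2 * int n - 1)) \<odot>\<^bsub>Uq n\<^esub> ypow n S m i i)"
  unfolding U.tr_def
proof (rule U.finsum_cong')
  have W: "(Wmat [^]\<^bsub>M1\<^esub> m) i i \<in> carrier (Uq n)" if "i \<in> I" for i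
    using that by (intro U.Mat_entry[of _ I]) auto
  show "(\<lambda>i. (ksgn (p i) * qq powi (2 * \<bar>i\<bar> - 2 * int n - 1)) \<odot>\<^bsub>Uq n\<^esub> ypow n S m i i) \<in> I \<rightarrow> carrier (Uq n)"
    using W assms by (auto simp: Wmat_pow[symmetric])
  fix i assume i: "i \<in> I"
  show "wt' n i \<odot>\<^bsub>Uq n\<^esub> (Wmat [^]\<^bsub>M1\<^esub> m) i i = (ksgn (p i) * qq powi (2 * \<bar>i\<bar> - 2 * int n - 1)) \<odot>\<^bsub>Uq n\<^esub> ypow n S m i i"
    using i assms by (simp add: Wmat_pow wt'_def)
qed simp

end

section \<open>The regular representation\<close>

lemma parity_inv_eq:
  assumes W: "is_superspace W" and x: "x0 \<in> hpart W 0" "x1 \<in> hpart W 1"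
  shows "parity_inv W (x0 \<oplus>\<^bsub>W\<^esub> x1) = x0 \<ominus>\<^bsub>W\<^esub> x1"
proof -
  have sub: "hpart W r \<subseteq> carrier W" for r
    using W by (simp add: is_superspace_def submodule_def subgroup_def)
  have "module kring W" using W by (simp add: is_superspace_def)
  then interpret module kring W .
  have c: "x0 \<oplus>\<^bsub>W\<^esub> x1 \<in> carrier W" using x sub by blast
  have "\<exists>!w. fst w \<in> hpart W 0 \<and> snd w \<in> hpart W 1 \<and> x0 \<oplus>\<^bsub>W\<^esub> x1 = fst w \<oplus>\<^bsub>W\<^esub> snd w"
    using W c unfolding is_superspace_def by blast
  then have u: "y0 = x0 \<and> y1 = x1" if "y0 \<in> hpart W 0" "y1 \<in> hpart W 1" "x0 \<oplus>\<^bsub>W\<^esub> x1 = y0 \<oplus>\<^bsub>W\<^esub> y1" for y0 y1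
    using that x by (metis fst_conv snd_conv)
  show ?thesis
    unfolding parity_inv_def
  proof (rule the_equality)
    show "\<exists>y0\<in>hpart W 0. \<exists>y1\<in>hpart W 1. x0 \<oplus>\<^bsub>W\<^esub> x1 = y0 \<oplus>\<^bsub>W\<^esub> y1 \<and> x0 \<ominus>\<^bsub>W\<^esub> x1 = y0 \<ominus>\<^bsub>W\<^esub> y1"
      using x by blast
  qed (use u in blast)
qed

definition tw :: "nat \<Rightarrow> bit \<Rightarrow> free set \<Rightarrow> free set" where
  "tw n r x = twist (Uq n) r x"

text \<open>The parity involution of the quotient is induced by \<open>sig\<close>, from which it
  inherits additivity and multiplicativity.\<close>

lemma tw_Uclass: "f \<in> FC n \<Longrightarrow> tw n r (Uclass n f) = Uclass n (if r = 0 then f else sig f)"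
proof -
  assume f: "f \<in> FC n"
  interpret R: ring "Uq n" by (rule ring_Uq)
  have "parity_inv (Uq n) (Uclass n (fpart 0 f) \<oplus>\<^bsub>Uq n\<^esub> Uclass n (fpart 1 f))
      = Uclass n (fpart 0 f) \<ominus>\<^bsub>Uq n\<^esub> Uclass n (fpart 1 f)"
    using f by (intro parity_inv_eq superspace_Uq) (auto simp: Uq_simps intro: FC_fpart fhom_fpart)
  moreover have "\<ominus>\<^bsub>Uq n\<^esub> Uclass n (fpart 1 f) = Uclass n (- fpart 1 f)"
    using f by (intro R.minus_equality) (auto simp: Uclass_add FC_uminus FC_fpart Uq_simps)
  ultimately have "parity_inv (Uq n) (Uclass n f) = Uclass n (sig f)"
    using f by (simp add: Uclass_add FC_fpart FC_uminus fpart_sum sig_def a_minus_def)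
  then show ?thesis by (simp add: tw_def twist_def)
qed

lemma sig_sig: "sig (sig f) = f"
proof -
  have h: "fhom 0 (fpart 0 f)" "fhom 1 (- fpart 1 f)"
    by (simp_all add: fhom_fpart fhom_uminus)
  have "sig (sig f) = sig (fpart 0 f + - fpart 1 f)" by (simp add: sig_def)
  also have "\<dots> = sig (fpart 0 f) + sig (- fpart 1 f)" by (rule sig_add)
  also have "\<dots> = fpart 0 f + fpart 1 f"
    using h by (simp add: sig_fhom const_simps)
  finally show ?thesis by (simp add: fpart_sum)
qed

lemma tw_closed [simp]: "x \<in> carrier (Uq n) \<Longrightarrow> tw n r x \<in> carrier (Uq n)"
  by (auto elim!: Uq_cases simp: tw_Uclass FC_sig)

lemma tw_add: "x \<in> carrier (Uq n) \<Longrightarrow> y \<in> carrier (Uq n) \<Longrightarrow> tw n r (x \<oplus>\<^bsub>Uq n\<^esub> y) = tw n r x \<oplus>\<^bsub>Uq n\<^esub> tw n r y"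
  by (elim Uq_cases) (simp add: tw_Uclass Uclass_add FC_sig FC_add sig_add)

lemma tw_mult: "x \<in> carrier (Uq n) \<Longrightarrow> y \<in> carrier (Uq n) \<Longrightarrow> tw n r (x \<otimes>\<^bsub>Uq n\<^esub> y) = tw n r x \<otimes>\<^bsub>Uq n\<^esub> tw n r y"
  by (elim Uq_cases) (simp add: tw_Uclass Uclass_mult FC_sig FC_mult sig_mult)

lemma tw_smult: "x \<in> carrier (Uq n) \<Longrightarrow> tw n r (a \<odot>\<^bsub>Uq n\<^esub> x) = a \<odot>\<^bsub>Uq n\<^esub> tw n r x"
  by (elim Uq_cases) (simp add: tw_Uclass Uclass_smult FC_sig FC_mult sig_mult sig_fhom[OF fhom_const] const_simps)

lemma tw_tw: "x \<in> carrier (Uq n) \<Longrightarrow> tw n r (tw n s x) = tw n (r + s) x"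
  using bit_cases[of r] bit_cases[of s]
  by (elim Uq_cases) (auto simp: tw_Uclass FC_sig sig_sig)

lemma tw_0 [simp]: "tw n 0 x = x"
  by (simp add: tw_def twist_def)

lemma tw_hpart: "x \<in> hpart (Uq n) s \<Longrightarrow> tw n r x = ksgn (r * s) \<odot>\<^bsub>Uq n\<^esub> x"
  using bit_cases[of r] unfolding Uq_simps
  by (auto simp: tw_Uclass sig_fhom Uclass_smult const_simps)

lemma tw_one [simp]: "tw n r \<one>\<^bsub>Uq n\<^esub> = \<one>\<^bsub>Uq n\<^esub>"
proof -
  interpret U: kalgebra "Uq n" by (rule kalgebra_Uq)
  have "\<one>\<^bsub>Uq n\<^esub> \<in> hpart (Uq n) 0" by (auto simp: Uq_simps intro!: exI[of _ 1])
  then show ?thesis by (simp add: tw_hpart)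
qed

lemma tw_hpart_closed: "x \<in> hpart (Uq n) s \<Longrightarrow> tw n r x \<in> hpart (Uq n) s"
  using Uq_submodule[of n s] unfolding tw_hpart
  by (metis Module.module.submoduleE(4) module_Uq kring_simps(1) UNIV_I)

context
  fixes n :: nat
begin

interpretation U: kalgebra "Uq n" by (rule kalgebra_Uq)

lemma tw_zero [simp]: "tw n r \<zero>\<^bsub>Uq n\<^esub> = \<zero>\<^bsub>Uq n\<^esub>"
  using tw_smult[of "\<one>\<^bsub>Uq n\<^esub>" n r 0] by simp

lemma tw_finsum:
  "finite A \<Longrightarrow> (\<And>i. i \<in> A \<Longrightarrow> f i \<in> carrier (Uq n)) \<Longrightarrow> tw n r (\<Oplus>\<^bsub>Uq n\<^esub>i\<in>A. f i) = (\<Oplus>\<^bsub>Uq n\<^esub>i\<in>A. tw n r (f i))"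
  by (induction A rule: finite_induct) (simp_all add: U.finsum_insert tw_add U.finsum_closed Pi_def)

lemma regular_simps [simp]:
  "carrier (regular n) = Alg ` carrier (Uq n)" "\<zero>\<^bsub>regular n\<^esub> = Alg \<zero>\<^bsub>Uq n\<^esub>"
  "Alg x \<oplus>\<^bsub>regular n\<^esub> Alg y = Alg (x \<oplus>\<^bsub>Uq n\<^esub> y)" "a \<odot>\<^bsub>regular n\<^esub> Alg x = Alg (a \<odot>\<^bsub>Uq n\<^esub> x)"
  "hpart (regular n) r = Alg ` hpart (Uq n) r" "act (regular n) x (Alg y) = Alg (x \<otimes>\<^bsub>Uq n\<^esub> y)"
  by (simp_all add: regular_def)

lemma abelian_group_regular: "abelian_group (regular n :: 'v vect supermod)"
proof (rule abelian_groupI)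
  fix x assume "x \<in> carrier (regular n :: 'v vect supermod)"
  then show "\<exists>y\<in>carrier (regular n :: 'v vect supermod). y \<oplus>\<^bsub>regular n\<^esub> x = \<zero>\<^bsub>regular n\<^esub>"
    by (auto intro!: bexI[of _ "\<ominus>\<^bsub>Uq n\<^esub> alg x"] simp: U.l_neg)
qed (auto simp: U.a_ac)

lemma module_regular: "module kring (regular n :: 'v vect supermod)"
proof (rule moduleI)
  show "cring kring" by (rule cring_from_type_algebra)
  show "abelian_group (regular n :: 'v vect supermod)" by (rule abelian_group_regular)
qed (auto simp: U.smult_smult module.smult_l_distr[OF U.mod, simplified] module.smult_r_distr[OF U.mod, simplified])

lemma hpart_sub: "hpart (Uq n) r \<subseteq> carrier (Uq n)"
  by (auto simp: Uq_simps)

lemma superspace_regular: "is_superspace (regular n :: 'v vect supermod)"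
  unfolding is_superspace_def
proof (intro conjI allI ballI module_regular)
  note sub = module.submoduleE[OF module_Uq Uq_submodule]
  fix r show "submodule (hpart (regular n :: 'v vect supermod) r) kring (regular n :: 'v vect supermod)"
  proof (rule module.submoduleI[OF module_regular])
    show "hpart (regular n :: 'v vect supermod) r \<subseteq> carrier (regular n :: 'v vect supermod)" using hpart_sub by auto
    have "\<zero>\<^bsub>Uq n\<^esub> \<in> hpart (Uq n) r" by (auto simp: Uq_simps intro!: exI[of _ 0])
    then show "\<zero>\<^bsub>regular n\<^esub> \<in> hpart (regular n :: 'v vect supermod) r" by simp
    fix a assume "a \<in> hpart (regular n :: 'v vect supermod) r"
    then obtain x where x: "a = Alg x" "x \<in> hpart (Uq n) r" by auto
    have xc: "x \<in> carrier (Uq n)" using x hpart_sub by blast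
    have "\<ominus>\<^bsub>(regular n :: 'v vect supermod)\<^esub> a = Alg (\<ominus>\<^bsub>Uq n\<^esub> x)"
      using x xc by (intro abelian_group.minus_equality[OF abelian_group_regular]) (auto simp: U.l_neg)
    then show "\<ominus>\<^bsub>regular n\<^esub> a \<in> hpart (regular n :: 'v vect supermod) r" using x sub(3) by simp
    show "c \<odot>\<^bsub>regular n\<^esub> a \<in> hpart (regular n :: 'v vect supermod) r" for c using x sub(4) by simp
    fix b assume "b \<in> hpart (regular n :: 'v vect supermod) r"
    then show "a \<oplus>\<^bsub>regular n\<^esub> b \<in> hpart (regular n :: 'v vect supermod) r" using x sub(5) by auto
  qed
next
  fix x assume "x \<in> carrier (regular n :: 'v vect supermod)"
  then obtain y where y: "x = Alg y" "y \<in> carrier (Uq n)" by auto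
  have "\<exists>!w. fst w \<in> hpart (Uq n) 0 \<and> snd w \<in> hpart (Uq n) 1 \<and> y = fst w \<oplus>\<^bsub>Uq n\<^esub> snd w"
    using superspace_Uq[of n] y unfolding is_superspace_def by blast
  then obtain w where w: "fst w \<in> hpart (Uq n) 0" "snd w \<in> hpart (Uq n) 1" "y = fst w \<oplus>\<^bsub>Uq n\<^esub> snd w"
    and wu: "\<And>v. fst v \<in> hpart (Uq n) 0 \<Longrightarrow> snd v \<in> hpart (Uq n) 1 \<Longrightarrow> y = fst v \<oplus>\<^bsub>Uq n\<^esub> snd v \<Longrightarrow> v = w"
    by (elim ex1E) blast
  show "\<exists>!w. fst w \<in> hpart (regular n :: 'v vect supermod) 0 \<and> snd w \<in> hpart (regular n :: 'v vect supermod) 1 \<and> x = fst w \<oplus>\<^bsub>regular n\<^esub> snd w"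
  proof (rule ex1I[of _ "(Alg (fst w), Alg (snd w))"])
    fix v assume v: "fst v \<in> hpart (regular n :: 'v vect supermod) 0 \<and> snd v \<in> hpart (regular n :: 'v vect supermod) 1 \<and> x = fst v \<oplus>\<^bsub>regular n\<^esub> snd v"
    then obtain a b where ab: "fst v = Alg a" "snd v = Alg b" "a \<in> hpart (Uq n) 0" "b \<in> hpart (Uq n) 1" by auto
    then have "(a, b) = w" using v y by (intro wu) auto
    then show "v = (Alg (fst w), Alg (snd w))" using ab by (metis fst_conv snd_conv prod.collapse)
  qed (use w y in auto)
qed

lemma supermodule_regular: "is_supermodule n (regular n :: 'v vect supermod)"
  unfolding is_supermodule_def
  using superspace_regular
  by (auto simp: U.l_distr U.r_distr U.m_assoc U.smult_left U.smult_right Uq_hpart_mult)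

lemma twist_regular: "x \<in> carrier (Uq n) \<Longrightarrow> twist (regular n :: 'v vect supermod) r (Alg x) = Alg (tw n r x)"
proof -
  assume "x \<in> carrier (Uq n)"
  then obtain f where f: "f \<in> FC n" "x = Uclass n f" by (rule Uq_cases)
  let ?a = "Uclass n (fpart 0 f)" and ?b = "Uclass n (fpart 1 f)"
  have h: "?a \<in> hpart (Uq n) 0" "?b \<in> hpart (Uq n) 1"
    using f by (auto simp: Uq_simps intro: FC_fpart fhom_fpart)
  then have c: "?a \<in> carrier (Uq n)" "?b \<in> carrier (Uq n)" using hpart_sub by auto
  have xab: "x = ?a \<oplus>\<^bsub>Uq n\<^esub> ?b" using f by (simp add: Uclass_add FC_fpart fpart_sum)
  have "\<ominus>\<^bsub>(regular n :: 'v vect supermod)\<^esub> Alg ?b = Alg (\<ominus>\<^bsub>Uq n\<^esub> ?b)"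
    using c by (intro abelian_group.minus_equality[OF abelian_group_regular]) (auto simp: U.l_neg)
  moreover have "parity_inv (regular n :: 'v vect supermod) (Alg ?a \<oplus>\<^bsub>(regular n :: 'v vect supermod)\<^esub> Alg ?b) = Alg ?a \<ominus>\<^bsub>(regular n :: 'v vect supermod)\<^esub> Alg ?b"
    using h by (intro parity_inv_eq superspace_regular) auto
  moreover have "parity_inv (Uq n) (?a \<oplus>\<^bsub>Uq n\<^esub> ?b) = ?a \<ominus>\<^bsub>Uq n\<^esub> ?b"
    using h by (intro parity_inv_eq superspace_Uq) auto
  ultimately show ?thesis
    unfolding xab by (simp add: twist_def tw_def a_minus_def)
qed

lemma finsum_regular:
  "finite A \<Longrightarrow> (\<And>i. i \<in> A \<Longrightarrow> f i \<in> carrier (Uq n)) \<Longrightarrow> (\<Oplus>\<^bsub>(regular n :: 'v vect supermod)\<^esub>i\<in>A. Alg (f i)) = Alg (\<Oplus>\<^bsub>Uq n\<^esub>i\<in>A. f i)"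
proof (induction A rule: finite_induct)
  case empty
  interpret R: abelian_group "regular n :: 'v vect supermod" by (rule abelian_group_regular)
  show ?case by simp
next
  case (insert i A)
  interpret R: abelian_group "regular n :: 'v vect supermod" by (rule abelian_group_regular)
  show ?case using insert by (subst R.finsum_insert) (auto simp: U.finsum_insert)
qed

end

section \<open>Operators on the regular representation as matrix products\<close>

context Uq_antipode
begin

text \<open>Columns of matrices as elements of \<open>V \<otimes> U\<^sub>q\<close> and of \<open>U\<^sub>q \<otimes> V\<close>.  The parity twist in the latter cancels
  the twists in \<open>T_op\<close> and \<open>tensor_J\<close>, which then become plain matrix multiplications.\<close>

definition vec :: "(int \<Rightarrow> int \<Rightarrow> free set) \<Rightarrow> int \<Rightarrow> 'v vect" where
  "vec B j = Tup (\<lambda>i\<in>I. Alg (B i j))"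

definition tvec :: "(int \<Rightarrow> int \<Rightarrow> free set) \<Rightarrow> int \<Rightarrow> 'v vect" where
  "tvec B j = Tup (\<lambda>i\<in>I. Alg (tw n (p i) (B i j)))"

lemma Jm_entry: "B \<in> carrier M1 \<Longrightarrow> a \<in> I \<Longrightarrow> j \<in> I \<Longrightarrow>
    (Jm \<otimes>\<^bsub>M1\<^esub> B) a j = ksgn (p (- a)) \<odot>\<^bsub>Uq n\<^esub> B (- a) j"
  unfolding Jm_def by (subst U.monomial_mult) (auto simp: Idx_minus)

lemma Jmat_finsum:
  assumes "a \<in> I" "\<And>b. b \<in> I \<Longrightarrow> f b \<in> carrier (Uq n)"
  shows "(\<Oplus>\<^bsub>regular n\<^esub>b\<in>I. Jmat a b \<odot>\<^bsub>regular n\<^esub> Alg (f b)) = Alg (ksgn (p (- a)) \<odot>\<^bsub>Uq n\<^esub> f (- a))"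
proof -
  have "(\<Oplus>\<^bsub>regular n\<^esub>b\<in>I. Jmat a b \<odot>\<^bsub>regular n\<^esub> Alg (f b)) = Alg (\<Oplus>\<^bsub>Uq n\<^esub>b\<in>I. Jmat a b \<odot>\<^bsub>Uq n\<^esub> f b)"
    using assms by (simp add: finsum_regular)
  also have "(\<Oplus>\<^bsub>Uq n\<^esub>b\<in>I. Jmat a b \<odot>\<^bsub>Uq n\<^esub> f b) = (\<Oplus>\<^bsub>Uq n\<^esub>b\<in>I. if b = - a then ksgn (p b) \<odot>\<^bsub>Uq n\<^esub> f b else \<zero>\<^bsub>Uq n\<^esub>)"
    using assms by (intro U.finsum_cong') (simp_all add: Jmat_def)
  also have "\<dots> = ksgn (p (- a)) \<odot>\<^bsub>Uq n\<^esub> f (- a)"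
    using assms Idx_minus by (intro U.finsum_delta) auto
  finally show ?thesis .
qed

lemma J_tensor_vec:
  assumes "B \<in> carrier M1" "j \<in> I"
  shows "J_tensor n (regular n) (vec B j) = vec (Jm \<otimes>\<^bsub>M1\<^esub> B) j"
  unfolding J_tensor_def vec_def
proof (intro arg_cong[where f = Tup] restrict_ext)
  fix a assume a: "a \<in> I"
  interpret R: abelian_group "regular n" by (rule abelian_group_regular)
  note e = U.Mat_entry[OF assms(1)]
  have "(\<Oplus>\<^bsub>regular n\<^esub>b\<in>I. Jmat a b \<odot>\<^bsub>regular n\<^esub> coord (Tup (\<lambda>i\<in>I. Alg (B i j))) b)
      = (\<Oplus>\<^bsub>regular n\<^esub>b\<in>I. Jmat a b \<odot>\<^bsub>regular n\<^esub> Alg (B b j))"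
    using assms e by (intro R.finsum_cong') auto
  also have "\<dots> = Alg ((Jm \<otimes>\<^bsub>M1\<^esub> B) a j)"
    using a assms e by (subst Jmat_finsum) (simp_all add: Jm_entry)
  finally show "(\<Oplus>\<^bsub>regular n\<^esub>b\<in>I. Jmat a b \<odot>\<^bsub>regular n\<^esub> coord (Tup (\<lambda>i\<in>I. Alg (B i j))) b)
      = Alg ((Jm \<otimes>\<^bsub>M1\<^esub> B) a j)" .
qed

lemma tensor_J_tvec:
  assumes "B \<in> carrier M1" "j \<in> I"
  shows "tensor_J n (regular n) (tvec B j) = tvec (Jm \<otimes>\<^bsub>M1\<^esub> B) j"
  unfolding tensor_J_def tvec_def
proof (intro arg_cong[where f = Tup] restrict_ext)
  fix a assume a: "a \<in> I"
  interpret R: abelian_group "regular n" by (rule abelian_group_regular)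
  note e = U.Mat_entry[OF assms(1)]
  have "(\<Oplus>\<^bsub>regular n\<^esub>b\<in>I. Jmat a b \<odot>\<^bsub>regular n\<^esub> twist (regular n) 1 (coord (Tup (\<lambda>i\<in>I. Alg (tw n (p i) (B i j)))) b))
      = (\<Oplus>\<^bsub>regular n\<^esub>b\<in>I. Jmat a b \<odot>\<^bsub>regular n\<^esub> Alg (tw n (1 + p b) (B b j)))"
    using assms e by (intro R.finsum_cong') (auto simp: twist_regular tw_tw)
  also have "\<dots> = Alg (ksgn (p (- a)) \<odot>\<^bsub>Uq n\<^esub> tw n (1 + p (- a)) (B (- a) j))"
    using a assms e by (intro Jmat_finsum) auto
  \<comment> \<open>The twist by 1 that \<open>tensor_J\<close> adds for the odd \<open>J\<close>
    turns the twist attached to the coordinate \<open>- a\<close> into the one \<open>tvec\<close>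
    expects at \<open>a\<close>.\<close>
  also have "1 + p (- a) = p a"
  proof -
    have "a \<noteq> 0" using a Idx_0[of n] by auto
    then show ?thesis by (cases "p a") (simp_all add: p_minus)
  qed
  finally show "(\<Oplus>\<^bsub>regular n\<^esub>b\<in>I. Jmat a b \<odot>\<^bsub>regular n\<^esub> twist (regular n) 1 (coord (Tup (\<lambda>i\<in>I. Alg (tw n (p i) (B i j)))) b))
      = Alg (tw n (p a) ((Jm \<otimes>\<^bsub>M1\<^esub> B) a j))"
    using a assms e Idx_minus by (simp add: Jm_entry tw_smult)
qed

text \<open>The twists of \<open>L_op\<close> and \<open>tvec\<close> combine to \<open>p i\<close>,
  independent of the summation index. The flip cancels this twist on the column and multiplies
  \<open>u n i k\<close> by \<open>ksgn (p i + p i * p k)\<close>: this is the origin of the sign in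
  \<open>Nmat\<close>.\<close>

lemma T_op_tvec:
  assumes "B \<in> carrier M1" "j \<in> I"
  shows "T_op n (regular n) (tvec B j) = vec (Nmat \<otimes>\<^bsub>M1\<^esub> B) j"
proof -
  interpret R: abelian_group "regular n" by (rule abelian_group_regular)
  note e = U.Mat_entry[OF assms(1)]
  have L: "coord (L_op n (regular n) (tvec B j)) i = Alg (\<Oplus>\<^bsub>Uq n\<^esub>k\<in>{k \<in> I. i \<le> k}. u n i k \<otimes>\<^bsub>Uq n\<^esub> tw n (p i) (B k j))"
    if i: "i \<in> I" for i
  proof -
    have "coord (L_op n (regular n) (tvec B j)) i
      = (\<Oplus>\<^bsub>regular n\<^esub>k\<in>{k \<in> I. i \<le> k}. Alg (u n i k \<otimes>\<^bsub>Uq n\<^esub> tw n (p i) (B k j)))"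
      unfolding L_op_def vect.sel restrict_apply' [OF i]
      using assms i e by (intro R.finsum_cong') (auto simp: tvec_def twist_regular tw_tw pp_def add.assoc)
    then show ?thesis using assms i e by (subst (asm) finsum_regular) auto
  qed
  show ?thesis
    unfolding T_op_def flip_op_def vec_def
  proof (intro arg_cong[where f = Tup] restrict_ext)
    fix i assume i: "i \<in> I"
    have "twist (regular n) (p i) (coord (L_op n (regular n) (tvec B j)) i)
      = Alg (\<Oplus>\<^bsub>Uq n\<^esub>k\<in>{k \<in> I. i \<le> k}. tw n (p i) (u n i k \<otimes>\<^bsub>Uq n\<^esub> tw n (p i) (B k j)))"
      unfolding L[OF i] using assms i e by (subst twist_regular, force intro!: U.finsum_closed, subst tw_finsum) auto
    also have "(\<Oplus>\<^bsub>Uq n\<^esub>k\<in>{k \<in> I. i \<le> k}. tw n (p i) (u n i k \<otimes>\<^bsub>Uq n\<^esub> tw n (p i) (B k j)))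
      = (\<Oplus>\<^bsub>Uq n\<^esub>k\<in>I. Nmat i k \<otimes>\<^bsub>Uq n\<^esub> B k j)"
    proof (rule U.add.finprod_mono_neutral_cong_left)
      fix k assume k: "k \<in> {k \<in> I. i \<le> k}"
      then have "tw n (p i) (u n i k) = ksgn (p i + p i * p k) \<odot>\<^bsub>Uq n\<^esub> u n i k"
        using i tw_hpart[OF u_hpart, of i k n "p i"] by (simp add: gens_def pp_def distrib_left bit_mult_self)
      then show "tw n (p i) (u n i k \<otimes>\<^bsub>Uq n\<^esub> tw n (p i) (B k j)) = Nmat i k \<otimes>\<^bsub>Uq n\<^esub> B k j"
        using k i assms e by (simp add: tw_mult tw_tw Nmat_def)
    qed (use i assms e in \<open>auto simp: Nmat_def\<close>)
    finally show "twist (regular n) (p i) (coord (L_op n (regular n) (tvec B j)) i) = Alg ((Nmat \<otimes>\<^bsub>M1\<^esub> B) i j)"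
      using i assms by (simp add: U.Mat_mult)
  qed
qed

lemma tvec_surj:
  assumes "y \<in> Tup ` (I \<rightarrow>\<^sub>E carrier (regular n))" "j \<in> I"
  obtains B where "B \<in> carrier M1" "y = tvec B j"
proof -
  from assms obtain c where c: "y = Tup c" "c \<in> I \<rightarrow>\<^sub>E Alg ` carrier (Uq n)" by auto
  \<comment> \<open>All columns are taken equal, since only the \<open>j\<close>-th one is looked
    at.\<close>
  define B where "B = U.mat I (\<lambda>i k. tw n (p i) (alg (c i)))"
  have ci: "c i \<in> Alg ` carrier (Uq n)" if "i \<in> I" for i using c that by auto
  have "B \<in> carrier M1"
    unfolding B_def using ci by (intro U.mat_in_Mat tw_closed) force
  moreover have "c = (\<lambda>i\<in>I. Alg (tw n (p i) (B i j)))"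
  proof (rule ext)
    fix i show "c i = (\<lambda>i\<in>I. Alg (tw n (p i) (B i j))) i"
    proof (cases "i \<in> I")
      case True
      then obtain x where "c i = Alg x" "x \<in> carrier (Uq n)" using ci by auto
      then show ?thesis using True assms by (simp add: B_def tw_tw)
    next
      case False then show ?thesis using c by (auto simp: PiE_def extensional_def)
    qed
  qed
  ultimately show ?thesis using that c unfolding tvec_def by auto
qed

lemma tvec_in:
  assumes B: "B \<in> carrier M1" and j: "j \<in> I"
  shows "tvec B j \<in> Tup ` (I \<rightarrow>\<^sub>E carrier (regular n))"
  unfolding tvec_def using U.Mat_entry[OF B _ j] by (intro imageI restrict_PiE_iff[THEN iffD2]) auto

text \<open>The inverse in \<open>o_op\<close> is \<open>inv_into\<close>, so preimages must be
  unique. \<open>T_op\<close> is injective because multiplying a column of \<open>N C\<close> by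
  \<open>Nimat\<close> recovers that column of \<open>C\<close>.\<close>

lemma o_op_vec:
  assumes B: "B \<in> carrier M1" and j: "j \<in> I"
  shows "o_op n (regular n :: 'v vect supermod) (vec B j) = vec (Nmat \<otimes>\<^bsub>M1\<^esub> (Jm \<otimes>\<^bsub>M1\<^esub> (Nimat \<otimes>\<^bsub>M1\<^esub> B))) j"
proof -
  let ?X = "Tup ` (I \<rightarrow>\<^sub>E carrier (regular n :: 'v vect supermod))"
  have inj: "inj_on (T_op n (regular n :: 'v vect supermod)) ?X"
  proof (rule inj_onI)
    fix x y assume xy: "x \<in> ?X" "y \<in> ?X" "T_op n (regular n :: 'v vect supermod) x = T_op n (regular n :: 'v vect supermod) y"
    obtain C D where CD: "C \<in> carrier M1" "x = tvec C j" "D \<in> carrier M1" "y = tvec D j"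
      using tvec_surj[OF xy(1) j] tvec_surj[OF xy(2) j] by metis
    then have v: "(vec (Nmat \<otimes>\<^bsub>M1\<^esub> C) j :: 'v vect) = vec (Nmat \<otimes>\<^bsub>M1\<^esub> D) j"
      using xy j by (simp add: T_op_tvec)
    have ent: "(Nmat \<otimes>\<^bsub>M1\<^esub> C) k j = (Nmat \<otimes>\<^bsub>M1\<^esub> D) k j" if "k \<in> I" for k
      using v that unfolding vec_def by (auto dest!: fun_cong[of _ _ k])
    \<comment> \<open>Only the \<open>j\<close>-th columns of the two products are known to agree,
      hence an argument by entries instead of cancelling \<open>Nmat\<close>.\<close>
    have "C i j = D i j" if i: "i \<in> I" for i
    proof -
      have "E i j = (\<Oplus>\<^bsub>Uq n\<^esub>k\<in>I. Nimat i k \<otimes>\<^bsub>Uq n\<^esub> (Nmat \<otimes>\<^bsub>M1\<^esub> E) k j)" if "E \<in> carrier M1" for E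
      proof -
        have "E = Nimat \<otimes>\<^bsub>M1\<^esub> (Nmat \<otimes>\<^bsub>M1\<^esub> E)"
          using that by (simp add: M1.m_assoc[symmetric] Nmat_inv)
        then have "E i j = (Nimat \<otimes>\<^bsub>M1\<^esub> (Nmat \<otimes>\<^bsub>M1\<^esub> E)) i j" by simp
        then show ?thesis using i j by (simp only: U.Mat_mult)
      qed
      note E = this
      have "(\<Oplus>\<^bsub>Uq n\<^esub>k\<in>I. Nimat i k \<otimes>\<^bsub>Uq n\<^esub> (Nmat \<otimes>\<^bsub>M1\<^esub> C) k j) = (\<Oplus>\<^bsub>Uq n\<^esub>k\<in>I. Nimat i k \<otimes>\<^bsub>Uq n\<^esub> (Nmat \<otimes>\<^bsub>M1\<^esub> D) k j)"
        using i j CD by (intro U.finsum_cong') (auto simp only: ent intro!: Pi_I U.m_closed U.Mat_entry[of _ I] Nimat_Mat Nmat_Mat M1.m_closed)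
      then show ?thesis using E[OF CD(1)] E[OF CD(3)] by simp
    qed
    then have "(\<lambda>i\<in>I. Alg (tw n (p i) (C i j))) = (\<lambda>i\<in>I. Alg (tw n (p i) (D i j)))"
      by (intro restrict_ext) simp
    then show "x = y" unfolding CD(2,4) tvec_def by simp
  qed
  let ?y = "tvec (Nimat \<otimes>\<^bsub>M1\<^esub> B) j"
  have "T_op n (regular n :: 'v vect supermod) ?y = vec B j"
    using B j by (simp add: T_op_tvec M1.m_assoc[symmetric] Nmat_inv)
  then have "inv_into ?X (T_op n (regular n :: 'v vect supermod)) (vec B j) = ?y"
    using inj B j by (intro inv_into_f_eq tvec_in) auto
  then show ?thesis
    unfolding o_op_def using B j by (simp only: tensor_J_tvec T_op_tvec M1.m_closed Nimat_Mat J_closed)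
qed

end

section \<open>Components of the superfunctor\<close>

lemma aqeq_cls: "aqeq z s t \<Longrightarrow> cls z s = cls z t"
  unfolding cls_def by (blast intro: aqeq.sym aqeq.trans)

lemma cls_self: "typed s X Y \<Longrightarrow> s \<in> cls z s"
  unfolding cls_def by (blast intro: aqeq.refl)

lemma homog_typed: "homog s X Y r \<Longrightarrow> typed s X Y"
  by (induction rule: homog.induct) (auto intro: typed.intros)

lemma AQ_simps [simp]:
  "obs (AQ z) = UNIV" "ide (AQ z) X = cls z (Id X)" "unit_ob (AQ z) = []" "tens_ob (AQ z) = (@)"
  "carrier (homs (AQ z) X Y) = {cls z s | s. typed s X Y}"
  "hpart (homs (AQ z) X Y) r = {cls z s | s. homog s X Y r}"
  by (simp_all add: AQ_def)

text \<open>The composite in \<open>AQ\<close> is a union over all representatives;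
  \<open>cmp_cong\<close> makes all sets in this union equal.\<close>

lemma AQ_cmp:
  assumes "typed s Y Z" "typed t X Y"
  shows "cmp (AQ z) (cls z s) (cls z t) = cls z (s \<bullet> t)"
proof -
  have e: "cls z (s' \<bullet> t') = cls z (s \<bullet> t)" if "s' \<in> cls z s" "t' \<in> cls z t" for s' t'
    using that assms by (intro aqeq_cls[symmetric] aqeq.cmp_cong) (auto simp: cls_def)
  have "cmp (AQ z) (cls z s) (cls z t) = (\<Union>s'\<in>cls z s. \<Union>t'\<in>cls z t. cls z (s' \<bullet> t'))"
    by (simp add: AQ_def)
  also have "\<dots> = (\<Union>s'\<in>cls z s. \<Union>t'\<in>cls z t. cls z (s \<bullet> t))"
    by (simp add: e cong: SUP_cong)
  also have "\<dots> = cls z (s \<bullet> t)"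
    using cls_self[OF assms(1), of z] cls_self[OF assms(2), of z] by auto
  finally show ?thesis .
qed

lemma AQ_tens:
  assumes "typed s X Y" "typed t X' Y'"
  shows "tens_ar (AQ z) (cls z s) (cls z t) = cls z (s \<boxtimes> t)"
proof -
  have e: "cls z (s' \<boxtimes> t') = cls z (s \<boxtimes> t)" if "s' \<in> cls z s" "t' \<in> cls z t" for s' t'
    using that assms by (intro aqeq_cls[symmetric] aqeq.tens_cong) (auto simp: cls_def)
  have "tens_ar (AQ z) (cls z s) (cls z t) = (\<Union>s'\<in>cls z s. \<Union>t'\<in>cls z t. cls z (s' \<boxtimes> t'))"
    by (simp add: AQ_def)
  also have "\<dots> = (\<Union>s'\<in>cls z s. \<Union>t'\<in>cls z t. cls z (s \<boxtimes> t))"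
    by (simp add: e cong: SUP_cong)
  also have "\<dots> = cls z (s \<boxtimes> t)"
    using cls_self[OF assms(1), of z] cls_self[OF assms(2), of z] by auto
  finally show ?thesis .
qed

lemma AQ_arrows: "typed s X Y \<Longrightarrow> cls z s \<in> arrows (AQ z)"
  by (auto simp: arrows_def)

text \<open>Parities, and in the next lemma also words, are passed as equations so that the rules
  apply to values that become a sum or a concatenation only after computation.\<close>

lemma homog_cmp: "homog s Y Z r \<Longrightarrow> homog t X Y r' \<Longrightarrow> r'' = r + r' \<Longrightarrow> homog (s \<bullet> t) X Z r''"
  by (auto intro: homog.intros)

lemma homog_tens: "homog s X Y r \<Longrightarrow> homog t X' Y' r' \<Longrightarrow> X'' = X @ X' \<Longrightarrow> Y'' = Y @ Y' \<Longrightarrow> r'' = r + r' \<Longrightarrow>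
    homog (s \<boxtimes> t) X'' Y'' r''"
  by (auto intro: homog.intros)

lemma homog_gen: "homog (Gen UPlus) [Up, Up] [Up, Up] 0" "homog (Gen RMinus) [Up, Down] [Down, Up] 0"
  "homog (Gen CapL) [Down, Up] [] 0" "homog (Gen CupL) [] [Up, Down] 0" "homog (Gen CDot) [Up] [Up] 1"
  "homog (Gen ODot) [Up] [Up] 1"
  using homog.intros(1)[of UPlus] homog.intros(1)[of RMinus] homog.intros(1)[of CapL]
    homog.intros(1)[of CupL] homog.intros(1)[of CDot] homog.intros(1)[of ODot]
  by (simp_all add: gpar_def)

lemma homog_co_power: "homog (co_power m) [Up] [Up] 0"
proof (induction m)
  case 0 then show ?case by (simp add: homog.intros)
next
  case (Suc m)
  have "homog (Gen CDot \<bullet> Gen ODot) [Up] [Up] 0"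
    by (rule homog_cmp[OF homog_gen(5,6)]) simp
  then show ?case using Suc by (auto intro: homog_cmp)
qed

lemma sum_smult:
  assumes M: "module kring M"
  shows "finite A \<Longrightarrow> x \<in> carrier M \<Longrightarrow> sum f A \<odot>\<^bsub>M\<^esub> x = (\<Oplus>\<^bsub>M\<^esub>i\<in>A. f i \<odot>\<^bsub>M\<^esub> x)"
proof (induction A rule: finite_induct)
  interpret M: Module.module kring M by (rule M)
  { case empty then show ?case using M.smult_l_null[of x] by simp }
  { case (insert i A)
    then show ?case using M.smult_l_distr[of "f i" "sum f A" x] M.smult_closed[of _ x]
      by (simp add: M.finsum_insert) }
qed

lemma obs_Smod [simp]: "obs (Smod n) = {M. is_supermodule n M}"
  and homs_Smod [simp]: "homs (Smod n) = smod_homs n"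
  and ide_Smod [simp]: "ide (Smod n) M = (M, \<lambda>m\<in>carrier M. m, M)"
  and cmp_Smod [simp]: "cmp (Smod n) (N, g, P) (M, f, N') = (M, compose (carrier M) g f, P)"
  by (simp_all add: Smod_def)

lemma hpart_smod_homs [simp]: "hpart (smod_homs n M N) r = {(M, f, N) | f. smod_hom n r M N f}"
  by (simp add: smod_homs_def)

lemma supermodule_module: "is_supermodule n M \<Longrightarrow> module kring M"
  by (simp add: is_supermodule_def is_superspace_def)

lemma supermodule_abelian: "is_supermodule n M \<Longrightarrow> abelian_group M"
  using supermodule_module[of n M] by (simp add: module_def)

lemma smod_homsI:
  "smod_hom n 0 M N f \<Longrightarrow> smod_hom n 1 M N g \<Longrightarrow> h = (\<lambda>m\<in>carrier M. f m \<oplus>\<^bsub>N\<^esub> g m) \<Longrightarrow>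
    (M, h, N) \<in> carrier (smod_homs n M N)"
  unfolding smod_homs_def by simp blast

lemma smod_hom_closed: "smod_hom n r M N f \<Longrightarrow> x \<in> carrier M \<Longrightarrow> f x \<in> carrier N"
  by (auto simp: smod_hom_def)

lemma smod_hom_smult: "smod_hom n r M N f \<Longrightarrow> x \<in> carrier M \<Longrightarrow> f (a \<odot>\<^bsub>M\<^esub> x) = a \<odot>\<^bsub>N\<^esub> f x"
  by (simp add: smod_hom_def)

lemma smod_hom_zero:
  assumes "is_supermodule n M" "is_supermodule n N" "smod_hom n r M N f"
  shows "f \<zero>\<^bsub>M\<^esub> = \<zero>\<^bsub>N\<^esub>"
proof -
  interpret M: Module.module kring M using assms by (intro supermodule_module)
  interpret N: Module.module kring N using assms by (intro supermodule_module)
  have "f (0 \<odot>\<^bsub>M\<^esub> \<zero>\<^bsub>M\<^esub>) = 0 \<odot>\<^bsub>N\<^esub> f \<zero>\<^bsub>M\<^esub>"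
    by (rule smod_hom_smult[OF assms(3)]) simp
  moreover have "f \<zero>\<^bsub>M\<^esub> \<in> carrier N" by (rule smod_hom_closed[OF assms(3)]) simp
  ultimately show ?thesis using M.smult_l_null[of "\<zero>\<^bsub>M\<^esub>"] N.smult_l_null[of "f \<zero>\<^bsub>M\<^esub>"] by simp
qed

section \<open>Values of the superfunctor on objects and arrows\<close>

locale fhat = Uq_antipode n S for n S +
  fixes \<rho> :: "free set \<Rightarrow> int \<Rightarrow> int \<Rightarrow> Cq" and F :: "'a aq_functor"
  assumes Fhat: "is_Fhat n S \<rho> F"
begin

abbreviation obj :: "'a vect supermod \<Rightarrow> bool" where
  "obj \<equiv> is_supermodule n"

abbreviation CC :: "('a vect supermod, 'a vect smod_arrow) supercat" where
  "CC \<equiv> Smod n"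

definition ob :: "dir list \<Rightarrow> 'a vect supermod \<Rightarrow> 'a vect supermod" where
  "ob X M = omap (omap F X) M"

text \<open>Taking expressions instead of classes as arguments lets the relations of
  \<open>AQ\<close> be used as equations between maps, see \<open>C_rel\<close>.\<close>

definition C :: "mor \<Rightarrow> 'a vect supermod \<Rightarrow> 'a vect \<Rightarrow> 'a vect" where
  "C s M = component (amap F (cls zz s)) M"

lemma monF: "strict_monoidal_superfunctor (AQ zz) (SEnd CC) F"
  using Fhat by (simp add: is_Fhat_def)

lemma sfF: "superfunctor (AQ zz) (SEnd CC) F"
  using monF by (simp add: strict_monoidal_superfunctor_def)

lemma endoF: "endofunctor CC (omap F X)"
  using sfF by (simp add: superfunctor_def SEnd_def)

lemma ob_obj [simp]: "obj M \<Longrightarrow> obj (ob X M)"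
  using endoF[of X] by (simp add: endofunctor_def superfunctor_def ob_def)

lemma omap_Nil: "omap F [] = unit_ob (SEnd CC)"
  using monF by (simp add: strict_monoidal_superfunctor_def)

lemma ob_Nil [simp]: "obj M \<Longrightarrow> ob [] M = M"
  by (simp add: ob_def omap_Nil SEnd_def)

lemma omap_append: "omap F (X @ Y) = fun_comp CC (omap F X) (omap F Y)"
  using monF by (simp add: strict_monoidal_superfunctor_def SEnd_def)

lemma ob_append: "obj M \<Longrightarrow> ob (X @ Y) M = ob X (ob Y M)"
  by (simp add: ob_def omap_append fun_comp_def compose_def)

lemma ob_Cons: "obj M \<Longrightarrow> ob (d # e # X) M = ob [d] (ob (e # X) M)"
  using ob_append[of M "[d]" "e # X"] by simp

text \<open>The source of all later facts on components. For homogeneous \<open>s\<close> the image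
  is a supernatural transformation of one parity, not a sum of an even and an odd one, so its
  components are homogeneous module maps.\<close>

lemma amap_homog:
  assumes "homog s X Y r"
  shows "\<exists>\<alpha>. amap F (cls zz s) = (omap F X, \<alpha>, omap F Y) \<and> supernat CC r (omap F X) (omap F Y) \<alpha> \<and>
    (\<forall>M. obj M \<longrightarrow> \<alpha> M = (ob X M, C s M, ob Y M) \<and> smod_hom n r (ob X M) (ob Y M) (C s M))"
proof -
  have "cls zz s \<in> hpart (homs (AQ zz) X Y) r" using assms by auto
  then have "amap F (cls zz s) \<in> hpart (homs (SEnd CC) (omap F X) (omap F Y)) r"
    using sfF unfolding superfunctor_def by (simp del: AQ_simps(6))
  then obtain \<alpha> where a: "amap F (cls zz s) = (omap F X, \<alpha>, omap F Y)" "supernat CC r (omap F X) (omap F Y) \<alpha>"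
    by (auto simp: SEnd_def nat_space_def Let_def)
  have "\<alpha> M = (ob X M, C s M, ob Y M) \<and> smod_hom n r (ob X M) (ob Y M) (C s M)" if "obj M" for M
  proof -
    have "\<alpha> M \<in> hpart (smod_homs n (ob X M) (ob Y M)) r"
      using a(2) that by (simp add: supernat_def ob_def del: hpart_smod_homs)
    then show ?thesis by (auto simp: C_def component_def a(1))
  qed
  with a show ?thesis by blast
qed

lemma C_hom: "homog s X Y r \<Longrightarrow> obj M \<Longrightarrow> smod_hom n r (ob X M) (ob Y M) (C s M)"
  using amap_homog by blast

lemma C_closed: "homog s X Y r \<Longrightarrow> obj M \<Longrightarrow> x \<in> carrier (ob X M) \<Longrightarrow> C s M x \<in> carrier (ob Y M)"
  by (rule smod_hom_closed[OF C_hom])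

lemma C_aqeq: "aqeq zz s t \<Longrightarrow> C s = C t"
  by (simp add: C_def[abs_def] aqeq_cls)

lemma C_rel: "(s, t) \<in> AQ_rels zz \<Longrightarrow> C s = C t"
  by (intro C_aqeq aqeq.rel)

lemma C_cmp:
  assumes s: "homog s Y Z r" and t: "homog t X Y r'" and M: "obj M" and x: "x \<in> carrier (ob X M)"
  shows "C (s \<bullet> t) M x = C s M (C t M x)"
proof -
  obtain \<beta> where b: "amap F (cls zz s) = (omap F Y, \<beta>, omap F Z)" "\<beta> M = (ob Y M, C s M, ob Z M)"
    using amap_homog[OF s] M by blast
  obtain \<alpha> where a: "amap F (cls zz t) = (omap F X, \<alpha>, omap F Y)" "\<alpha> M = (ob X M, C t M, ob Y M)"
    using amap_homog[OF t] M by blast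
  note ty = homog_typed[OF s] homog_typed[OF t]
  have "amap F (cmp (AQ zz) g f) = cmp (SEnd CC) (amap F g) (amap F f)"
    if "g \<in> carrier (homs (AQ zz) Y Z)" "f \<in> carrier (homs (AQ zz) X Y)" for g f
    using sfF that unfolding superfunctor_def by (simp del: AQ_simps(5))
  from this[of "cls zz s" "cls zz t"]
  have "amap F (cls zz (s \<bullet> t)) = cmp (SEnd CC) (amap F (cls zz s)) (amap F (cls zz t))"
    using ty by (auto simp: AQ_cmp[OF ty])
  then show ?thesis
    using M x by (simp add: C_def[of "s \<bullet> t"] component_def a b SEnd_def compose_def)
qed

lemma amap_Id: "amap F (cls zz (Id X)) = (omap F X, \<lambda>M\<in>obs CC. ide CC (ob X M), omap F X)"
  using sfF by (simp add: superfunctor_def SEnd_def ob_def)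

lemma C_Id: "obj M \<Longrightarrow> x \<in> carrier (ob X M) \<Longrightarrow> C (Id X) M x = x"
  by (simp add: C_def component_def amap_Id)

lemma amap_tens:
  assumes "homog s X Y r" "homog t X' Y' r'"
  shows "amap F (cls zz (s \<boxtimes> t)) = tens_ar (SEnd CC) (amap F (cls zz s)) (amap F (cls zz t))"
proof -
  note ty = homog_typed[OF assms(1)] homog_typed[OF assms(2)]
  show ?thesis
    using monF AQ_arrows[OF ty(1), of zz] AQ_arrows[OF ty(2), of zz]
    unfolding strict_monoidal_superfunctor_def AQ_tens[OF ty, symmetric] by blast
qed

definition dmat :: "dir \<Rightarrow> int \<Rightarrow> int \<Rightarrow> int \<Rightarrow> int \<Rightarrow> Cq" where
  "dmat d = (case d of Up \<Rightarrow> V_mat n \<rho> | Down \<Rightarrow> Vdual_mat n S \<rho>)"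

lemma tfF: "tensor_functor n (dmat d) (omap F [d])"
  using Fhat by (cases d) (simp_all add: is_Fhat_def dmat_def)

lemma ob_tensor: "obj M \<Longrightarrow> is_tensor n (dmat d) M (ob [d] M)"
  using tfF by (simp add: tensor_functor_def ob_def)

lemma carrier_ob: "obj M \<Longrightarrow> carrier (ob [d] M) = Tup ` (I \<rightarrow>\<^sub>E carrier M)"
  using ob_tensor[of M d] by (simp add: is_tensor_def)

lemma coord_closed: "obj M \<Longrightarrow> x \<in> carrier (ob [d] M) \<Longrightarrow> i \<in> I \<Longrightarrow> coord x i \<in> carrier M"
  by (auto simp: carrier_ob)

lemma Tup_closed: "obj M \<Longrightarrow> (\<And>i. i \<in> I \<Longrightarrow> f i \<in> carrier M) \<Longrightarrow> Tup (\<lambda>i\<in>I. f i) \<in> carrier (ob [d] M)"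
  by (simp add: carrier_ob)

lemma ob_eqI:
  assumes "obj M" "x \<in> carrier (ob [d] M)" "y \<in> carrier (ob [d] M)" "\<And>i. i \<in> I \<Longrightarrow> coord x i = coord y i"
  shows "x = y"
proof -
  from assms obtain c c' where c: "x = Tup c" "c \<in> I \<rightarrow>\<^sub>E carrier M" "y = Tup c'" "c' \<in> I \<rightarrow>\<^sub>E carrier M"
    by (auto simp: carrier_ob)
  then have "c = c'" using assms(4) by (intro PiE_ext[OF c(2,4)]) simp
  then show ?thesis using c by simp
qed

lemma coord_add: "obj M \<Longrightarrow> x \<in> carrier (ob [d] M) \<Longrightarrow> y \<in> carrier (ob [d] M) \<Longrightarrow> i \<in> I \<Longrightarrow>
    coord (x \<oplus>\<^bsub>ob [d] M\<^esub> y) i = coord x i \<oplus>\<^bsub>M\<^esub> coord y i"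
  using ob_tensor[of M d] by (simp add: is_tensor_def)

lemma coord_zero: "obj M \<Longrightarrow> i \<in> I \<Longrightarrow> coord \<zero>\<^bsub>ob [d] M\<^esub> i = \<zero>\<^bsub>M\<^esub>"
  using ob_tensor[of M d] by (simp add: is_tensor_def)

lemma coord_smult: "obj M \<Longrightarrow> x \<in> carrier (ob [d] M) \<Longrightarrow> i \<in> I \<Longrightarrow>
    coord (a \<odot>\<^bsub>ob [d] M\<^esub> x) i = a \<odot>\<^bsub>M\<^esub> coord x i"
  using ob_tensor[of M d] by (simp add: is_tensor_def)

lemma coord_finsum:
  assumes M: "obj M" and i: "i \<in> I"
  shows "finite A \<Longrightarrow> (\<And>a. a \<in> A \<Longrightarrow> f a \<in> carrier (ob [d] M)) \<Longrightarrow>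
    coord (\<Oplus>\<^bsub>ob [d] M\<^esub>a\<in>A. f a) i = (\<Oplus>\<^bsub>M\<^esub>a\<in>A. coord (f a) i)"
proof (induction A rule: finite_induct)
  interpret M: abelian_group M using M by (rule supermodule_abelian)
  interpret P: abelian_group "ob [d] M" using M by (intro supermodule_abelian[of n] ob_obj)
  { case empty then show ?case using M i by (simp add: coord_zero) }
  { case (insert a A)
    then have c: "coord (f b) i \<in> carrier M" if "b \<in> insert a A" for b
      using M i that by (intro coord_closed) auto
    then have "(\<Oplus>\<^bsub>M\<^esub>a\<in>insert a A. coord (f a) i) = coord (f a) i \<oplus>\<^bsub>M\<^esub> (\<Oplus>\<^bsub>M\<^esub>a\<in>A. coord (f a) i)"
      using insert by (intro M.finsum_insert) auto
    then show ?case using insert M i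
      by (simp add: P.finsum_insert coord_add P.finsum_closed Pi_def) }
qed

lemma smult_ob_closed: "obj M \<Longrightarrow> x \<in> carrier M \<Longrightarrow> a \<odot>\<^bsub>M\<^esub> x \<in> carrier M"
  using module.smult_closed[OF supermodule_module, of n M a x] by simp

lemma smult_ob_one: "obj M \<Longrightarrow> x \<in> carrier M \<Longrightarrow> 1 \<odot>\<^bsub>M\<^esub> x = x"
  using module.smult_one[OF supermodule_module, of n M x] by simp

text \<open>The factor \<open>Id [d]\<close> contributes an identity, and the tensor functor applies
  an even map to each coordinate without sign.\<close>

lemma C_Id_tens:
  assumes t: "homog t X Y 0" and M: "obj M" and x: "x \<in> carrier (ob [d] (ob X M))"
  shows "C (Id [d] \<boxtimes> t) M x = Tup (\<lambda>i\<in>I. C t M (coord x i))"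
proof -
  obtain \<beta> where b: "amap F (cls zz t) = (omap F X, \<beta>, omap F Y)" "\<beta> M = (ob X M, C t M, ob Y M)"
    and h: "smod_hom n 0 (ob X M) (ob Y M) (C t M)"
    using amap_homog[OF t] M by blast
  have a: "amap (omap F [d]) (ob X M, C t M, ob Y M) =
      (ob [d] (ob X M), \<lambda>x\<in>carrier (ob [d] (ob X M)). Tup (\<lambda>i\<in>I. ksgn (0 * p i) \<odot>\<^bsub>ob Y M\<^esub> C t M (coord x i)), ob [d] (ob Y M))"
    using tfF[of d] h M unfolding tensor_functor_def ob_def[of "[d]"] by simp
  have c: "coord x i \<in> carrier (ob X M)" if "i \<in> I" for i
    using coord_closed[OF _ x that] M by simp
  have e: "Tup (\<lambda>i\<in>I. ksgn (0 * p i) \<odot>\<^bsub>ob Y M\<^esub> C t M (coord x i)) = Tup (\<lambda>i\<in>I. C t M (coord x i))"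
    using c M by (intro arg_cong[where f = Tup] restrict_ext) (simp add: smult_ob_one smod_hom_closed[OF h])
  have f: "Tup (\<lambda>i\<in>I. C t M (coord x i)) \<in> carrier (ob [d] (ob Y M))"
    using c M by (intro Tup_closed) (auto intro: smod_hom_closed[OF h])
  have "homog (Id [d]) [d] [d] 0" by (rule homog.intros)
  from amap_tens[OF this t] show ?thesis
    using M x f
    by (simp add: C_def[of "Id [d] \<boxtimes> t"] component_def b amap_Id SEnd_def ob_def[symmetric] a[unfolded e] e compose_def del: mult_zero_left)
qed

text \<open>In \<open>tens_ar\<close> the transformation on the left is taken at the value of the
  functor on the right, and \<open>omap F X\<close> preserves the identity supplied by
  \<open>Id Z\<close>.\<close>

lemma C_tens_Id:
  assumes s: "homog s X Y r" and M: "obj M" and x: "x \<in> carrier (ob X (ob Z M))"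
  shows "C (s \<boxtimes> Id Z) M x = C s (ob Z M) x"
proof -
  obtain \<alpha> where a: "amap F (cls zz s) = (omap F X, \<alpha>, omap F Y)"
    "\<alpha> (ob Z M) = (ob X (ob Z M), C s (ob Z M), ob Y (ob Z M))"
    using amap_homog[OF s] ob_obj[OF M] by blast
  have i: "amap (omap F X) (ide CC N) = ide CC (ob X N)" if "obj N" for N
    using endoF[of X] that by (simp add: endofunctor_def superfunctor_def ob_def del: ide_Smod)
  have "homog (Id Z) Z Z 0" by (rule homog.intros)
  from amap_tens[OF s this] show ?thesis
    using M x i[OF ob_obj[OF M, of Z]]
    by (simp add: C_def[of "s \<boxtimes> Id Z"] component_def a amap_Id SEnd_def ob_def[symmetric] compose_def)
qed

lemma
  assumes "obj M"
  shows C_UPlus: "x \<in> carrier (ob [Up, Up] M) \<Longrightarrow> C (Gen UPlus) M x = T_tensor n M x"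
    and C_CapL: "x \<in> carrier (ob [Down, Up] M) \<Longrightarrow> C (Gen CapL) M x = ev_tensor n M x"
    and C_CDot: "x \<in> carrier (ob [Up] M) \<Longrightarrow> C (Gen CDot) M x = J_tensor n M x"
    and C_ODot: "x \<in> carrier (ob [Up] M) \<Longrightarrow> C (Gen ODot) M x = o_op n M x"
  using Fhat assms by (auto simp: is_Fhat_def C_def ob_def)

section \<open>Cups and the bubble\<close>

lemma bubble_types:
  "homog (Id X) X X 0"
  "homog (Gen CapL \<boxtimes> Id [Down]) [Down, Up, Down] [Down] 0"
  "homog (Id [Down] \<boxtimes> Gen CupL) [Down] [Down, Up, Down] 0"
  "homog (Id [Up] \<boxtimes> Gen CupL) [Up] [Up, Up, Down] 0"
  "homog (Id [Down] \<boxtimes> Id [Up] \<boxtimes> Gen CupL) [Down, Up] [Down, Up, Up, Down] 0"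
  "homog (Gen UPlus \<boxtimes> Id [Down]) [Up, Up, Down] [Up, Up, Down] 0"
  "homog (Id [Down] \<boxtimes> Gen UPlus \<boxtimes> Id [Down]) [Down, Up, Up, Down] [Down, Up, Up, Down] 0"
  "homog (Gen CapL \<boxtimes> Id [Up] \<boxtimes> Id [Down]) [Down, Up, Up, Down] [Up, Down] 0"
proof -
  show i: "homog (Id X) X X 0" for X by (rule homog.intros)
  show "homog (Gen CapL \<boxtimes> Id [Down]) [Down, Up, Down] [Down] 0"
    by (rule homog_tens[OF homog_gen(3) i]) simp_all
  show "homog (Id [Down] \<boxtimes> Gen CupL) [Down] [Down, Up, Down] 0"
    by (rule homog_tens[OF i homog_gen(4)]) simp_all
  show a: "homog (Id [Up] \<boxtimes> Gen CupL) [Up] [Up, Up, Down] 0"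
    by (rule homog_tens[OF i homog_gen(4)]) simp_all
  show "homog (Id [Down] \<boxtimes> Id [Up] \<boxtimes> Gen CupL) [Down, Up] [Down, Up, Up, Down] 0"
    by (rule homog_tens[OF i a]) simp_all
  show b: "homog (Gen UPlus \<boxtimes> Id [Down]) [Up, Up, Down] [Up, Up, Down] 0"
    by (rule homog_tens[OF homog_gen(1) i]) simp_all
  show "homog (Id [Down] \<boxtimes> Gen UPlus \<boxtimes> Id [Down]) [Down, Up, Up, Down] [Down, Up, Up, Down] 0"
    by (rule homog_tens[OF i b]) simp_all
  have "homog (Id [Up] \<boxtimes> Id [Down]) [Up, Down] [Up, Down] 0"
    by (rule homog_tens[OF i i]) simp_all
  then show "homog (Gen CapL \<boxtimes> Id [Up] \<boxtimes> Id [Down]) [Down, Up, Up, Down] [Up, Down] 0"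
    by (rule homog_tens[OF homog_gen(3)]) simp_all
qed

text \<open>The pure tensor of the \<open>b\<close>-th basis vector with \<open>m\<close>, in
  \<open>V \<otimes> M\<close> as well as in \<open>V^* \<otimes> M\<close>.\<close>

definition delta :: "'a vect supermod \<Rightarrow> int \<Rightarrow> 'a vect \<Rightarrow> 'a vect" where
  "delta M b m = Tup (\<lambda>i\<in>I. if i = b then m else \<zero>\<^bsub>M\<^esub>)"

lemma zero_closed: "obj M \<Longrightarrow> \<zero>\<^bsub>M\<^esub> \<in> carrier M"
  using abelian_group.axioms(1)[OF supermodule_abelian] abelian_monoid.zero_closed by blast

lemma delta_closed: "obj M \<Longrightarrow> m \<in> carrier M \<Longrightarrow> delta M b m \<in> carrier (ob [d] M)"
  unfolding delta_def by (rule Tup_closed) (auto simp: zero_closed)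

text \<open>Apply the second zigzag relation to \<open>v\<^sub>b\<^sup>* \<otimes> m\<close>.\<close>

lemma C_CupL:
  assumes M: "obj M" and m: "m \<in> carrier M"
  shows "C (Gen CupL) M m = Tup (\<lambda>b\<in>I. delta M b m)"
proof (rule ob_eqI)
  let ?D = "ob [Down] M"
  have D: "obj ?D" using M by simp
  then show "obj ?D" .
  have e: "ob [Up, Down] M = ob [Up] ?D" using M by (rule ob_Cons)
  show c: "C (Gen CupL) M m \<in> carrier (ob [Up] ?D)"
    using C_closed[OF homog_gen(4) M] M m by (simp add: e)
  show "Tup (\<lambda>b\<in>I. delta M b m) \<in> carrier (ob [Up] ?D)"
    using D M m by (intro Tup_closed delta_closed)
  fix b assume b: "b \<in> I"
  interpret DM: abelian_group ?D using D by (rule supermodule_abelian)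
  have x: "delta M b m \<in> carrier ?D" using M m by (rule delta_closed)
  \<comment> \<open>All coordinates of the test vector except the \<open>b\<close>-th are zero;
    their cups have to vanish too.\<close>
  have z: "C (Gen CupL) M \<zero>\<^bsub>M\<^esub> = \<zero>\<^bsub>ob [Up] ?D\<^esub>"
    using smod_hom_zero[OF _ _ C_hom[OF homog_gen(4) M]] M by (simp add: e)
  let ?w = "Tup (\<lambda>i\<in>I. C (Gen CupL) M (coord (delta M b m) i))"
  have w: "C (Id [Down] \<boxtimes> Gen CupL) M (delta M b m) = ?w"
    using M x by (intro C_Id_tens[OF homog_gen(4) M]) simp
  have wc: "?w \<in> carrier (ob [Down, Up, Down] M)"
    unfolding w[symmetric] using x by (rule C_closed[OF bubble_types(3) M])
  have f: "ob [Down, Up] ?D = ob [Down, Up, Down] M" using ob_append[OF M, of "[Down, Up]" "[Down]"] by simp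
  have "delta M b m = C (Id [Down]) M (delta M b m)" using C_Id[OF M x] by simp
  also have "\<dots> = C ((Gen CapL \<boxtimes> Id [Down]) \<bullet> (Id [Down] \<boxtimes> Gen CupL)) M (delta M b m)"
    by (subst C_rel[of "(Gen CapL \<boxtimes> Id [Down]) \<bullet> (Id [Down] \<boxtimes> Gen CupL)" "Id [Down]"])
      (auto simp: AQ_rels_def Q_rels_def)
  also have "\<dots> = C (Gen CapL \<boxtimes> Id [Down]) M ?w"
    using C_cmp[OF bubble_types(2,3) M x] w by simp
  also have "\<dots> = C (Gen CapL) ?D ?w"
    using wc M by (intro C_tens_Id[OF homog_gen(3)]) (simp_all add: f)
  also have "\<dots> = ev_tensor n ?D ?w"
    using D wc by (intro C_CapL) (simp_all add: f)
  \<comment> \<open>The evaluation pairs \<open>v_b^*\<close> with the outer factor of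
    \<open>cup_L(m)\<close> and thus reads off its \<open>b\<close>-th coordinate.\<close>
  also have "\<dots> = (\<Oplus>\<^bsub>?D\<^esub>i\<in>I. if i = b then coord (C (Gen CupL) M m) b else \<zero>\<^bsub>?D\<^esub>)"
    unfolding ev_tensor_def
  proof (rule DM.finsum_cong')
    show "(\<lambda>i. if i = b then coord (C (Gen CupL) M m) b else \<zero>\<^bsub>?D\<^esub>) \<in> I \<rightarrow> carrier ?D"
      using coord_closed[OF D c b] by auto
    fix i assume "i \<in> I"
    then show "coord (coord ?w i) i = (if i = b then coord (C (Gen CupL) M m) b else \<zero>\<^bsub>?D\<^esub>)"
      using D by (simp add: delta_def z coord_zero)
  qed simp
  also have "\<dots> = coord (C (Gen CupL) M m) b"
    using coord_closed[OF D c b] b by (intro DM.finsum_delta) auto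
  finally show "coord (C (Gen CupL) M m) b = coord (Tup (\<lambda>b\<in>I. delta M b m)) b"
    using b by simp
qed

text \<open>The value of \<open>cup\<^sub>R\<close>, to be recognised as a preimage of \<open>cup\<^sub>L\<close> under \<open>l\<^sup>+\<close>.\<close>

definition rcup :: "'a vect supermod \<Rightarrow> 'a vect \<Rightarrow> 'a vect" where
  "rcup M m = Tup (\<lambda>a\<in>I. delta M a (wt n a \<odot>\<^bsub>M\<^esub> m))"

lemma rcup_closed: "obj M \<Longrightarrow> m \<in> carrier M \<Longrightarrow> rcup M m \<in> carrier (ob [Down] (ob [Up] M))"
  unfolding rcup_def by (intro Tup_closed delta_closed smult_ob_closed) auto

text \<open>The equation that the coefficients of \<open>cup_R\<close> have to satisfy. After a
  comparison of signs it is the system that \<open>wt\<close> solves for the partial trace of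
  \<open>P R\<close>.\<close>

lemma Tmat_sum:
  assumes "e \<in> I" "c \<in> I"
  shows "(\<Sum>a\<in>I. Tmat a e a c * wt n a) = (if e = c then 1 else 0)"
proof (cases "e = c")
  case True
  have "Tmat a e a c * wt n a = wt n a * (ksgn (p a * p e + (p e + p a) * (p e + p c) + (p a + p c) * p a) * Theta a c e a)" for a
    unfolding Tmat_def True pp_def by (simp add: ksgn_add ac_simps)
  then have "(\<Sum>a\<in>I. Tmat a e a c * wt n a)
    = (\<Sum>a\<in>I. wt n a * (ksgn (p a * p e + (p e + p a) * (p e + p c) + (p a + p c) * p a) * Theta a c e a))"
    by (simp only:)
  then show ?thesis using Theta_sum_wt[OF assms] by (simp only:)
next
  case False
  then have "Tmat a e a c = 0" if "a \<in> I" for a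
    using that by (auto simp: Tmat_def Theta_def E_def Idx_def)
  then show ?thesis using False by simp
qed

text \<open>After cup, crossing and evaluation, the coefficient of
  \<open>v_e \<otimes> v_c^*\<close> is the sum over \<open>a\<close> of
  \<open>Tmat a e a c * wt n a\<close>, which by \<open>Tmat_sum\<close> is its coefficient in
  \<open>cup_L\<close>.\<close>

lemma C_lplus:
  assumes M: "obj M" and m: "m \<in> carrier M"
  shows "C lplus M (rcup M m) = C (Gen CupL) M m"
proof -
  let ?D = "ob [Down] M" and ?U = "ob [Up] M"
  have D: "obj ?D" and U: "obj ?U" using M by simp_all
  interpret M: abelian_group M using M by (rule supermodule_abelian)
  interpret MM: Module.module kring M using M by (rule supermodule_module)
  interpret DM: abelian_group ?D using D by (rule supermodule_abelian)
  \<comment> \<open>The coefficient of \<open>v_a^* \<otimes> v_b\<close> in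
    \<open>rcup M m\<close>.\<close>
  define x where "x a b = (if b = a then wt n a \<odot>\<^bsub>M\<^esub> m else \<zero>\<^bsub>M\<^esub>)" for a b
  have x: "x a b \<in> carrier M" for a b using M m by (auto simp: x_def intro: smult_ob_closed)
  have ob2: "ob [Down, Up] M = ob [Down] ?U" using ob_Cons[OF M] .
  have ob3: "ob [Up, Up, Down] M = ob [Up] (ob [Up] ?D)" using ob_Cons[OF M] by simp
  have ob4: "ob [Down, Up, Up, Down] M = ob [Down] (ob [Up, Up, Down] M)" by (rule ob_Cons[OF M])
  have ob5: "ob [Up, Up] ?D = ob [Up, Up, Down] M" using ob_append[OF M, of "[Up, Up]" "[Down]"] by simp
  have ob6: "ob [Down, Up] (ob [Up, Down] M) = ob [Down, Up, Up, Down] M"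
    using ob_append[OF M, of "[Down, Up]" "[Up, Down]"] by simp
  have ob7: "ob [Up, Down] M = ob [Up] ?D" by (rule ob_Cons[OF M])
  note r = rcup_closed[OF M m]
  define x1 where "x1 = Tup (\<lambda>a\<in>I. Tup (\<lambda>b\<in>I. C (Gen CupL) M (x a b)))"
  have s1: "C (Id [Down] \<boxtimes> Id [Up] \<boxtimes> Gen CupL) M (rcup M m) = x1"
  proof -
    have "C (Id [Down] \<boxtimes> Id [Up] \<boxtimes> Gen CupL) M (rcup M m) = Tup (\<lambda>a\<in>I. C (Id [Up] \<boxtimes> Gen CupL) M (coord (rcup M m) a))"
      using r by (intro C_Id_tens[OF bubble_types(4) M])
    also have "\<dots> = x1"
      unfolding x1_def
    proof (intro arg_cong[where f = Tup] restrict_ext)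
      fix a assume a: "a \<in> I"
      have c: "coord (rcup M m) a = delta M a (wt n a \<odot>\<^bsub>M\<^esub> m)" using a by (simp add: rcup_def)
      have "delta M a (wt n a \<odot>\<^bsub>M\<^esub> m) \<in> carrier (ob [Up] (ob [] M))"
        using M m by (auto intro!: delta_closed smult_ob_closed)
      from C_Id_tens[OF homog_gen(4) M this]
      show "C (Id [Up] \<boxtimes> Gen CupL) M (coord (rcup M m) a) = Tup (\<lambda>b\<in>I. C (Gen CupL) M (x a b))"
        unfolding c by (simp add: delta_def x_def cong: restrict_cong)
    qed
    finally show ?thesis .
  qed
  have x1c: "x1 \<in> carrier (ob [Down, Up, Up, Down] M)"
    unfolding s1[symmetric] using r by (intro C_closed[OF bubble_types(5) M]) (simp add: ob2)
  define x2 where "x2 = Tup (\<lambda>a\<in>I. T_tensor n ?D (coord x1 a))"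
  have x1a: "coord x1 a \<in> carrier (ob [Up, Up, Down] M)" if "a \<in> I" for a
    using x1c that M unfolding ob4 by (intro coord_closed[of "ob [Up, Up, Down] M" x1 Down]) simp_all
  have s2: "C (Id [Down] \<boxtimes> Gen UPlus \<boxtimes> Id [Down]) M x1 = x2"
  proof -
    have "C (Id [Down] \<boxtimes> Gen UPlus \<boxtimes> Id [Down]) M x1 = Tup (\<lambda>a\<in>I. C (Gen UPlus \<boxtimes> Id [Down]) M (coord x1 a))"
      using x1c by (intro C_Id_tens[OF bubble_types(6) M]) (simp add: ob4)
    also have "\<dots> = x2"
      unfolding x2_def
    proof (intro arg_cong[where f = Tup] restrict_ext)
      fix a assume a: "a \<in> I"
      have "C (Gen UPlus \<boxtimes> Id [Down]) M (coord x1 a) = C (Gen UPlus) ?D (coord x1 a)"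
        using x1a[OF a] by (intro C_tens_Id[OF homog_gen(1) M]) (simp add: ob5)
      also have "\<dots> = T_tensor n ?D (coord x1 a)"
        using x1a[OF a] by (intro C_UPlus D) (simp add: ob5)
      finally show "C (Gen UPlus \<boxtimes> Id [Down]) M (coord x1 a) = T_tensor n ?D (coord x1 a)" .
    qed
    finally show ?thesis .
  qed
  have x2c: "x2 \<in> carrier (ob [Down, Up, Up, Down] M)"
    unfolding s2[symmetric] using x1c by (rule C_closed[OF bubble_types(7) M])
  have s3: "C (Gen CapL \<boxtimes> Id [Up] \<boxtimes> Id [Down]) M x2 = ev_tensor n (ob [Up, Down] M) x2"
  proof -
    have ty: "typed (Gen CapL) [Down, Up] []" by (rule homog_typed[OF homog_gen(3)])
    \<comment> \<open>The two identities are merged into one, so that \<open>C_tens_Id\<close>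
      becomes applicable.\<close>
    have "aqeq zz (Gen CapL \<boxtimes> Id [Up] \<boxtimes> Id [Down]) (Gen CapL \<boxtimes> Id ([Up] @ [Down]))"
      by (intro aqeq.tens_cong aqeq.tens_id aqeq.refl[OF ty])
    then have "C (Gen CapL \<boxtimes> Id [Up] \<boxtimes> Id [Down]) M x2 = C (Gen CapL \<boxtimes> Id [Up, Down]) M x2"
      by (simp add: C_aqeq)
    also have "\<dots> = C (Gen CapL) (ob [Up, Down] M) x2"
      using x2c by (intro C_tens_Id[OF homog_gen(3) M]) (simp add: ob6)
    also have "\<dots> = ev_tensor n (ob [Up, Down] M) x2"
      using x2c M by (intro C_CapL) (simp_all add: ob6)
    finally show ?thesis .
  qed
  have ba: "homog ((Id [Down] \<boxtimes> Gen UPlus \<boxtimes> Id [Down]) \<bullet> (Id [Down] \<boxtimes> Id [Up] \<boxtimes> Gen CupL)) [Down, Up] [Down, Up, Up, Down] 0"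
    by (rule homog_cmp[OF bubble_types(7,5)]) simp
  have rc: "rcup M m \<in> carrier (ob [Down, Up] M)" using r by (simp add: ob2)
  have l: "C lplus M (rcup M m) = ev_tensor n (ob [Up, Down] M) x2"
    unfolding lplus_def C_cmp[OF bubble_types(8) ba M rc] C_cmp[OF bubble_types(7,5) M rc] s1 s2 s3 ..
  have lc: "C lplus M (rcup M m) \<in> carrier (ob [Up] ?D)"
    unfolding lplus_def C_cmp[OF bubble_types(8) ba M rc] C_cmp[OF bubble_types(7,5) M rc] s1 s2
    using C_closed[OF bubble_types(8) M x2c] by (simp add: ob7)
  show ?thesis
  proof (rule ob_eqI[OF D lc])
    show "C (Gen CupL) M m \<in> carrier (ob [Up] ?D)"
      using C_closed[OF homog_gen(4) M] M m by (simp add: ob7)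
    fix e assume e: "e \<in> I"
    have x2a: "coord x2 a \<in> carrier (ob [Up] (ob [Up] ?D))" if "a \<in> I" for a
      using x2c that M unfolding ob4 ob3[symmetric] by (intro coord_closed[of "ob [Up, Up, Down] M" x2 Down]) simp_all
    have x2aa: "coord (coord x2 a) a \<in> carrier (ob [Up] ?D)" if "a \<in> I" for a
      using coord_closed[OF _ x2a[OF that] that] D by simp
    \<comment> \<open>The cup to the right of \<open>v_b\<close> contributes
      \<open>v_d \<otimes> v_d^*\<close>, the crossing takes \<open>v_b \<otimes> v_d\<close> to
      \<open>v_a \<otimes> v_e\<close> with coefficient \<open>Tmat a e b d\<close>, and
      \<open>v_a\<close> is the vector that will be paired with \<open>v_a^*\<close>.\<close>
    have x2e: "coord (coord (coord x2 a) a) e = (\<Oplus>\<^bsub>?D\<^esub>b\<in>I. \<Oplus>\<^bsub>?D\<^esub>d\<in>I. Tmat a e b d \<odot>\<^bsub>?D\<^esub> delta M d (x a b))"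
      if a: "a \<in> I" for a
    proof -
      have "coord (coord (coord x2 a) a) e = (\<Oplus>\<^bsub>?D\<^esub>b\<in>I. \<Oplus>\<^bsub>?D\<^esub>d\<in>I. Tmat a e b d \<odot>\<^bsub>?D\<^esub> coord (coord (coord x1 a) b) d)"
        using a e by (simp add: x2_def T_tensor_def)
      also have "\<dots> = (\<Oplus>\<^bsub>?D\<^esub>b\<in>I. \<Oplus>\<^bsub>?D\<^esub>d\<in>I. Tmat a e b d \<odot>\<^bsub>?D\<^esub> delta M d (x a b))"
      proof (intro DM.finsum_cong' refl)
        show "(\<lambda>b. \<Oplus>\<^bsub>?D\<^esub>d\<in>I. Tmat a e b d \<odot>\<^bsub>?D\<^esub> delta M d (x a b)) \<in> I \<rightarrow> carrier ?D"
          by (intro Pi_I DM.finsum_closed smult_ob_closed[OF D] delta_closed[OF M] x)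
        fix b assume b: "b \<in> I"
        show "(\<lambda>d. Tmat a e b d \<odot>\<^bsub>?D\<^esub> delta M d (x a b)) \<in> I \<rightarrow> carrier ?D"
          by (intro Pi_I smult_ob_closed[OF D] delta_closed[OF M] x)
        fix d assume d: "d \<in> I"
        show "Tmat a e b d \<odot>\<^bsub>?D\<^esub> coord (coord (coord x1 a) b) d = Tmat a e b d \<odot>\<^bsub>?D\<^esub> delta M d (x a b)"
          using a b d by (simp add: x1_def C_CupL[OF M x])
      qed simp_all
      finally show ?thesis .
    qed
    have le: "coord (C lplus M (rcup M m)) e = (\<Oplus>\<^bsub>?D\<^esub>a\<in>I. coord (coord (coord x2 a) a) e)"
      unfolding l ev_tensor_def ob7 using e x2aa by (intro coord_finsum[OF D]) auto
    have lec: "coord (C lplus M (rcup M m)) e \<in> carrier ?D"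
      using coord_closed[OF D lc e] .
    show "coord (C lplus M (rcup M m)) e = coord (C (Gen CupL) M m) e"
    proof (rule ob_eqI[OF M lec])
      show "coord (C (Gen CupL) M m) e \<in> carrier ?D"
        using e M m by (simp add: C_CupL delta_closed)
      fix c assume c: "c \<in> I"
      \<comment> \<open>Two indices are pinned: \<open>b = a\<close> because \<open>rcup\<close> is
        diagonal, and \<open>d = c\<close> by the coordinate that is read off.\<close>
      have inner: "coord (\<Oplus>\<^bsub>?D\<^esub>b\<in>I. \<Oplus>\<^bsub>?D\<^esub>d\<in>I. Tmat a e b d \<odot>\<^bsub>?D\<^esub> delta M d (x a b)) c = (Tmat a e a c * wt n a) \<odot>\<^bsub>M\<^esub> m"
        if a: "a \<in> I" for a
      proof -
        have dc: "Tmat a e b d \<odot>\<^bsub>?D\<^esub> delta M d (x a b) \<in> carrier ?D" for b d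
          by (intro smult_ob_closed[OF D] delta_closed[OF M] x)
        have "coord (\<Oplus>\<^bsub>?D\<^esub>b\<in>I. \<Oplus>\<^bsub>?D\<^esub>d\<in>I. Tmat a e b d \<odot>\<^bsub>?D\<^esub> delta M d (x a b)) c
          = (\<Oplus>\<^bsub>M\<^esub>b\<in>I. coord (\<Oplus>\<^bsub>?D\<^esub>d\<in>I. Tmat a e b d \<odot>\<^bsub>?D\<^esub> delta M d (x a b)) c)"
          by (intro coord_finsum[OF M c]) (auto intro!: DM.finsum_closed dc)
        also have "\<dots> = (\<Oplus>\<^bsub>M\<^esub>b\<in>I. if b = a then (Tmat a e a c * wt n a) \<odot>\<^bsub>M\<^esub> m else \<zero>\<^bsub>M\<^esub>)"
        proof (rule M.finsum_cong')
          show "(\<lambda>b. if b = a then (Tmat a e a c * wt n a) \<odot>\<^bsub>M\<^esub> m else \<zero>\<^bsub>M\<^esub>) \<in> I \<rightarrow> carrier M"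
            using smult_ob_closed[OF M m] by auto
          fix b assume b: "b \<in> I"
          have "coord (\<Oplus>\<^bsub>?D\<^esub>d\<in>I. Tmat a e b d \<odot>\<^bsub>?D\<^esub> delta M d (x a b)) c
            = (\<Oplus>\<^bsub>M\<^esub>d\<in>I. coord (Tmat a e b d \<odot>\<^bsub>?D\<^esub> delta M d (x a b)) c)"
            by (intro coord_finsum[OF M c]) (auto intro!: dc)
          also have "\<dots> = (\<Oplus>\<^bsub>M\<^esub>d\<in>I. if c = d then Tmat a e b d \<odot>\<^bsub>M\<^esub> x a b else \<zero>\<^bsub>M\<^esub>)"
          proof (rule M.finsum_cong')
            show "(\<lambda>d. if c = d then Tmat a e b d \<odot>\<^bsub>M\<^esub> x a b else \<zero>\<^bsub>M\<^esub>) \<in> I \<rightarrow> carrier M"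
              using smult_ob_closed[OF M x] by auto
            fix d assume "d \<in> I"
            show "coord (Tmat a e b d \<odot>\<^bsub>?D\<^esub> delta M d (x a b)) c = (if c = d then Tmat a e b d \<odot>\<^bsub>M\<^esub> x a b else \<zero>\<^bsub>M\<^esub>)"
              unfolding coord_smult[OF M delta_closed[OF M x] c] using c
              by (simp add: delta_def MM.smult_r_null)
          qed simp
          also have "\<dots> = Tmat a e b c \<odot>\<^bsub>M\<^esub> x a b"
            using c smult_ob_closed[OF M x] by (intro M.finsum_delta) auto
          also have "\<dots> = (if b = a then (Tmat a e a c * wt n a) \<odot>\<^bsub>M\<^esub> m else \<zero>\<^bsub>M\<^esub>)"
            using m MM.smult_assoc1[of "Tmat a e a c" "wt n a" m] by (simp add: x_def MM.smult_r_null)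
          finally show "coord (\<Oplus>\<^bsub>?D\<^esub>d\<in>I. Tmat a e b d \<odot>\<^bsub>?D\<^esub> delta M d (x a b)) c
            = (if b = a then (Tmat a e a c * wt n a) \<odot>\<^bsub>M\<^esub> m else \<zero>\<^bsub>M\<^esub>)" .
        qed simp
        also have "\<dots> = (Tmat a e a c * wt n a) \<odot>\<^bsub>M\<^esub> m"
          using a smult_ob_closed[OF M m] by (intro M.finsum_delta) auto
        finally show ?thesis .
      qed
      have "coord (coord (C lplus M (rcup M m)) e) c = (\<Oplus>\<^bsub>M\<^esub>a\<in>I. coord (coord (coord (coord x2 a) a) e) c)"
        unfolding le using c x2aa coord_closed[OF D _ e] by (intro coord_finsum[OF M]) auto
      also have "\<dots> = (\<Oplus>\<^bsub>M\<^esub>a\<in>I. (Tmat a e a c * wt n a) \<odot>\<^bsub>M\<^esub> m)"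
        using smult_ob_closed[OF M m] by (intro M.finsum_cong') (auto simp: x2e inner)
      also have "\<dots> = (if e = c then 1 else 0) \<odot>\<^bsub>M\<^esub> m"
        unfolding Tmat_sum[OF e c, symmetric] using supermodule_module[OF M] m by (intro sum_smult[symmetric]) auto
      also have "\<dots> = coord (coord (C (Gen CupL) M m) e) c"
        using e c m M MM.smult_l_null[OF m] by (auto simp: C_CupL delta_def smult_ob_one)
      finally show "coord (coord (C lplus M (rcup M m)) e) c = coord (coord (C (Gen CupL) M m) e) c" .
    qed
  qed
qed

text \<open>\<open>r^-\<close> is a left inverse of \<open>l^+\<close>, so it takes
  \<open>cup_L\<close>, the image of \<open>rcup\<close> under \<open>l^+\<close>, back to
  \<open>rcup\<close>.\<close>

lemma C_cupR:
  assumes M: "obj M" and m: "m \<in> carrier M"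
  shows "C cupR M m = rcup M m"
proof -
  have r: "rcup M m \<in> carrier (ob [Down, Up] M)"
    using rcup_closed[OF M m] ob_Cons[OF M, of Down Up "[]"] by simp
  have ba: "homog ((Id [Down] \<boxtimes> Gen UPlus \<boxtimes> Id [Down]) \<bullet> (Id [Down] \<boxtimes> Id [Up] \<boxtimes> Gen CupL)) [Down, Up] [Down, Up, Up, Down] 0"
    by (rule homog_cmp[OF bubble_types(7,5)]) simp
  have l: "homog lplus [Down, Up] [Up, Down] 0"
    unfolding lplus_def by (rule homog_cmp[OF bubble_types(8) ba]) simp
  have "C cupR M m = C (Gen RMinus) M (C (Gen CupL) M m)"
    unfolding cupR_def using M m by (intro C_cmp[OF homog_gen(2,4) M]) simp
  also have "\<dots> = C (Gen RMinus \<bullet> lplus) M (rcup M m)"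
    unfolding C_cmp[OF homog_gen(2) l M r] C_lplus[OF M m] ..
  also have "\<dots> = C (Id [Down, Up]) M (rcup M m)"
    by (subst C_rel[of "Gen RMinus \<bullet> lplus" "Id [Down, Up]"]) (auto simp: AQ_rels_def Q_rels_def)
  also have "\<dots> = rcup M m" using C_Id[OF M r] .
  finally show ?thesis .
qed

section \<open>The bubble on the regular representation\<close>

abbreviation reg :: "'a vect supermod" where
  "reg \<equiv> regular n"

lemma reg_obj: "obj reg"
  by (rule supermodule_regular)

lemma vec_closed: "B \<in> carrier M1 \<Longrightarrow> j \<in> I \<Longrightarrow> vec B j \<in> carrier (ob [Up] reg)"
  unfolding vec_def using reg_obj by (intro Tup_closed) (simp_all add: U.Mat_entry)

abbreviation "Amat \<equiv> Jm \<otimes>\<^bsub>M1\<^esub> (Nmat \<otimes>\<^bsub>M1\<^esub> (Jm \<otimes>\<^bsub>M1\<^esub> Nimat))"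

lemma C_co_power:
  assumes B: "B \<in> carrier M1" and j: "j \<in> I"
  shows "C (co_power k) reg (vec B j) = vec (Amat [^]\<^bsub>M1\<^esub> k \<otimes>\<^bsub>M1\<^esub> B) j"
proof (induction k)
  case 0
  show ?case using C_Id[OF reg_obj vec_closed[OF B j]] B by simp
next
  case (Suc k)
  let ?B = "Amat [^]\<^bsub>M1\<^esub> k \<otimes>\<^bsub>M1\<^esub> B"
  have B': "?B \<in> carrier M1" using B by simp
  let ?B' = "Nmat \<otimes>\<^bsub>M1\<^esub> (Jm \<otimes>\<^bsub>M1\<^esub> (Nimat \<otimes>\<^bsub>M1\<^esub> ?B))"
  have B'': "?B' \<in> carrier M1" using B by simp
  have co: "homog (Gen CDot \<bullet> Gen ODot) [Up] [Up] 0"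
    by (rule homog_cmp[OF homog_gen(5,6)]) simp
  have "C (co_power (Suc k)) reg (vec B j) = C (Gen CDot \<bullet> Gen ODot) reg (vec ?B j)"
    unfolding co_power.simps C_cmp[OF co homog_co_power reg_obj vec_closed[OF B j]] Suc ..
  also have "\<dots> = C (Gen CDot) reg (C (Gen ODot) reg (vec ?B j))"
    by (rule C_cmp[OF homog_gen(5,6) reg_obj vec_closed[OF B' j]])
  also have "\<dots> = C (Gen CDot) reg (vec ?B' j)"
    unfolding C_ODot[OF reg_obj vec_closed[OF B' j]] o_op_vec[OF B' j] ..
  also have "\<dots> = vec (Jm \<otimes>\<^bsub>M1\<^esub> ?B') j"
    unfolding C_CDot[OF reg_obj vec_closed[OF B'' j]] by (rule J_tensor_vec[OF B'' j])
  also have "Jm \<otimes>\<^bsub>M1\<^esub> ?B' = Amat \<otimes>\<^bsub>M1\<^esub> Amat [^]\<^bsub>M1\<^esub> k \<otimes>\<^bsub>M1\<^esub> B"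
    using B by (simp add: M1.m_assoc)
  also have "Amat \<otimes>\<^bsub>M1\<^esub> Amat [^]\<^bsub>M1\<^esub> k = Amat [^]\<^bsub>M1\<^esub> Suc k"
    by (subst M1.nat_pow_Suc2) auto
  finally show ?case .
qed

lemma Amat_pow: "Amat [^]\<^bsub>M1\<^esub> (k::nat) = Nmat \<otimes>\<^bsub>M1\<^esub> Wmat [^]\<^bsub>M1\<^esub> k \<otimes>\<^bsub>M1\<^esub> Nimat"
proof -
  have "Nmat \<otimes>\<^bsub>M1\<^esub> Wmat \<otimes>\<^bsub>M1\<^esub> Nimat = (Nmat \<otimes>\<^bsub>M1\<^esub> Nimat) \<otimes>\<^bsub>M1\<^esub> Amat"
    by (simp add: Wmat_def M1.m_assoc)
  then have "Amat = Nmat \<otimes>\<^bsub>M1\<^esub> Wmat \<otimes>\<^bsub>M1\<^esub> Nimat" by (simp add: Nmat_inv)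
  then show ?thesis using M1.conj_pow[of Nmat Nimat Wmat k] by (simp add: Nmat_inv)
qed

abbreviation "bubble m \<equiv> Gen CapL \<bullet> (Id [Down] \<boxtimes> co_power m) \<bullet> cupR"

lemma homog_bubble:
  "homog cupR [] [Down, Up] 0" "homog (Id [Down] \<boxtimes> co_power m) [Down, Up] [Down, Up] 0"
  "homog ((Id [Down] \<boxtimes> co_power m) \<bullet> cupR) [] [Down, Up] 0" "homog (bubble m) [] [] 0"
proof -
  show a: "homog cupR [] [Down, Up] 0"
    unfolding cupR_def by (rule homog_cmp[OF homog_gen(2,4)]) simp
  show b: "homog (Id [Down] \<boxtimes> co_power m) [Down, Up] [Down, Up] 0"
    by (rule homog_tens[OF bubble_types(1) homog_co_power]) simp_all
  show c: "homog ((Id [Down] \<boxtimes> co_power m) \<bullet> cupR) [] [Down, Up] 0"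
    by (rule homog_cmp[OF b a]) simp
  show "homog (bubble m) [] [] 0"
    by (rule homog_cmp[OF homog_gen(3) c]) simp
qed

lemma C_bubble:
  "C (bubble k) reg (Alg \<one>\<^bsub>Uq n\<^esub>) = Alg (U.tr (wt n) I (Amat [^]\<^bsub>M1\<^esub> k))"
proof -
  \<comment> \<open>The columns of the diagonal matrix \<open>?D\<close> are the coordinates of
    \<open>cup_R\<close> applied to 1, so \<open>C_co_power\<close> can be used column by
    column.\<close>
  let ?e = "Alg \<one>\<^bsub>Uq n\<^esub> :: 'a vect" and ?D = "U.monomial I (\<lambda>i. i) (wt n)"
  interpret R: abelian_group reg by (rule abelian_group_regular)
  have e: "?e \<in> carrier reg" "?e \<in> carrier (ob [] reg)" using reg_obj by simp_all
  have r: "rcup reg ?e \<in> carrier (ob [Down] (ob [Up] reg))" using rcup_closed[OF reg_obj e(1)] .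
  have du: "ob [Down, Up] reg = ob [Down] (ob [Up] reg)" by (rule ob_Cons[OF reg_obj])
  have rv: "coord (rcup reg ?e) a = vec ?D a" if "a \<in> I" for a
    using that unfolding rcup_def delta_def vec_def
    by (auto simp: U.monomial_def intro!: restrict_ext)
  let ?y = "Tup (\<lambda>a\<in>I. vec (Amat [^]\<^bsub>M1\<^esub> k \<otimes>\<^bsub>M1\<^esub> ?D) a)"
  have y: "C (Id [Down] \<boxtimes> co_power k) reg (rcup reg ?e) = ?y"
    unfolding C_Id_tens[OF homog_co_power reg_obj r]
    by (intro arg_cong[where f = Tup] restrict_ext) (simp add: rv C_co_power)
  have yc: "?y \<in> carrier (ob [Down, Up] reg)"
    unfolding y[symmetric] using r by (intro C_closed[OF homog_bubble(2) reg_obj]) (simp add: du)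
  have "C (bubble k) reg ?e = C (Gen CapL) reg ?y"
    unfolding C_cmp[OF homog_gen(3) homog_bubble(3) reg_obj e(2)] C_cmp[OF homog_bubble(2,1) reg_obj e(2)]
      C_cupR[OF reg_obj e(1)] y ..
  also have "\<dots> = (\<Oplus>\<^bsub>reg\<^esub>a\<in>I. coord (coord ?y a) a)"
    unfolding C_CapL[OF reg_obj yc] ev_tensor_def ..
  also have "\<dots> = (\<Oplus>\<^bsub>reg\<^esub>a\<in>I. Alg (wt n a \<odot>\<^bsub>Uq n\<^esub> (Amat [^]\<^bsub>M1\<^esub> k) a a))"
  proof (rule R.finsum_cong')
    have c: "(Amat [^]\<^bsub>M1\<^esub> k) a a \<in> carrier (Uq n)" if "a \<in> I" for a
      using that by (intro U.Mat_entry[of _ I]) simp_all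
    show "(\<lambda>a. Alg (wt n a \<odot>\<^bsub>Uq n\<^esub> (Amat [^]\<^bsub>M1\<^esub> k) a a)) \<in> I \<rightarrow> carrier reg"
      using c by simp
    fix a assume a: "a \<in> I"
    have "(Amat [^]\<^bsub>M1\<^esub> k \<otimes>\<^bsub>M1\<^esub> ?D) a a = wt n a \<odot>\<^bsub>Uq n\<^esub> (Amat [^]\<^bsub>M1\<^esub> k) a a"
      using a by (subst U.mult_monomial) simp_all
    then show "coord (coord ?y a) a = Alg (wt n a \<odot>\<^bsub>Uq n\<^esub> (Amat [^]\<^bsub>M1\<^esub> k) a a)"
      using a by (simp add: vec_def)
  qed simp
  also have "\<dots> = Alg (U.tr (wt n) I (Amat [^]\<^bsub>M1\<^esub> k))"
    unfolding U.tr_def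
    by (intro finsum_regular U.smult_closed U.Mat_entry[of "Amat [^]\<^bsub>M1\<^esub> k" I]) simp_all
  finally show ?thesis .
qed

lemma eval_bubble:
  assumes "k > 0"
  shows "eval_one n (amap F (zeta zz k)) =
    (\<Oplus>\<^bsub>Uq n\<^esub>i\<in>I. (ksgn (p i) * qq powi (2 * \<bar>i\<bar> - 2 * int n - 1)) \<odot>\<^bsub>Uq n\<^esub> ypow n S k i i)"
proof -
  have "eval_one n (amap F (zeta zz k)) = alg (C (bubble k) reg (Alg \<one>\<^bsub>Uq n\<^esub>))"
    by (simp add: eval_one_def zeta_def C_def)
  also have "\<dots> = U.tr (wt n) I (Amat [^]\<^bsub>M1\<^esub> k)" by (simp only: C_bubble vect.sel)
  finally show ?thesis
    using assms by (simp only: Amat_pow tr_conj tr_Wmat_pow)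
qed

section \<open>Centrality\<close>

text \<open>Right multiplications commute with the left action; the twist \<open>tw n s\<close> adds
  the sign that a module map of parity \<open>s\<close> has to produce when an element passes
  it.\<close>

lemma regular_right_mult:
  assumes y: "y \<in> hpart (Uq n) s"
  shows "smod_hom n s reg reg (\<lambda>x\<in>carrier reg. Alg (tw n s (alg x) \<otimes>\<^bsub>Uq n\<^esub> y))"
proof -
  have yc: "y \<in> carrier (Uq n)" using y hpart_sub by blast
  have hc: "x \<in> carrier (Uq n)" if "x \<in> hpart (Uq n) t" for x t using that hpart_sub by blast
  have h: "tw n s x \<otimes>\<^bsub>Uq n\<^esub> y \<in> hpart (Uq n) (s + t)" if "x \<in> hpart (Uq n) t" for x t
    using Uq_hpart_mult[OF tw_hpart_closed[OF that, of s] y] by (simp add: add.commute)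
  show ?thesis
    unfolding smod_hom_def
    using yc h hc
    by (auto simp: tw_add tw_mult tw_smult U.l_distr U.smult_left tw_hpart U.m_assoc)
qed

text \<open>Let \<open>z\<close> be the value of the component at 1. Along right multiplication by
  \<open>y\<close>, naturality at 1 gives \<open>z y\<close>, up to a twist of \<open>z\<close>, as
  the value at \<open>y\<close>; linearity of the component gives \<open>y z\<close>. The twist is
  trivial because \<open>z\<close> is even.\<close>

lemma bubble_central:
  assumes y: "y \<in> hpart (Uq n) s"
  shows "eval_one n (amap F (zeta zz k)) \<in> hpart (Uq n) 0"
    and "eval_one n (amap F (zeta zz k)) \<otimes>\<^bsub>Uq n\<^esub> y = y \<otimes>\<^bsub>Uq n\<^esub> eval_one n (amap F (zeta zz k))"
proof -
  let ?e = "Alg \<one>\<^bsub>Uq n\<^esub> :: 'a vect" and ?g = "C (bubble k) reg"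
  define z where "z = eval_one n (amap F (zeta zz k))"
  have yc: "y \<in> carrier (Uq n)" using y hpart_sub by blast
  have g: "smod_hom n 0 reg reg ?g"
    using C_hom[OF homog_bubble(4) reg_obj] reg_obj by simp
  have "\<one>\<^bsub>Uq n\<^esub> \<in> hpart (Uq n) 0" by (auto simp: Uq_simps intro!: exI[of _ 1])
  then have "?g ?e \<in> hpart reg (0 + 0)" using g unfolding smod_hom_def by simp
  moreover have z: "z = alg (?g ?e)" by (simp add: z_def eval_one_def zeta_def C_def)
  ultimately have z0: "z \<in> hpart (Uq n) 0" and ge: "?g ?e = Alg z" by auto
  then show "eval_one n (amap F (zeta zz k)) \<in> hpart (Uq n) 0" by (simp add: z_def)
  have zc: "z \<in> carrier (Uq n)" using z0 hpart_sub by blast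
  let ?f = "\<lambda>x\<in>carrier reg. Alg (tw n s (alg x) \<otimes>\<^bsub>Uq n\<^esub> y) :: 'a vect"
  have f: "smod_hom n s reg reg ?f" using y by (rule regular_right_mult)
  from amap_homog[OF homog_bubble(4)[of k]]
  obtain \<alpha> where "amap F (cls zz (bubble k)) = (omap F [], \<alpha>, omap F [])" and a1: "supernat CC 0 (omap F []) (omap F []) \<alpha>"
    and a: "\<forall>M. obj M \<longrightarrow> \<alpha> M = (ob [] M, C (bubble k) M, ob [] M) \<and> smod_hom n 0 (ob [] M) (ob [] M) (C (bubble k) M)"
    by (elim exE conjE) (rule that)
  have a2: "\<alpha> reg = (reg, ?g, reg)"
    using conjunct1[OF mp[OF spec[OF a] reg_obj]] by (simp only: ob_Nil[OF reg_obj])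
  \<comment> \<open>The identity functor is specified only on \<open>arrows\<close>. An arrow is a
    sum of an even and an odd map, so the homogeneous \<open>?f\<close> is completed by the zero map
    of the other parity.\<close>
  have "(reg, ?f, reg) \<in> arrows CC"
  proof -
    have zr: "smod_hom n r reg reg (\<lambda>x\<in>carrier reg. \<zero>\<^bsub>reg\<^esub>)" for r
    proof -
      have z: "\<zero>\<^bsub>Uq n\<^esub> \<in> hpart (Uq n) t" for t by (auto simp: Uq_simps intro!: exI[of _ 0])
      show ?thesis
        unfolding smod_hom_def
        by (intro conjI ballI allI; clarsimp simp: z subsetD[OF hpart_sub])
    qed
    have "(reg, ?f, reg) \<in> carrier (smod_homs n reg reg)"
    proof (cases "s = 0")
      case True
      have f': "smod_hom n 0 reg reg ?f" using f True by (simp only:)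
      have "?f = (\<lambda>m\<in>carrier reg. ?f m \<oplus>\<^bsub>reg\<^esub> (\<lambda>x\<in>carrier reg. \<zero>\<^bsub>reg\<^esub>) m)"
        using yc by (intro restrict_ext) clarsimp
      then show ?thesis by (rule smod_homsI[OF f' zr])
    next
      case False
      then have "s = 1" using bit_cases by blast
      then have f': "smod_hom n 1 reg reg ?f" using f by (simp only:)
      have "?f = (\<lambda>m\<in>carrier reg. (\<lambda>x\<in>carrier reg. \<zero>\<^bsub>reg\<^esub>) m \<oplus>\<^bsub>reg\<^esub> ?f m)"
        using yc by (intro restrict_ext) clarsimp
      then show ?thesis by (rule smod_homsI[OF zr f'])
    qed
    then show ?thesis using reg_obj by (auto simp: arrows_def)
  qed
  then have Ff: "amap (omap F []) (reg, ?f, reg) = (reg, ?f, reg)"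
    by (simp add: omap_Nil SEnd_def)
  have o: "omap (omap F []) reg = reg" using ob_Nil[OF reg_obj] by (simp add: ob_def)
  have "cmp CC (amap (omap F []) (reg, ?f, reg)) (\<alpha> reg) =
      ksgn (0 * s) \<odot>\<^bsub>homs CC (omap (omap F []) reg) (omap (omap F []) reg)\<^esub> cmp CC (\<alpha> reg) (amap (omap F []) (reg, ?f, reg))"
    using a1 f reg_obj unfolding supernat_def by (auto simp del: mult_zero_left)
  then have "compose (carrier reg) ?f ?g = (\<lambda>m\<in>carrier reg. 1 \<odot>\<^bsub>reg\<^esub> compose (carrier reg) ?g ?f m)"
    unfolding Ff a2 o by (simp add: smod_homs_def)
  from fun_cong[OF this, of ?e]
  have "Alg (tw n s z \<otimes>\<^bsub>Uq n\<^esub> y) = 1 \<odot>\<^bsub>reg\<^esub> ?g (Alg y)"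
    using zc yc by (simp add: compose_def ge)
  moreover have "?g (Alg y) = Alg (y \<otimes>\<^bsub>Uq n\<^esub> z)"
  proof -
    have "?g (act reg y ?e) = ksgn (0 * s) \<odot>\<^bsub>reg\<^esub> act reg y (?g ?e)"
      using g y unfolding smod_hom_def by (auto simp del: mult_zero_left)
    then show ?thesis using yc zc by (simp add: ge)
  qed
  ultimately have "tw n s z \<otimes>\<^bsub>Uq n\<^esub> y = y \<otimes>\<^bsub>Uq n\<^esub> z" using yc zc by simp
  then have "z \<otimes>\<^bsub>Uq n\<^esub> y = y \<otimes>\<^bsub>Uq n\<^esub> z" using zc by (simp add: tw_hpart[OF z0])
  then show "eval_one n (amap F (zeta zz k)) \<otimes>\<^bsub>Uq n\<^esub> y = y \<otimes>\<^bsub>Uq n\<^esub> eval_one n (amap F (zeta zz k))"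
    by (simp add: z_def)
qed

lemma bubble_in_Zq: "eval_one n (amap F (zeta zz k)) \<in> Zq n"
proof -
  have z: "\<zero>\<^bsub>Uq n\<^esub> \<in> hpart (Uq n) t" for t by (auto simp: Uq_simps intro!: exI[of _ 0])
  let ?x = "eval_one n (amap F (zeta zz k))"
  \<comment> \<open>Zero is homogeneous of every parity and serves as an instance of
    \<open>y\<close>.\<close>
  have x: "?x \<in> hpart (Uq n) 0" by (rule bubble_central(1)[OF z])
  have c: "?x \<in> carrier (Uq n)" using x hpart_sub by blast
  have "\<forall>s. \<forall>y\<in>hpart (Uq n) s. ?x \<otimes>\<^bsub>Uq n\<^esub> y = ksgn (0 * s) \<odot>\<^bsub>Uq n\<^esub> (y \<otimes>\<^bsub>Uq n\<^esub> ?x)"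
  proof (intro allI ballI)
    fix s y assume y: "y \<in> hpart (Uq n) s"
    then have "y \<in> carrier (Uq n)" using hpart_sub by blast
    then show "?x \<otimes>\<^bsub>Uq n\<^esub> y = ksgn (0 * s) \<odot>\<^bsub>Uq n\<^esub> (y \<otimes>\<^bsub>Uq n\<^esub> ?x)"
      using c by (simp add: bubble_central(2)[OF y])
  qed
  \<comment> \<open>\<open>Zq\<close> consists of sums of an even and an odd central element; the
    odd one is taken to be zero.\<close>
  moreover have "\<forall>s. \<forall>y\<in>hpart (Uq n) s. \<zero>\<^bsub>Uq n\<^esub> \<otimes>\<^bsub>Uq n\<^esub> y = ksgn (1 * s) \<odot>\<^bsub>Uq n\<^esub> (y \<otimes>\<^bsub>Uq n\<^esub> \<zero>\<^bsub>Uq n\<^esub>)"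
    by (simp add: subsetD[OF hpart_sub])
  moreover have "?x = ?x \<oplus>\<^bsub>Uq n\<^esub> \<zero>\<^bsub>Uq n\<^esub>" using c by simp
  ultimately show ?thesis
    unfolding Zq_def Let_def using x z[of 1] by blast
qed

end

theorem proposition8p4:
  fixes n m :: nat
    and S :: "free set \<Rightarrow> free set"
    and \<rho> :: "free set \<Rightarrow> int \<Rightarrow> int \<Rightarrow> Cq"
    and F :: "'a aq_functor"
  assumes "n \<ge> 1" and "m > 0"
    and "antipode n S"
    and "vector_rep n \<rho>"
    and "is_Fhat n S \<rho> F"
  shows "eval_one n (amap F (zeta zz m)) \<in> Zq n \<and>
    eval_one n (amap F (zeta zz m)) =
      (\<Oplus>\<^bsub>Uq n\<^esub>i\<in>Idx n.
         (ksgn (p i) * qq powi (2 * \<bar>i\<bar> - 2 * int n - 1)) \<odot>\<^bsub>Uq n\<^esub> ypow n S m i i)"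
proof -
  interpret fhat n S \<rho> F
    using assms by unfold_locales
  show ?thesis using bubble_in_Zq eval_bubble[OF \<open>m > 0\<close>] by blast
qed

end
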